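(* Let $n\ge1$ and let $\Lambda_n$ be the algebra of lower triangular $n\times n$ matrices over a field. All modules are counted up to isomorphism. (i) If $k_{n,s}$ denotes the number of basic faithfully balanced $\Lambda_n$-modules with exactly $s$ indecomposable summands, then $$\sum_s k_{n,s}x^s=\prod_{i=1}^n\bigl((1+x)^i-1\bigr).$$ (ii) $$k_{n,s}=\sum_{\substack{(j_1,\dots,j_n):\ 1\le j_r\le r,\\ \sum_{r=1}^n j_r=s}}\binom1{j_1}\binom2{j_2}\cdots\binom n{j_n}.$$ (iii) The number of basic faithfully balanced $\Lambda_n$-modules is $[n]_2!:=\prod_{i=1}^n(2^i-1)$. The number of faithfully balanced $\Lambda_n$-modules in which the indecomposable summands have multiplicity at most $m$ is $\prod_{i=1}^n((1+m)^i-1)$. (iv) Any basic faithfully balanced $\Lambda_n$-module has at least $n$ indecomposable summands, and the number of basic faithfully balanced $\Lambda_n$-modules with exactly $n$ indecomposable summands is $n!$. (v) The direct sum of all indecomposable $\Lambda_n$-modules (one from each isomorphism class) is a faithfully balanced module with $N=n(n+1)/2$ indecomposable summands, and there are $N-1$ basic faithfully balanced $\Lambda_n$-modules with $N-1$ indecomposable summands.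
   Context: Modules are finitely generated left modules. A module $M$ over an algebra $\Lambda$ is faithfully balanced if the natural map $\Lambda\to\mathrm{End}_E(M)$, $E=\mathrm{End}_\Lambda(M)$, is bijective; it is basic if its indecomposable summands occur with multiplicity one. $\Lambda_n$ is equivalently the path algebra of the quiver $1\to2\to\cdots\to n$. *)

theory Defs
  imports
    Jordan_Normal_Form.Matrix
    "HOL-Algebra.Coset"
    "HOL-Algebra.AbelCoset"
    "HOL-Computational_Algebra.Formal_Power_Series"
begin

section \<open>Finitely generated left modules\<close>

text \<open>
  The locale \<^locale>\<open>module\<close> only covers commutative rings, so left modules over an arbitrary ring
  are introduced here on the same record type. The ring multiplication and unit of the module
  record carry no meaning and are never used.
\<close>

locale left_module = R?: ring R + M?: abelian_group M
  for R :: "('a, 'c) ring_scheme" and M :: "('a, 'm, 'd) module_scheme" (structure) +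
  assumes smult_closed [simp, intro]:
      "\<lbrakk>a \<in> carrier R; x \<in> carrier M\<rbrakk> \<Longrightarrow> a \<odot>\<^bsub>M\<^esub> x \<in> carrier M"
    and smult_l_distr:
      "\<lbrakk>a \<in> carrier R; b \<in> carrier R; x \<in> carrier M\<rbrakk> \<Longrightarrow>
        (a \<oplus>\<^bsub>R\<^esub> b) \<odot>\<^bsub>M\<^esub> x = (a \<odot>\<^bsub>M\<^esub> x) \<oplus>\<^bsub>M\<^esub> (b \<odot>\<^bsub>M\<^esub> x)"
    and smult_r_distr:
      "\<lbrakk>a \<in> carrier R; x \<in> carrier M; y \<in> carrier M\<rbrakk> \<Longrightarrow>
        a \<odot>\<^bsub>M\<^esub> (x \<oplus>\<^bsub>M\<^esub> y) = (a \<odot>\<^bsub>M\<^esub> x) \<oplus>\<^bsub>M\<^esub> (a \<odot>\<^bsub>M\<^esub> y)"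
    and smult_assoc:
      "\<lbrakk>a \<in> carrier R; b \<in> carrier R; x \<in> carrier M\<rbrakk> \<Longrightarrow>
        (a \<otimes>\<^bsub>R\<^esub> b) \<odot>\<^bsub>M\<^esub> x = a \<odot>\<^bsub>M\<^esub> (b \<odot>\<^bsub>M\<^esub> x)"
    and smult_one [simp]:
      "x \<in> carrier M \<Longrightarrow> \<one>\<^bsub>R\<^esub> \<odot>\<^bsub>M\<^esub> x = x"

definition fg_module :: "('a, 'c) ring_scheme \<Rightarrow> ('a, 'm, 'd) module_scheme \<Rightarrow> bool" where
  "fg_module R M \<longleftrightarrow> left_module R M \<and>
     (\<exists>S. finite S \<and> S \<subseteq> carrier M \<and> (\<forall>H. submodule H R M \<and> S \<subseteq> H \<longrightarrow> H = carrier M))"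

text \<open>Homomorphisms are extensional, so that equal homomorphisms are equal as HOL functions.\<close>

definition mod_hom ::
  "('a, 'c) ring_scheme \<Rightarrow> ('a, 'm, 'd) module_scheme \<Rightarrow> ('a, 'p, 'e) module_scheme \<Rightarrow> ('m \<Rightarrow> 'p) set"
  where
  "mod_hom R M N = {f \<in> hom (add_monoid M) (add_monoid N) \<inter> extensional (carrier M).
     \<forall>a\<in>carrier R. \<forall>x\<in>carrier M. f (a \<odot>\<^bsub>M\<^esub> x) = a \<odot>\<^bsub>N\<^esub> f x}"

definition mod_iso ::
  "('a, 'c) ring_scheme \<Rightarrow> ('a, 'm, 'd) module_scheme \<Rightarrow> ('a, 'p, 'e) module_scheme \<Rightarrow> bool" where
  "mod_iso R M N \<longleftrightarrow> (\<exists>f\<in>mod_hom R M N. bij_betw f (carrier M) (carrier N))"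

definition num_iso_classes :: "('a, 'c) ring_scheme \<Rightarrow> ('a, 'm, 'd) module_scheme set \<Rightarrow> nat" where
  "num_iso_classes R \<M> = card (\<M> // {(M, N). M \<in> \<M> \<and> N \<in> \<M> \<and> mod_iso R M N})"

definition direct_sum ::
  "'i set \<Rightarrow> ('i \<Rightarrow> ('a, 'm, 'd) module_scheme) \<Rightarrow> ('a, 'i \<Rightarrow> 'm) module" where
  "direct_sum I X =
     \<lparr>carrier = {x \<in> \<Pi>\<^sub>E i\<in>I. carrier (X i). finite {i \<in> I. x i \<noteq> \<zero>\<^bsub>X i\<^esub>}},
      mult = undefined,
      one = undefined,
      zero = (\<lambda>i\<in>I. \<zero>\<^bsub>X i\<^esub>),
      add = (\<lambda>x y. \<lambda>i\<in>I. x i \<oplus>\<^bsub>X i\<^esub> y i),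
      smult = (\<lambda>a x. \<lambda>i\<in>I. a \<odot>\<^bsub>X i\<^esub> x i)\<rparr>"


section \<open>Faithfully balanced modules\<close>

definition End_ring :: "('a, 'c) ring_scheme \<Rightarrow> ('a, 'm, 'd) module_scheme \<Rightarrow> ('m \<Rightarrow> 'm) ring" where
  "End_ring R M =
     \<lparr>carrier = mod_hom R M M,
      mult = compose (carrier M),
      one = (\<lambda>x\<in>carrier M. x),
      zero = (\<lambda>x\<in>carrier M. \<zero>\<^bsub>M\<^esub>),
      add = (\<lambda>f g. \<lambda>x\<in>carrier M. f x \<oplus>\<^bsub>M\<^esub> g x)\<rparr>"

text \<open>\<open>M\<close> as a left module over its endomorphism ring, acting by evaluation.\<close>

definition End_module :: "('a, 'm, 'd) module_scheme \<Rightarrow> ('m \<Rightarrow> 'm, 'm) module" where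
  "End_module M =
     \<lparr>carrier = carrier M, mult = mult M, one = one M, zero = zero M, add = add M,
      smult = (\<lambda>f x. f x)\<rparr>"

definition faithfully_balanced ::
  "('a, 'c) ring_scheme \<Rightarrow> ('a, 'm, 'd) module_scheme \<Rightarrow> bool" where
  "faithfully_balanced R M \<longleftrightarrow>
     bij_betw (\<lambda>a. \<lambda>x\<in>carrier M. a \<odot>\<^bsub>M\<^esub> x) (carrier R)
       (carrier (End_ring (End_ring R M) (End_module M)))"


section \<open>Indecomposable summands\<close>

definition indecomposable :: "('a, 'c) ring_scheme \<Rightarrow> ('a, 'm, 'd) module_scheme \<Rightarrow> bool" where
  "indecomposable R M \<longleftrightarrow> carrier M \<noteq> {\<zero>\<^bsub>M\<^esub>} \<and>
     (\<forall>H K. submodule H R M \<and> submodule K R M \<and> H \<inter> K = {\<zero>\<^bsub>M\<^esub>} \<and> H <+>\<^bsub>M\<^esub> K = carrier M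
        \<longrightarrow> H = {\<zero>\<^bsub>M\<^esub>} \<or> K = {\<zero>\<^bsub>M\<^esub>})"

text \<open>
  \<open>M\<close> is isomorphic to the direct sum of the indecomposable modules \<open>X 0, \<dots>, X (s - 1)\<close>.
  Taking the \<open>X i\<close> of the same type as \<open>M\<close> is no restriction, since direct summands of \<open>M\<close> are
  isomorphic to submodules of \<open>M\<close>. For the algebras considered below, the number \<open>s\<close> and the
  multiplicities depend only on \<open>M\<close> by the Krull-Schmidt theorem.
\<close>

definition indec_decomposition ::
  "('a, 'c) ring_scheme \<Rightarrow> ('a, 'm) module \<Rightarrow> nat \<Rightarrow> (nat \<Rightarrow> ('a, 'm) module) \<Rightarrow> bool" where
  "indec_decomposition R M s X \<longleftrightarrow>
     (\<forall>i<s. fg_module R (X i) \<and> indecomposable R (X i)) \<and> mod_iso R M (direct_sum {..<s} X)"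

definition has_num_summands :: "('a, 'c) ring_scheme \<Rightarrow> ('a, 'm) module \<Rightarrow> nat \<Rightarrow> bool" where
  "has_num_summands R M s \<longleftrightarrow> (\<exists>X. indec_decomposition R M s X)"

definition multiplicity_in ::
  "('a, 'c) ring_scheme \<Rightarrow> nat \<Rightarrow> (nat \<Rightarrow> ('a, 'm) module) \<Rightarrow> nat \<Rightarrow> nat" where
  "multiplicity_in R s X i = card {j \<in> {..<s}. mod_iso R (X j) (X i)}"

definition multiplicities_at_most :: "('a, 'c) ring_scheme \<Rightarrow> nat \<Rightarrow> ('a, 'm) module \<Rightarrow> bool" where
  "multiplicities_at_most R m M \<longleftrightarrow>
     (\<exists>s X. indec_decomposition R M s X \<and> (\<forall>i<s. multiplicity_in R s X i \<le> m))"

definition basic :: "('a, 'c) ring_scheme \<Rightarrow> ('a, 'm) module \<Rightarrow> bool" where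
  "basic R M \<longleftrightarrow>
     (\<exists>s X. indec_decomposition R M s X \<and> (\<forall>i<s. multiplicity_in R s X i = 1))"


section \<open>The algebra of lower triangular matrices and its modules\<close>

definition lower_tri_algebra :: "'k::field itself \<Rightarrow> nat \<Rightarrow> 'k mat ring" where
  "lower_tri_algebra k n =
     (ring_mat k n ())\<lparr>carrier := {A \<in> carrier_mat n n. \<forall>i<n. \<forall>j<n. i < j \<longrightarrow> A $$ (i, j) = 0}\<rparr>"

text \<open>
  The modules whose underlying set consists of functions \<^typ>\<open>nat \<Rightarrow> 'k\<close>. A finitely generated module
  over the lower triangular matrices is finite-dimensional over the field, so its underlying vector
  space is isomorphic to the space of functions supported on an initial segment of the natural
  numbers; hence every isomorphism class of finitely generated modules is represented here.
\<close>

type_synonym 'k tri_module = "('k mat, nat \<Rightarrow> 'k) module"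

definition tri_modules :: "'k::field itself \<Rightarrow> nat \<Rightarrow> 'k tri_module set" where
  "tri_modules k n = {M. fg_module (lower_tri_algebra k n) M}"

definition fb_modules :: "'k::field itself \<Rightarrow> nat \<Rightarrow> 'k tri_module set" where
  "fb_modules k n = {M \<in> tri_modules k n. faithfully_balanced (lower_tri_algebra k n) M}"

definition basic_fb_modules :: "'k::field itself \<Rightarrow> nat \<Rightarrow> 'k tri_module set" where
  "basic_fb_modules k n = {M \<in> fb_modules k n. basic (lower_tri_algebra k n) M}"

definition num_basic_fb :: "'k::field itself \<Rightarrow> nat \<Rightarrow> nat \<Rightarrow> nat" where
  "num_basic_fb k n s =
     num_iso_classes (lower_tri_algebra k n)
       {M \<in> basic_fb_modules k n. has_num_summands (lower_tri_algebra k n) M s}"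

definition indec_representatives :: "'k::field itself \<Rightarrow> nat \<Rightarrow> 'k tri_module set \<Rightarrow> bool" where
  "indec_representatives k n T \<longleftrightarrow>
     T \<subseteq> {X \<in> tri_modules k n. indecomposable (lower_tri_algebra k n) X} \<and>
     (\<forall>Y\<in>tri_modules k n. indecomposable (lower_tri_algebra k n) Y \<longrightarrow>
        (\<exists>!X. X \<in> T \<and> mod_iso (lower_tri_algebra k n) Y X))"

end

theory Submission
  imports
    Defs
    "HOL-Combinatorics.List_Permutation"
    "HOL-Library.Function_Algebras"
    "HOL-Library.Nat_Bijection"
begin

text \<open>
  A module over the lower triangular matrices is a representation of the linear quiver, hence a direct
  sum of interval modules \<open>[a, b]\<close>, and the multiset of these intervals is determined by the ranks of
  the structure maps. Maps between interval modules are multiples of the identity on the common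
  vertices, so the bicommutant of a direct sum of interval modules splits, matrix entry by matrix
  entry, into elementary conditions. They show that being faithfully balanced depends only on the set
  \<open>S\<close> of intervals that occur, and that it means: \<open>S\<close> contains the longest interval, every other
  interval of \<open>S\<close> can be prolonged within \<open>S\<close> at one end with the other end fixed, and every inner vertex \<open>p\<close> is
  the first vertex of some interval of \<open>S\<close>, or \<open>p - 1\<close> is the last one.

  To count such \<open>S\<close> with weight \<open>x ^ card S\<close>, view them as fillings of a staircase shape whose columns
  are the right end points and give a cell of the first column the weight \<open>u\<close> instead of \<open>x\<close>. Merging
  the first two columns, one obtains \<open>F (n + 1) u = u * F n (u + x + u * x)\<close> for the generating functions,
  so \<open>F n u\<close> is the product of the factors \<open>(1 + u) * (1 + x) ^ i - 1\<close> for \<open>i < n\<close>.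
\<close>

section \<open>Module homomorphisms and direct sums\<close>

text \<open>The Krull-Schmidt property is not presupposed; it comes out of the ranks and turns all
  counts into counts of multisets of intervals. For a fixed matrix position (q, p) the unknowns in a
  bicommuting map are its entries on the summands containing p and q, and these are tied together by
  the maps between summands. There should be one free parameter for p \<le> q and none for q < p.
  Prolongation leads from every interval to the longest one, so all entries at a position agree; for
  q < p the condition on inner vertices provides an interval from which prolongation must run into a
  map that forces the entry to vanish. In the count, the second weight u is unavoidable: prolonging
  to the right only asks whether a row is occupied farther right, so two columns may be replaced by
  their union, but a row of the union stands for a cell in the one, in the other or in both and has
  weight u + x + u * x instead of x. Since 1 + (u + x + u * x) = (1 + u) * (1 + x), every merging
  multiplies 1 + u by 1 + x, which is where the powers come from.\<close>

definition lin ::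
  "('a, 'c) ring_scheme \<Rightarrow> ('a, 'm, 'd) module_scheme \<Rightarrow> ('a, 'p, 'e) module_scheme \<Rightarrow> ('m \<Rightarrow> 'p) \<Rightarrow> bool"
  where "lin R M N f \<longleftrightarrow> f \<in> carrier M \<rightarrow> carrier N \<and>
    (\<forall>x\<in>carrier M. \<forall>y\<in>carrier M. f (x \<oplus>\<^bsub>M\<^esub> y) = f x \<oplus>\<^bsub>N\<^esub> f y) \<and>
    (\<forall>a\<in>carrier R. \<forall>x\<in>carrier M. f (a \<odot>\<^bsub>M\<^esub> x) = a \<odot>\<^bsub>N\<^esub> f x)"

lemma linI:
  assumes "\<And>x. x \<in> carrier M \<Longrightarrow> f x \<in> carrier N"
    and "\<And>x y. x \<in> carrier M \<Longrightarrow> y \<in> carrier M \<Longrightarrow> f (x \<oplus>\<^bsub>M\<^esub> y) = f x \<oplus>\<^bsub>N\<^esub> f y"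
    and "\<And>a x. a \<in> carrier R \<Longrightarrow> x \<in> carrier M \<Longrightarrow> f (a \<odot>\<^bsub>M\<^esub> x) = a \<odot>\<^bsub>N\<^esub> f x"
  shows "lin R M N f"
  using assms by (auto simp: lin_def)

lemma linD:
  assumes "lin R M N f"
  shows "x \<in> carrier M \<Longrightarrow> f x \<in> carrier N"
    and "x \<in> carrier M \<Longrightarrow> y \<in> carrier M \<Longrightarrow> f (x \<oplus>\<^bsub>M\<^esub> y) = f x \<oplus>\<^bsub>N\<^esub> f y"
    and "a \<in> carrier R \<Longrightarrow> x \<in> carrier M \<Longrightarrow> f (a \<odot>\<^bsub>M\<^esub> x) = a \<odot>\<^bsub>N\<^esub> f x"
  using assms by (auto simp: lin_def)

definition lin_iso ::
  "('a, 'c) ring_scheme \<Rightarrow> ('a, 'm, 'd) module_scheme \<Rightarrow> ('a, 'p, 'e) module_scheme \<Rightarrow> ('m \<Rightarrow> 'p) \<Rightarrow> bool"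
  where "lin_iso R M N f \<longleftrightarrow> lin R M N f \<and> bij_betw f (carrier M) (carrier N)"

lemma left_module_ops:
  assumes "left_module R M"
  shows "abelian_group M" "ring R"
    and "x \<in> carrier M \<Longrightarrow> y \<in> carrier M \<Longrightarrow> x \<oplus>\<^bsub>M\<^esub> y \<in> carrier M"
    and "a \<in> carrier R \<Longrightarrow> x \<in> carrier M \<Longrightarrow> a \<odot>\<^bsub>M\<^esub> x \<in> carrier M"
    and "\<zero>\<^bsub>M\<^esub> \<in> carrier M"
proof -
  interpret left_module R M by fact
  show "abelian_group M" "ring R" by unfold_locales
  show "x \<in> carrier M \<Longrightarrow> y \<in> carrier M \<Longrightarrow> x \<oplus>\<^bsub>M\<^esub> y \<in> carrier M"
    "a \<in> carrier R \<Longrightarrow> x \<in> carrier M \<Longrightarrow> a \<odot>\<^bsub>M\<^esub> x \<in> carrier M"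
    "\<zero>\<^bsub>M\<^esub> \<in> carrier M" by auto
qed

text \<open>\<open>lin\<close> omits the extensionality of \<open>mod_hom\<close>, so that
  composites and inverses are plain functions; restriction to the carrier restores it.\<close>

lemma restrict_lin_mod_hom:
  assumes "left_module R M" "lin R M N f"
  shows "restrict f (carrier M) \<in> mod_hom R M N"
  using assms left_module_ops(3,4)[OF assms(1)] by (auto simp: mod_hom_def lin_def hom_def)

lemma mod_hom_lin:
  assumes "f \<in> mod_hom R M N"
  shows "lin R M N f"
  using assms by (auto simp: mod_hom_def lin_def hom_def)

lemma mod_iso_iff:
  assumes "left_module R M"
  shows "mod_iso R M N \<longleftrightarrow> (\<exists>f. lin_iso R M N f)"
proof
  assume "mod_iso R M N"
  thus "\<exists>f. lin_iso R M N f" unfolding mod_iso_def lin_iso_def using mod_hom_lin by blast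
next
  assume "\<exists>f. lin_iso R M N f"
  then obtain f where f: "lin R M N f" "bij_betw f (carrier M) (carrier N)" unfolding lin_iso_def by blast
  have "bij_betw (restrict f (carrier M)) (carrier M) (carrier N)"
    using f(2) by (simp cong: bij_betw_cong)
  thus "mod_iso R M N" unfolding mod_iso_def using restrict_lin_mod_hom[OF assms f(1)] by blast
qed

lemma lin_compose: "lin R M N f \<Longrightarrow> lin R N P g \<Longrightarrow> lin R M P (\<lambda>x. g (f x))"
  unfolding lin_def by (auto simp: Pi_iff)

lemma lin_iso_compose: "lin_iso R M N f \<Longrightarrow> lin_iso R N P g \<Longrightarrow> lin_iso R M P (\<lambda>x. g (f x))"
  unfolding lin_iso_def using lin_compose bij_betw_trans[of f _ _ g] by (auto simp: comp_def)

lemma lin_iso_inverse: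
  assumes M: "left_module R M" and f: "lin_iso R M N f"
  obtains g where "lin_iso R N M g"
    "\<And>x. x \<in> carrier M \<Longrightarrow> g (f x) = x" "\<And>y. y \<in> carrier N \<Longrightarrow> f (g y) = y"
proof -
  let ?g = "inv_into (carrier M) f"
  have lin: "lin R M N f" and bij: "bij_betw f (carrier M) (carrier N)"
    using f by (auto simp: lin_iso_def)
  have gf: "?g (f x) = x" if "x \<in> carrier M" for x
    using that bij by (simp add: bij_betw_inv_into_left)
  have fg: "f (?g y) = y" and gc: "?g y \<in> carrier M" if "y \<in> carrier N" for y
    using that bij by (simp_all add: bij_betw_inv_into_right bij_betw_imp_surj_on inv_into_into)
  have "lin R N M ?g"
  proof (rule linI)
    fix x y assume xy: "x \<in> carrier N" "y \<in> carrier N"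
    have "f (?g x \<oplus>\<^bsub>M\<^esub> ?g y) = x \<oplus>\<^bsub>N\<^esub> y"
      using xy by (simp add: linD(2)[OF lin] fg gc)
    thus "?g (x \<oplus>\<^bsub>N\<^esub> y) = ?g x \<oplus>\<^bsub>M\<^esub> ?g y"
      using gf[of "?g x \<oplus>\<^bsub>M\<^esub> ?g y"] left_module_ops(3)[OF M] gc xy by simp
  next
    fix a x assume ax: "a \<in> carrier R" "x \<in> carrier N"
    have "f (a \<odot>\<^bsub>M\<^esub> ?g x) = a \<odot>\<^bsub>N\<^esub> x"
      using ax by (simp add: linD(3)[OF lin] fg gc)
    thus "?g (a \<odot>\<^bsub>N\<^esub> x) = a \<odot>\<^bsub>M\<^esub> ?g x"
      using gf[of "a \<odot>\<^bsub>M\<^esub> ?g x"] left_module_ops(4)[OF M] gc ax by simp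
  qed (rule gc)
  moreover have "bij_betw ?g (carrier N) (carrier M)" using bij by (rule bij_betw_inv_into)
  ultimately show ?thesis using that gf fg by (auto simp: lin_iso_def)
qed

lemma mod_iso_sym: "left_module R M \<Longrightarrow> left_module R N \<Longrightarrow> mod_iso R M N \<Longrightarrow> mod_iso R N M"
  using lin_iso_inverse mod_iso_iff by metis

lemma mod_iso_trans:
  "left_module R M \<Longrightarrow> left_module R N \<Longrightarrow> mod_iso R M N \<Longrightarrow> mod_iso R N P \<Longrightarrow> mod_iso R M P"
  using lin_iso_compose mod_iso_iff by metis

lemma lin_zero:
  assumes "left_module R M" "left_module R N" "lin R M N f"
  shows "f \<zero>\<^bsub>M\<^esub> = \<zero>\<^bsub>N\<^esub>"
proof -
  interpret M: left_module R M by fact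
  interpret N: left_module R N by fact
  have "f \<zero>\<^bsub>M\<^esub> \<oplus>\<^bsub>N\<^esub> f \<zero>\<^bsub>M\<^esub> = f \<zero>\<^bsub>M\<^esub>"
    using linD(2)[OF assms(3), of "\<zero>\<^bsub>M\<^esub>" "\<zero>\<^bsub>M\<^esub>"] by simp
  thus ?thesis using linD(1)[OF assms(3), of "\<zero>\<^bsub>M\<^esub>"] by simp
qed

lemma (in left_module) smult_zero_left: "x \<in> carrier M \<Longrightarrow> \<zero>\<^bsub>R\<^esub> \<odot>\<^bsub>M\<^esub> x = \<zero>\<^bsub>M\<^esub>"
  using smult_l_distr[of "\<zero>\<^bsub>R\<^esub>" "\<zero>\<^bsub>R\<^esub>" x] by simp

lemma (in left_module) smult_zero_right: "a \<in> carrier R \<Longrightarrow> a \<odot>\<^bsub>M\<^esub> \<zero>\<^bsub>M\<^esub> = \<zero>\<^bsub>M\<^esub>"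
  using smult_r_distr[of a "\<zero>\<^bsub>M\<^esub>" "\<zero>\<^bsub>M\<^esub>"] by simp

lemma (in left_module) smult_minus_one:
  assumes "x \<in> carrier M" shows "(\<ominus>\<^bsub>R\<^esub> \<one>\<^bsub>R\<^esub>) \<odot>\<^bsub>M\<^esub> x = \<ominus>\<^bsub>M\<^esub> x"
proof -
  have "(\<ominus>\<^bsub>R\<^esub> \<one>\<^bsub>R\<^esub>) \<odot>\<^bsub>M\<^esub> x \<oplus>\<^bsub>M\<^esub> x = \<zero>\<^bsub>M\<^esub>"
    using smult_l_distr[of "\<ominus>\<^bsub>R\<^esub> \<one>\<^bsub>R\<^esub>" "\<one>\<^bsub>R\<^esub>" x] assms by (simp add: R.l_neg smult_zero_left)
  thus ?thesis using assms by (metis M.minus_equality R.a_inv_closed R.one_closed smult_closed)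
qed

text \<open>Closure under negatives comes from the action of the ring element
  \<open>\<ominus> \<one>\<close>.\<close>

lemma submodule_iff:
  assumes "left_module R M"
  shows "submodule H R M \<longleftrightarrow> H \<subseteq> carrier M \<and> \<zero>\<^bsub>M\<^esub> \<in> H \<and>
    (\<forall>x\<in>H. \<forall>y\<in>H. x \<oplus>\<^bsub>M\<^esub> y \<in> H) \<and> (\<forall>a\<in>carrier R. \<forall>x\<in>H. a \<odot>\<^bsub>M\<^esub> x \<in> H)"
proof -
  interpret left_module R M by fact
  show ?thesis
  proof
    assume "submodule H R M"
    then interpret submodule H R M .
    show "H \<subseteq> carrier M \<and> \<zero>\<^bsub>M\<^esub> \<in> H \<and>
      (\<forall>x\<in>H. \<forall>y\<in>H. x \<oplus>\<^bsub>M\<^esub> y \<in> H) \<and> (\<forall>a\<in>carrier R. \<forall>x\<in>H. a \<odot>\<^bsub>M\<^esub> x \<in> H)"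
      using subset m_closed one_closed smult_closed by auto
  next
    assume *: "H \<subseteq> carrier M \<and> \<zero>\<^bsub>M\<^esub> \<in> H \<and>
      (\<forall>x\<in>H. \<forall>y\<in>H. x \<oplus>\<^bsub>M\<^esub> y \<in> H) \<and> (\<forall>a\<in>carrier R. \<forall>x\<in>H. a \<odot>\<^bsub>M\<^esub> x \<in> H)"
    have "\<ominus>\<^bsub>M\<^esub> x \<in> H" if "x \<in> H" for x
      using that * smult_minus_one[of x] by (metis R.a_inv_closed R.one_closed subsetD)
    thus "submodule H R M"
      using * by unfold_locales (auto simp: a_inv_def)
  qed
qed

lemma submoduleD:
  assumes "left_module R M" "submodule H R M"
  shows "H \<subseteq> carrier M" "\<zero>\<^bsub>M\<^esub> \<in> H"
    and "x \<in> H \<Longrightarrow> y \<in> H \<Longrightarrow> x \<oplus>\<^bsub>M\<^esub> y \<in> H"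
    and "a \<in> carrier R \<Longrightarrow> x \<in> H \<Longrightarrow> a \<odot>\<^bsub>M\<^esub> x \<in> H"
  using assms(2) unfolding submodule_iff[OF assms(1)] by simp_all

lemma submodule_image:
  assumes M: "left_module R M" and N: "left_module R N" and f: "lin R M N f"
    and H: "submodule H R M"
  shows "submodule (f ` H) R N"
proof -
  have HM: "x \<in> H \<Longrightarrow> x \<in> carrier M" for x using H submoduleD(1)[OF M] by blast
  show ?thesis
    unfolding submodule_iff[OF N]
  proof (intro conjI ballI)
    show "f ` H \<subseteq> carrier N" using linD(1)[OF f] HM by blast
    show "\<zero>\<^bsub>N\<^esub> \<in> f ` H" using submoduleD(2)[OF M H] lin_zero[OF M N f] by (metis image_eqI)
    show "x \<oplus>\<^bsub>N\<^esub> y \<in> f ` H" if xy: "x \<in> f ` H" "y \<in> f ` H" for x y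
    proof -
      obtain u v where uv: "u \<in> H" "v \<in> H" "x = f u" "y = f v" using xy by blast
      thus ?thesis using linD(2)[OF f HM HM, of u v] submoduleD(3)[OF M H, of u v] by (metis image_eqI)
    qed
    show "a \<odot>\<^bsub>N\<^esub> x \<in> f ` H" if ax: "a \<in> carrier R" "x \<in> f ` H" for a x
    proof -
      obtain u where uv: "u \<in> H" "x = f u" using ax by blast
      thus ?thesis using linD(3)[OF f ax(1) HM, of u] submoduleD(4)[OF M H ax(1), of u] by (metis image_eqI)
    qed
  qed
qed

lemma fg_module_iso:
  assumes M: "fg_module R M" and N: "left_module R N" and f: "lin_iso R M N f"
  shows "fg_module R N"
proof -
  have LM: "left_module R M" using M by (simp add: fg_module_def)
  obtain S where S': "finite S \<and> S \<subseteq> carrier M \<and> (\<forall>H. submodule H R M \<and> S \<subseteq> H \<longrightarrow> H = carrier M)"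
    using M unfolding fg_module_def by (elim conjE exE) metis
  hence S: "finite S" "S \<subseteq> carrier M" and gen: "submodule H R M \<Longrightarrow> S \<subseteq> H \<Longrightarrow> H = carrier M" for H
    by auto
  obtain g where g: "lin_iso R N M g" and gf: "\<And>x. x \<in> carrier M \<Longrightarrow> g (f x) = x"
    and fg: "\<And>y. y \<in> carrier N \<Longrightarrow> f (g y) = y" using lin_iso_inverse[OF LM f] by metis
  have lf: "lin R M N f" and lg: "lin R N M g" using f g by (auto simp: lin_iso_def)
  have "H = carrier N" if H: "submodule H R N" "f ` S \<subseteq> H" for H
  proof -
    have HN: "H \<subseteq> carrier N" using submoduleD(1)[OF N H(1)] .
    have "S \<subseteq> g ` H" using H(2) gf S(2) by (force simp: image_iff)
    hence "g ` H = carrier M" using gen submodule_image[OF N LM lg H(1)] by blast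
    hence "y \<in> H" if "y \<in> carrier N" for y
      using linD(1)[OF lg that] fg[OF that] fg HN by (metis imageE subsetD)
    thus ?thesis using HN by blast
  qed
  moreover have "f ` S \<subseteq> carrier N" using linD(1)[OF lf] S(2) by blast
  ultimately show ?thesis unfolding fg_module_def using N S(1) by blast
qed

lemma indecomposable_iso:
  assumes M: "left_module R M" and N: "left_module R N" and f: "lin_iso R M N f"
    and ind: "indecomposable R M"
  shows "indecomposable R N"
proof -
  obtain g where g: "lin_iso R N M g" and gf: "\<And>x. x \<in> carrier M \<Longrightarrow> g (f x) = x"
    and fg: "\<And>y. y \<in> carrier N \<Longrightarrow> f (g y) = y" using lin_iso_inverse[OF M f] by metis
  have lf: "lin R M N f" and lg: "lin R N M g" using f g by (auto simp: lin_iso_def)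
  have g0: "g \<zero>\<^bsub>N\<^esub> = \<zero>\<^bsub>M\<^esub>" and f0: "f \<zero>\<^bsub>M\<^esub> = \<zero>\<^bsub>N\<^esub>"
    using lin_zero M N lf lg by blast+
  show ?thesis
    unfolding indecomposable_def
  proof (intro conjI allI impI)
    show "carrier N \<noteq> {\<zero>\<^bsub>N\<^esub>}"
    proof
      assume "carrier N = {\<zero>\<^bsub>N\<^esub>}"
      hence "x = \<zero>\<^bsub>M\<^esub>" if "x \<in> carrier M" for x using gf[OF that] linD(1)[OF lf that] g0 by simp
      thus False using ind left_module_ops(5)[OF M] unfolding indecomposable_def by blast
    qed
    fix H K assume HK: "submodule H R N \<and> submodule K R N \<and> H \<inter> K = {\<zero>\<^bsub>N\<^esub>} \<and> H <+>\<^bsub>N\<^esub> K = carrier N"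
    have H: "H \<subseteq> carrier N" "\<zero>\<^bsub>N\<^esub> \<in> H" and K: "K \<subseteq> carrier N" "\<zero>\<^bsub>N\<^esub> \<in> K"
      using submoduleD(1,2)[OF N] HK by auto
    have 1: "submodule (g ` H) R M" "submodule (g ` K) R M"
      using submodule_image[OF N M lg] HK by blast+
    have inj: "inj_on g (carrier N)" using fg by (metis inj_onI)
    have 2: "g ` H \<inter> g ` K = {\<zero>\<^bsub>M\<^esub>}"
      using inj_on_image_Int[OF inj H(1) K(1)] HK g0 by simp
    have 3: "g ` H <+>\<^bsub>M\<^esub> g ` K = carrier M"
    proof
      show "g ` H <+>\<^bsub>M\<^esub> g ` K \<subseteq> carrier M"
        using H K linD(1)[OF lg] left_module_ops(3)[OF M] by (force simp: set_add_def set_mult_def subset_iff)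
      show "carrier M \<subseteq> g ` H <+>\<^bsub>M\<^esub> g ` K"
      proof
        fix x assume x: "x \<in> carrier M"
        hence "f x \<in> H <+>\<^bsub>N\<^esub> K" using HK linD(1)[OF lf] by blast
        then obtain h k where hk: "h \<in> H" "k \<in> K" "f x = h \<oplus>\<^bsub>N\<^esub> k"
          by (auto simp: set_add_def set_mult_def)
        have "x = g h \<oplus>\<^bsub>M\<^esub> g k" using gf[OF x] hk linD(2)[OF lg] H K by auto
        thus "x \<in> g ` H <+>\<^bsub>M\<^esub> g ` K" using hk by (auto simp: set_add_def set_mult_def)
      qed
    qed
    have "g ` H = {\<zero>\<^bsub>M\<^esub>} \<or> g ` K = {\<zero>\<^bsub>M\<^esub>}" using ind 1 2 3 unfolding indecomposable_def by blast
    thus "H = {\<zero>\<^bsub>N\<^esub>} \<or> K = {\<zero>\<^bsub>N\<^esub>}"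
    proof
      assume a: "g ` H = {\<zero>\<^bsub>M\<^esub>}"
      have "x = \<zero>\<^bsub>N\<^esub>" if "x \<in> H" for x
        using a that H(1) fg[of x] f0 by (metis imageI singletonD subsetD)
      thus ?thesis using H(2) by blast
    next
      assume a: "g ` K = {\<zero>\<^bsub>M\<^esub>}"
      have "x = \<zero>\<^bsub>N\<^esub>" if "x \<in> K" for x
        using a that K(1) fg[of x] f0 by (metis imageI singletonD subsetD)
      thus ?thesis using K(2) by blast
    qed
  qed
qed

section \<open>Double centralizers\<close>

text \<open>The double centralizer, with plain functions in place of the extensional ones of
  \<open>End_ring\<close>. Such a map is only additive; even its homogeneity over the field has to
  be derived from its commuting with endomorphisms.\<close>

definition bicommuting ::
  "('a, 'c) ring_scheme \<Rightarrow> ('a, 'm, 'd) module_scheme \<Rightarrow> ('m \<Rightarrow> 'm) \<Rightarrow> bool" where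
  "bicommuting R M \<phi> \<longleftrightarrow> \<phi> \<in> carrier M \<rightarrow> carrier M \<and>
    (\<forall>x\<in>carrier M. \<forall>y\<in>carrier M. \<phi> (x \<oplus>\<^bsub>M\<^esub> y) = \<phi> x \<oplus>\<^bsub>M\<^esub> \<phi> y) \<and>
    (\<forall>h. lin R M M h \<longrightarrow> (\<forall>x\<in>carrier M. \<phi> (h x) = h (\<phi> x)))"

text \<open>The iterated \<open>End_ring\<close> consists of the extensional bicommuting maps,
  because restricting an endomorphism to the carrier is invisible to a map of the carrier into
  itself. Injectivity then says that the action is faithful, surjectivity is the double centralizer
  property.\<close>

lemma faithfully_balanced_iff:
  assumes M: "left_module R M"
  shows "faithfully_balanced R M \<longleftrightarrow>
    (\<forall>a\<in>carrier R. \<forall>b\<in>carrier R. (\<forall>x\<in>carrier M. a \<odot>\<^bsub>M\<^esub> x = b \<odot>\<^bsub>M\<^esub> x) \<longrightarrow> a = b) \<and>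
    (\<forall>\<phi>. bicommuting R M \<phi> \<longrightarrow> (\<exists>a\<in>carrier R. \<forall>x\<in>carrier M. \<phi> x = a \<odot>\<^bsub>M\<^esub> x))" (is "_ = (?inj \<and> ?surj)")
proof -
  let ?E = "carrier (End_ring (End_ring R M) (End_module M))"
  let ?F = "\<lambda>a. \<lambda>x\<in>carrier M. a \<odot>\<^bsub>M\<^esub> x"
  interpret left_module R M by fact
  have hom: "h \<in> mod_hom R M M \<longleftrightarrow> lin R M M h \<and> h \<in> extensional (carrier M)" for h
    by (auto simp: mod_hom_def lin_def hom_def)
  have E0: "\<phi> \<in> ?E \<longleftrightarrow> \<phi> \<in> carrier M \<rightarrow> carrier M \<and> \<phi> \<in> extensional (carrier M) \<and>
      (\<forall>x\<in>carrier M. \<forall>y\<in>carrier M. \<phi> (x \<oplus>\<^bsub>M\<^esub> y) = \<phi> x \<oplus>\<^bsub>M\<^esub> \<phi> y) \<and>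
      (\<forall>h\<in>mod_hom R M M. \<forall>x\<in>carrier M. \<phi> (h x) = h (\<phi> x))" for \<phi>
  proof -
    have "?E = mod_hom (End_ring R M) (End_module M) (End_module M)"
      by (simp add: End_ring_def[of "End_ring R M"])
    moreover have "carrier (End_ring R M) = mod_hom R M M" by (simp add: End_ring_def)
    ultimately show ?thesis
      by (auto simp: mod_hom_def[of "End_ring R M"] End_module_def hom_def)
  qed
  have E: "\<phi> \<in> ?E \<longleftrightarrow> bicommuting R M \<phi> \<and> \<phi> \<in> extensional (carrier M)" for \<phi>
  proof
    assume \<phi>: "\<phi> \<in> ?E"
    have "\<phi> (h x) = h (\<phi> x)" if h: "lin R M M h" and x: "x \<in> carrier M" for h x
    proof -
      have "restrict h (carrier M) \<in> mod_hom R M M" by (rule restrict_lin_mod_hom[OF M h])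
      hence "\<phi> (restrict h (carrier M) x) = restrict h (carrier M) (\<phi> x)"
        using \<phi> x unfolding E0 by blast
      thus ?thesis using \<phi> x unfolding E0 by (simp add: Pi_iff)
    qed
    thus "bicommuting R M \<phi> \<and> \<phi> \<in> extensional (carrier M)"
      using \<phi> unfolding E0 by (simp add: bicommuting_def)
  next
    assume \<phi>: "bicommuting R M \<phi> \<and> \<phi> \<in> extensional (carrier M)"
    thus "\<phi> \<in> ?E"
      unfolding E0 bicommuting_def using hom by auto
  qed
  have F: "?F a \<in> ?E" if "a \<in> carrier R" for a
    unfolding E bicommuting_def using that by (auto simp: lin_def smult_r_distr Pi_iff)
  show ?thesis
  proof
    assume "faithfully_balanced R M"
    hence bij: "bij_betw ?F (carrier R) ?E" by (simp add: faithfully_balanced_def)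
    have ?inj
    proof (intro ballI impI)
      fix a b assume ab: "a \<in> carrier R" "b \<in> carrier R" "\<forall>x\<in>carrier M. a \<odot>\<^bsub>M\<^esub> x = b \<odot>\<^bsub>M\<^esub> x"
      hence "?F a = ?F b" by (auto intro!: restrict_ext)
      thus "a = b" using bij ab unfolding bij_betw_def inj_on_def by blast
    qed
    moreover have ?surj
    proof (intro allI impI)
      fix \<phi> assume \<phi>: "bicommuting R M \<phi>"
      hence "restrict \<phi> (carrier M) \<in> ?E"
        unfolding E by (auto simp: bicommuting_def lin_def Pi_iff)
      then obtain a where a: "a \<in> carrier R" "restrict \<phi> (carrier M) = ?F a"
        using bij unfolding bij_betw_def by blast
      have "\<phi> x = a \<odot>\<^bsub>M\<^esub> x" if "x \<in> carrier M" for x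
        using fun_cong[OF a(2), of x] that by simp
      thus "\<exists>a\<in>carrier R. \<forall>x\<in>carrier M. \<phi> x = a \<odot>\<^bsub>M\<^esub> x" using a(1) by blast
    qed
    ultimately show "?inj \<and> ?surj" ..
  next
    assume *: "?inj \<and> ?surj"
    have "inj_on ?F (carrier R)"
    proof (rule inj_onI)
      fix a b assume ab: "a \<in> carrier R" "b \<in> carrier R" "?F a = ?F b"
      have "a \<odot>\<^bsub>M\<^esub> x = b \<odot>\<^bsub>M\<^esub> x" if "x \<in> carrier M" for x using fun_cong[OF ab(3), of x] that by simp
      thus "a = b" using * ab by blast
    qed
    moreover have "?E \<subseteq> ?F ` carrier R"
    proof
      fix \<phi> assume \<phi>: "\<phi> \<in> ?E"
      then obtain a where a: "a \<in> carrier R" "\<forall>x\<in>carrier M. \<phi> x = a \<odot>\<^bsub>M\<^esub> x"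
        using * unfolding E by blast
      have "\<phi> = ?F a" using a(2) \<phi> unfolding E by (intro ext) (auto simp: extensional_def)
      thus "\<phi> \<in> ?F ` carrier R" using a(1) by blast
    qed
    ultimately show "faithfully_balanced R M"
      unfolding faithfully_balanced_def bij_betw_def using F by blast
  qed
qed

lemma faithfully_balanced_iso:
  assumes M: "left_module R M" and N: "left_module R N" and f: "lin_iso R M N f"
    and fb: "faithfully_balanced R M"
  shows "faithfully_balanced R N"
proof -
  obtain g where g: "lin_iso R N M g" and gf: "\<And>x. x \<in> carrier M \<Longrightarrow> g (f x) = x"
    and fg: "\<And>y. y \<in> carrier N \<Longrightarrow> f (g y) = y" using lin_iso_inverse[OF M f] by metis
  have lf: "lin R M N f" and lg: "lin R N M g" using f g by (auto simp: lin_iso_def)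
  show ?thesis
    unfolding faithfully_balanced_iff[OF N]
  proof (intro conjI ballI allI impI)
    fix a b assume ab: "a \<in> carrier R" "b \<in> carrier R" and eq: "\<forall>x\<in>carrier N. a \<odot>\<^bsub>N\<^esub> x = b \<odot>\<^bsub>N\<^esub> x"
    have "a \<odot>\<^bsub>M\<^esub> x = b \<odot>\<^bsub>M\<^esub> x" if x: "x \<in> carrier M" for x
    proof -
      have "f (a \<odot>\<^bsub>M\<^esub> x) = f (b \<odot>\<^bsub>M\<^esub> x)"
        using eq linD(1,3)[OF lf] x ab by simp
      thus ?thesis using gf left_module_ops(4)[OF M] ab x by metis
    qed
    thus "a = b" using fb ab unfolding faithfully_balanced_iff[OF M] by blast
  next
    fix \<phi> assume \<phi>: "bicommuting R N \<phi>"
    let ?\<psi> = "\<lambda>x. g (\<phi> (f x))"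
    have \<phi>c: "\<phi> y \<in> carrier N" if "y \<in> carrier N" for y using \<phi> that by (auto simp: bicommuting_def)
    have "bicommuting R M ?\<psi>"
      unfolding bicommuting_def
    proof (intro conjI ballI allI impI)
      show "?\<psi> \<in> carrier M \<rightarrow> carrier M" using linD(1)[OF lf] linD(1)[OF lg] \<phi>c by blast
      show "?\<psi> (x \<oplus>\<^bsub>M\<^esub> y) = ?\<psi> x \<oplus>\<^bsub>M\<^esub> ?\<psi> y" if xy: "x \<in> carrier M" "y \<in> carrier M" for x y
      proof -
        have "\<phi> (f x \<oplus>\<^bsub>N\<^esub> f y) = \<phi> (f x) \<oplus>\<^bsub>N\<^esub> \<phi> (f y)"
          using \<phi> linD(1)[OF lf] xy by (auto simp: bicommuting_def)
        thus ?thesis using linD(1,2)[OF lf] linD(1,2)[OF lg] xy \<phi>c by simp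
      qed
      show "?\<psi> (h x) = h (?\<psi> x)" if h: "lin R M M h" and x: "x \<in> carrier M" for h x
      proof -
        have "lin R N N (\<lambda>y. f (h (g y)))"
          using lin_compose[OF lin_compose[OF lg h] lf] .
        hence "\<phi> (f (h (g (f x)))) = f (h (g (\<phi> (f x))))"
          using \<phi> linD(1)[OF lf x] unfolding bicommuting_def by blast
        thus ?thesis using gf[OF x] gf[of "h (g (\<phi> (f x)))"] linD(1)[OF lf x] \<phi>c linD(1)[OF lg] linD(1)[OF h]
          by metis
      qed
    qed
    then obtain a where a: "a \<in> carrier R" "\<And>x. x \<in> carrier M \<Longrightarrow> ?\<psi> x = a \<odot>\<^bsub>M\<^esub> x"
      using fb unfolding faithfully_balanced_iff[OF M] by blast
    have "\<phi> y = a \<odot>\<^bsub>N\<^esub> y" if y: "y \<in> carrier N" for y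
    proof -
      have "g (\<phi> y) = a \<odot>\<^bsub>M\<^esub> g y" using a(2)[of "g y"] fg[OF y] linD(1)[OF lg y] by simp
      also have "\<dots> = g (a \<odot>\<^bsub>N\<^esub> y)" using linD(3)[OF lg a(1) y] by simp
      finally show ?thesis using fg \<phi>c[OF y] left_module_ops(4)[OF N a(1) y] by metis
    qed
    thus "\<exists>a\<in>carrier R. \<forall>x\<in>carrier N. \<phi> x = a \<odot>\<^bsub>N\<^esub> x" using a(1) by blast
  qed
qed

section \<open>Finite direct sums and transport of structure\<close>

lemma direct_sum_carrier_finite:
  "finite I \<Longrightarrow> carrier (direct_sum I X) = (\<Pi>\<^sub>E i\<in>I. carrier (X i))"
  by (auto simp: direct_sum_def)

lemma direct_sum_left_module:
  assumes "ring R" "finite I" "\<And>i. i \<in> I \<Longrightarrow> left_module R (X i)"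
  shows "left_module R (direct_sum I X)"
proof -
  note c = direct_sum_carrier_finite[OF assms(2)]
  note ag = left_module_ops(1)[OF assms(3)]
  have "abelian_group (direct_sum I X)"
  proof (rule abelian_groupI)
    fix x y z
    assume x: "x \<in> carrier (direct_sum I X)"
    show "\<zero>\<^bsub>direct_sum I X\<^esub> \<oplus>\<^bsub>direct_sum I X\<^esub> x = x"
      using x ag unfolding c by (intro ext) (auto simp: direct_sum_def PiE_iff extensional_def abelian_group.l_neg abelian_monoid.l_zero abelian_group.axioms)
    show "\<exists>y\<in>carrier (direct_sum I X). y \<oplus>\<^bsub>direct_sum I X\<^esub> x = \<zero>\<^bsub>direct_sum I X\<^esub>"
    proof
      show "(\<lambda>i\<in>I. \<ominus>\<^bsub>X i\<^esub> x i) \<in> carrier (direct_sum I X)"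
        using x ag unfolding c by (auto simp: abelian_group.a_inv_closed PiE_iff)
      show "(\<lambda>i\<in>I. \<ominus>\<^bsub>X i\<^esub> x i) \<oplus>\<^bsub>direct_sum I X\<^esub> x = \<zero>\<^bsub>direct_sum I X\<^esub>"
        using x ag unfolding c by (intro ext) (auto simp: direct_sum_def abelian_group.l_neg PiE_iff)
    qed
    assume y: "y \<in> carrier (direct_sum I X)"
    show "x \<oplus>\<^bsub>direct_sum I X\<^esub> y \<in> carrier (direct_sum I X)"
      using x y left_module_ops(3)[OF assms(3)] unfolding c by (auto simp: direct_sum_def PiE_iff)
    show "x \<oplus>\<^bsub>direct_sum I X\<^esub> y = y \<oplus>\<^bsub>direct_sum I X\<^esub> x"
      using x y ag unfolding c by (auto simp: direct_sum_def PiE_iff abelian_monoid.a_comm abelian_group.axioms intro!: restrict_ext)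
    assume z: "z \<in> carrier (direct_sum I X)"
    show "x \<oplus>\<^bsub>direct_sum I X\<^esub> y \<oplus>\<^bsub>direct_sum I X\<^esub> z = x \<oplus>\<^bsub>direct_sum I X\<^esub> (y \<oplus>\<^bsub>direct_sum I X\<^esub> z)"
      using x y z ag unfolding c by (auto simp: direct_sum_def PiE_iff abelian_monoid.a_assoc abelian_group.axioms intro!: restrict_ext)
  next
    show "\<zero>\<^bsub>direct_sum I X\<^esub> \<in> carrier (direct_sum I X)"
      unfolding c using left_module_ops(5)[OF assms(3)] by (auto simp: direct_sum_def)
  qed
  moreover have "left_module_axioms R (direct_sum I X)"
  proof (rule left_module_axioms.intro, goal_cases)
    case (1 a x)
    thus ?case using left_module_ops(4)[OF assms(3)] unfolding c by (auto simp: direct_sum_def PiE_iff)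
  next
    case (2 a b x)
    thus ?case using left_module.smult_l_distr[OF assms(3)] unfolding c by (auto simp: direct_sum_def PiE_iff intro!: restrict_ext)
  next
    case (3 a x y)
    thus ?case using left_module.smult_r_distr[OF assms(3)] unfolding c by (auto simp: direct_sum_def PiE_iff intro!: restrict_ext)
  next
    case (4 a b x)
    thus ?case using left_module.smult_assoc[OF assms(3)] unfolding c by (auto simp: direct_sum_def PiE_iff intro!: restrict_ext)
  next
    case (5 x)
    thus ?case using left_module.smult_one[OF assms(3)] unfolding c by (intro ext) (auto simp: direct_sum_def PiE_iff extensional_def)
  qed
  ultimately show ?thesis using assms(1) by (simp add: left_module_def)
qed

text \<open>The reindexing \<open>\<sigma>\<close> is there because the sum of all indecomposable
  modules is indexed by the modules themselves, whereas \<open>bar\<close> numbers its summands by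
  list positions.\<close>

lemma direct_sum_iso:
  assumes R: "ring R" and fin: "finite I" and \<sigma>: "bij_betw \<sigma> I J"
    and X: "\<And>i. i \<in> I \<Longrightarrow> left_module R (X i)" and Y: "\<And>j. j \<in> J \<Longrightarrow> left_module R (Y j)"
    and iso: "\<And>i. i \<in> I \<Longrightarrow> mod_iso R (X i) (Y (\<sigma> i))"
  shows "mod_iso R (direct_sum I X) (direct_sum J Y)"
proof -
  have finJ: "finite J" using \<sigma> fin by (metis bij_betw_finite)
  have "\<forall>i\<in>I. \<exists>f. lin_iso R (X i) (Y (\<sigma> i)) f" using iso X mod_iso_iff by blast
  then obtain f where f: "\<And>i. i \<in> I \<Longrightarrow> lin_iso R (X i) (Y (\<sigma> i)) (f i)" by metis
  have "\<forall>i\<in>I. \<exists>g. lin_iso R (Y (\<sigma> i)) (X i) g \<and> (\<forall>x\<in>carrier (X i). g (f i x) = x)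
      \<and> (\<forall>y\<in>carrier (Y (\<sigma> i)). f i (g y) = y)"
    using lin_iso_inverse[OF X f] by metis
  then obtain g where g: "\<And>i. i \<in> I \<Longrightarrow> lin_iso R (Y (\<sigma> i)) (X i) (g i)"
    and gf: "\<And>i x. i \<in> I \<Longrightarrow> x \<in> carrier (X i) \<Longrightarrow> g i (f i x) = x"
    and fg: "\<And>i y. i \<in> I \<Longrightarrow> y \<in> carrier (Y (\<sigma> i)) \<Longrightarrow> f i (g i y) = y" by metis
  have lf: "lin R (X i) (Y (\<sigma> i)) (f i)" and lg: "lin R (Y (\<sigma> i)) (X i) (g i)" if "i \<in> I" for i
    using f g that by (auto simp: lin_iso_def)
  define \<tau> where "\<tau> = inv_into I \<sigma>"
  have \<tau>: "\<tau> j \<in> I" "\<sigma> (\<tau> j) = j" if "j \<in> J" for j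
    using that \<sigma> unfolding \<tau>_def by (auto simp: bij_betw_def inv_into_into f_inv_into_f)
  have \<sigma>': "\<sigma> i \<in> J" "\<tau> (\<sigma> i) = i" if "i \<in> I" for i
    using that \<sigma> unfolding \<tau>_def by (auto simp: bij_betw_def)
  let ?F = "\<lambda>x. \<lambda>j\<in>J. f (\<tau> j) (x (\<tau> j))"
  let ?G = "\<lambda>y. \<lambda>i\<in>I. g i (y (\<sigma> i))"
  have Fc: "?F x \<in> (\<Pi>\<^sub>E j\<in>J. carrier (Y j))" if "x \<in> (\<Pi>\<^sub>E i\<in>I. carrier (X i))" for x
    using that linD(1)[OF lf[OF \<tau>(1)]] \<tau> by (auto simp: PiE_iff)
  have "lin R (direct_sum I X) (direct_sum J Y) ?F"
  proof (rule linI)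
    fix x assume x: "x \<in> carrier (direct_sum I X)"
    show "?F x \<in> carrier (direct_sum J Y)"
      using x Fc unfolding direct_sum_carrier_finite[OF fin] direct_sum_carrier_finite[OF finJ] by blast
    fix y assume y: "y \<in> carrier (direct_sum I X)"
    show "?F (x \<oplus>\<^bsub>direct_sum I X\<^esub> y) = ?F x \<oplus>\<^bsub>direct_sum J Y\<^esub> ?F y"
      using x y linD(2)[OF lf[OF \<tau>(1)]] \<tau> unfolding direct_sum_carrier_finite[OF fin]
      by (auto simp: direct_sum_def PiE_iff intro!: restrict_ext)
  next
    fix a x assume "a \<in> carrier R" "x \<in> carrier (direct_sum I X)"
    thus "?F (a \<odot>\<^bsub>direct_sum I X\<^esub> x) = a \<odot>\<^bsub>direct_sum J Y\<^esub> ?F x"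
      using linD(3)[OF lf[OF \<tau>(1)]] \<tau> unfolding direct_sum_carrier_finite[OF fin]
      by (auto simp: direct_sum_def PiE_iff intro!: restrict_ext)
  qed
  moreover have "bij_betw ?F (carrier (direct_sum I X)) (carrier (direct_sum J Y))"
    unfolding direct_sum_carrier_finite[OF fin] direct_sum_carrier_finite[OF finJ]
  proof (rule bij_betw_byWitness[where f' = ?G])
    show "\<forall>x\<in>\<Pi>\<^sub>E i\<in>I. carrier (X i). ?G (?F x) = x"
      using gf \<sigma>' by (auto simp: PiE_iff extensional_def)
    show "\<forall>y\<in>\<Pi>\<^sub>E j\<in>J. carrier (Y j). ?F (?G y) = y"
      using fg \<tau> by (auto simp: PiE_iff extensional_def)
    show "?F ` (\<Pi>\<^sub>E i\<in>I. carrier (X i)) \<subseteq> (\<Pi>\<^sub>E j\<in>J. carrier (Y j))" using Fc by blast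
    show "?G ` (\<Pi>\<^sub>E j\<in>J. carrier (Y j)) \<subseteq> (\<Pi>\<^sub>E i\<in>I. carrier (X i))"
      using linD(1)[OF lg] \<sigma>' by (auto simp: PiE_iff)
  qed
  ultimately show ?thesis
    using mod_iso_iff[of R "direct_sum I X" "direct_sum J Y"] direct_sum_left_module[of R I X] R fin X
    by (auto simp: lin_iso_def)
qed

text \<open>Decompositions and representatives are required to live on prescribed types; this moves
  a module constructed elsewhere to such a type along any injection.\<close>

lemma left_module_transport:
  fixes R :: "('a, 'c) ring_scheme" and M :: "('a, 'm) module" and h :: "'m \<Rightarrow> 'p"
  assumes M: "left_module R M" and inj: "inj_on h (carrier M)"
  obtains N :: "('a, 'p) module" where "left_module R N" "lin_iso R M N h"
proof -
  interpret left_module R M by fact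
  define g where "g = inv_into (carrier M) h"
  have g: "g (h x) = x" if "x \<in> carrier M" for x using that inj by (simp add: g_def)
  define N :: "('a, 'p) module" where "N = \<lparr>carrier = h ` carrier M, mult = undefined, one = undefined,
    zero = h \<zero>\<^bsub>M\<^esub>, add = (\<lambda>x y. h (g x \<oplus>\<^bsub>M\<^esub> g y)), smult = (\<lambda>a x. h (a \<odot>\<^bsub>M\<^esub> g x))\<rparr>"
  have "abelian_group N"
  proof (rule abelian_groupI)
    fix x assume "x \<in> carrier N"
    then obtain u where u: "u \<in> carrier M" "x = h u" by (auto simp: N_def)
    show "\<exists>y\<in>carrier N. y \<oplus>\<^bsub>N\<^esub> x = \<zero>\<^bsub>N\<^esub>"
      by (rule bexI[of _ "h (\<ominus>\<^bsub>M\<^esub> u)"]) (use u in \<open>auto simp: N_def g M.l_neg\<close>)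
  qed (auto simp: N_def g M.a_ac)
  moreover have "left_module_axioms R N"
    by (rule left_module_axioms.intro)
      (auto simp: N_def g smult_l_distr smult_r_distr smult_assoc)
  ultimately have "left_module R N" using R.ring_axioms by (simp add: left_module_def)
  moreover have "lin_iso R M N h"
    unfolding lin_iso_def using inj by (auto simp: lin_def N_def g bij_betw_def)
  ultimately show ?thesis using that by blast
qed

section \<open>Lower triangular matrices and interval modules\<close>

abbreviation Tri :: "nat \<Rightarrow> 'k::field mat ring" where
  "Tri n \<equiv> lower_tri_algebra TYPE('k) n"

lemma Tri_simps:
  "mult (Tri n) = (*)" "add (Tri n) = (+)" "one (Tri n) = 1\<^sub>m n" "zero (Tri n) = 0\<^sub>m n n"
  by (simp_all add: lower_tri_algebra_def ring_mat_simps)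

lemma Tri_carrier:
  "A \<in> carrier (Tri n) \<longleftrightarrow> A \<in> carrier_mat n n \<and> (\<forall>i<n. \<forall>j<n. i < j \<longrightarrow> A $$ (i, j) = 0)"
  by (simp add: lower_tri_algebra_def)

lemma Tri_mult_index:
  assumes "A \<in> carrier (Tri n)" "B \<in> carrier (Tri n)" "i < n" "j < n"
  shows "(A * B) $$ (i, j) = (\<Sum>k<n. A $$ (i, k) * B $$ (k, j))"
  using assms by (auto simp: Tri_carrier scalar_prod_def atLeast0LessThan)

lemma Tri_mult_closed:
  assumes "A \<in> carrier (Tri n)" "B \<in> carrier (Tri n)"
  shows "A * B \<in> carrier (Tri n)"
  unfolding Tri_carrier[of "A * B"]
proof (intro conjI allI impI)
  show "A * B \<in> carrier_mat n n" using assms unfolding Tri_carrier by (intro mult_carrier_mat) auto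
  fix i j assume ij: "i < n" "j < n" "i < j"
  have "A $$ (i, k) * B $$ (k, j) = 0" if "k < n" for k
    using assms ij that unfolding Tri_carrier by (cases "i < k") auto
  hence "(\<Sum>k<n. A $$ (i, k) * B $$ (k, j)) = 0" by (intro sum.neutral) auto
  thus "(A * B) $$ (i, j) = 0" using Tri_mult_index[OF assms ij(1,2)] by simp
qed

lemma Tri_ring: "ring (Tri n :: 'k::field mat ring)"
proof (rule ringI)
  show "abelian_group (Tri n :: 'k mat ring)"
  proof (rule abelian_groupI)
    fix A :: "'k mat" assume A: "A \<in> carrier (Tri n)"
    show "\<exists>B\<in>carrier (Tri n). B \<oplus>\<^bsub>Tri n\<^esub> A = \<zero>\<^bsub>Tri n\<^esub>"
      by (rule bexI[of _ "- A"]) (use A in \<open>auto simp: Tri_simps Tri_carrier\<close>)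
  qed (auto simp: Tri_simps Tri_carrier comm_add_mat assoc_add_mat)
  show "Group.monoid (Tri n :: 'k mat ring)"
  proof (rule monoidI)
    fix A B C :: "'k mat"
    assume "A \<in> carrier (Tri n)" "B \<in> carrier (Tri n)" "C \<in> carrier (Tri n)"
    thus "A \<otimes>\<^bsub>Tri n\<^esub> B \<otimes>\<^bsub>Tri n\<^esub> C = A \<otimes>\<^bsub>Tri n\<^esub> (B \<otimes>\<^bsub>Tri n\<^esub> C)"
      unfolding Tri_simps Tri_carrier by (intro assoc_mult_mat) auto
  qed (auto simp: Tri_simps Tri_mult_closed, auto simp: Tri_carrier intro: left_mult_one_mat right_mult_one_mat)
  fix A B C :: "'k mat"
  assume *: "A \<in> carrier (Tri n)" "B \<in> carrier (Tri n)" "C \<in> carrier (Tri n)"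
  show "(A \<oplus>\<^bsub>Tri n\<^esub> B) \<otimes>\<^bsub>Tri n\<^esub> C = A \<otimes>\<^bsub>Tri n\<^esub> C \<oplus>\<^bsub>Tri n\<^esub> B \<otimes>\<^bsub>Tri n\<^esub> C"
    using * unfolding Tri_simps Tri_carrier by (intro add_mult_distrib_mat) auto
  show "C \<otimes>\<^bsub>Tri n\<^esub> (A \<oplus>\<^bsub>Tri n\<^esub> B) = C \<otimes>\<^bsub>Tri n\<^esub> A \<oplus>\<^bsub>Tri n\<^esub> C \<otimes>\<^bsub>Tri n\<^esub> B"
    using * unfolding Tri_simps Tri_carrier by (intro mult_add_distrib_mat) auto
qed

text \<open>The scalar belongs to the unit so that these matrices generate the algebra additively;
  statements about the action can then be checked on them using additivity alone.\<close>

definition munit :: "nat \<Rightarrow> 'k \<Rightarrow> nat \<Rightarrow> nat \<Rightarrow> 'k::field mat" where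
  "munit n c i j = mat n n (\<lambda>(r, s). if r = i \<and> s = j then c else 0)"

lemma munit_index [simp]:
  "r < n \<Longrightarrow> s < n \<Longrightarrow> munit n c i j $$ (r, s) = (if r = i \<and> s = j then c else 0)"
  by (simp add: munit_def)

lemma munit_dim [simp]: "dim_row (munit n c i j) = n" "dim_col (munit n c i j) = n"
  by (simp_all add: munit_def)

lemma munit_carrier: "j \<le> i \<Longrightarrow> munit n c i j \<in> carrier (Tri n)"
  unfolding Tri_carrier by (intro conjI allI impI carrier_matI) auto

lemma munit_mult:
  assumes "i < n" "k < n" "l < n" "k \<le> i" "l \<le> k"
  shows "munit n c i k * munit n d k l = munit n (c * d) i l"
proof (rule eq_matI)
  fix r s assume "r < dim_row (munit n (c * d) i l)" "s < dim_col (munit n (c * d) i l)"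
  hence rs: "r < n" "s < n" by (simp_all add: munit_def)
  have "(munit n c i k * munit n d k l) $$ (r, s) =
      (\<Sum>m<n. (if r = i \<and> m = k then c else 0) * (if m = k \<and> s = l then d else 0))"
    using Tri_mult_index[OF munit_carrier munit_carrier rs] assms rs by simp
  also have "\<dots> = (\<Sum>m<n. if m = k then (if r = i \<and> s = l then c * d else 0) else 0)"
    by (intro sum.cong) auto
  also have "\<dots> = munit n (c * d) i l $$ (r, s)" using assms rs by simp
  finally show "(munit n c i k * munit n d k l) $$ (r, s) = munit n (c * d) i l $$ (r, s)" .
qed (simp_all add: munit_def)

text \<open>Induction on the number of nonzero entries, one of which is cancelled in each step. The
  unit used for this is lower triangular because the entry is nonzero.\<close>

lemma Tri_induct [consumes 1, case_names zero add munit]: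
  assumes A: "A \<in> carrier (Tri n)"
    and zero: "P (0\<^sub>m n n)"
    and add: "\<And>A B. A \<in> carrier (Tri n) \<Longrightarrow> B \<in> carrier (Tri n) \<Longrightarrow> P A \<Longrightarrow> P B \<Longrightarrow> P (A + B)"
    and munit: "\<And>c i j. j \<le> i \<Longrightarrow> i < n \<Longrightarrow> P (munit n c i j)"
  shows "P A"
  using A
proof (induction "card {(i, j). i < n \<and> j < n \<and> A $$ (i, j) \<noteq> 0}" arbitrary: A rule: less_induct)
  case less
  let ?Z = "\<lambda>A. {(i, j). i < n \<and> j < n \<and> A $$ (i, j) \<noteq> 0}"
  have fin: "finite (?Z A)" for A :: "'a mat" by (rule finite_subset[of _ "{..<n} \<times> {..<n}"]) auto
  show ?case
  proof (cases "?Z A = {}")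
    case True
    hence "A = 0\<^sub>m n n" using less.prems by (intro eq_matI) (auto simp: Tri_carrier)
    thus ?thesis using zero by simp
  next
    case False
    then obtain i j where ij: "i < n" "j < n" "A $$ (i, j) \<noteq> 0" by auto
    have "j \<le> i" using ij less.prems unfolding Tri_carrier by (meson leI)
    define B where "B = A + munit n (- (A $$ (i, j))) i j"
    have B: "B \<in> carrier (Tri n)"
      using less.prems munit_carrier[OF \<open>j \<le> i\<close>, of n "- (A $$ (i, j))"] by (auto simp: B_def Tri_carrier)
    have A': "A \<in> carrier_mat n n" using less.prems by (simp add: Tri_carrier)
    have mu: "munit n c i j \<in> carrier_mat n n" for c :: 'a by (simp add: munit_def)
    have Bix: "B $$ (r, s) = (if r = i \<and> s = j then 0 else A $$ (r, s))" if "r < n" "s < n" for r s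
      using that A' by (auto simp: B_def)
    have "?Z B \<subseteq> ?Z A" "(i, j) \<in> ?Z A" "(i, j) \<notin> ?Z B" using ij Bix by (auto split: if_splits)
    hence "?Z B \<subset> ?Z A" by blast
    hence "card (?Z B) < card (?Z A)" by (rule psubset_card_mono[OF fin])
    hence "P B" using less.hyps B by blast
    moreover have "A = B + munit n (A $$ (i, j)) i j"
      using A' mu by (intro eq_matI) (auto simp: B_def)
    ultimately show ?thesis
      using add[OF B munit_carrier[OF \<open>j \<le> i\<close>]] munit[OF \<open>j \<le> i\<close> ij(1)] by metis
  qed
qed

text \<open>The matrices whose action an additive map respects are closed under sums, so additive
  generators suffice.\<close>

lemma lin_TriI:
  fixes M :: "('k::field mat, 'm, 'd) module_scheme" and N :: "('k mat, 'p, 'e) module_scheme"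
  assumes M: "left_module (Tri n) M" and N: "left_module (Tri n) N"
    and f: "\<And>x. x \<in> carrier M \<Longrightarrow> f x \<in> carrier N"
    and add: "\<And>x y. x \<in> carrier M \<Longrightarrow> y \<in> carrier M \<Longrightarrow> f (x \<oplus>\<^bsub>M\<^esub> y) = f x \<oplus>\<^bsub>N\<^esub> f y"
    and mu: "\<And>c i j x. x \<in> carrier M \<Longrightarrow> j \<le> i \<Longrightarrow> i < n \<Longrightarrow>
      f (munit n c i j \<odot>\<^bsub>M\<^esub> x) = munit n c i j \<odot>\<^bsub>N\<^esub> f x"
  shows "lin (Tri n) M N f"
proof (rule linI)
  interpret M: left_module "Tri n" M by fact
  interpret N: left_module "Tri n" N by fact
  have "f \<zero>\<^bsub>M\<^esub> \<oplus>\<^bsub>N\<^esub> f \<zero>\<^bsub>M\<^esub> = f \<zero>\<^bsub>M\<^esub>" using add[of "\<zero>\<^bsub>M\<^esub>" "\<zero>\<^bsub>M\<^esub>"] by simp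
  hence f0: "f \<zero>\<^bsub>M\<^esub> = \<zero>\<^bsub>N\<^esub>" using f[of "\<zero>\<^bsub>M\<^esub>"] by simp
  fix A :: "'k mat" and x assume A: "A \<in> carrier (Tri n)" and x: "x \<in> carrier M"
  from A show "f (A \<odot>\<^bsub>M\<^esub> x) = A \<odot>\<^bsub>N\<^esub> f x"
  proof (induction A rule: Tri_induct)
    case zero
    show ?case using M.smult_zero_left[OF x] N.smult_zero_left[OF f[OF x]] f0 by (simp add: Tri_simps)
  next
    case (add A B)
    thus ?case
      using M.smult_l_distr[OF add.hyps x] N.smult_l_distr[OF add.hyps f[OF x]] assms(4) x
      by (simp add: Tri_simps)
  next
    case (munit c i j)
    thus ?case using mu[OF x] by blast
  qed
qed (use f add in auto)

section \<open>Concrete direct sums of interval modules\<close>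

text \<open>Taking the type class addition makes finite sums and the vector space library available
  for modules inside function spaces.\<close>

definition tmod :: "'m::ab_group_add set \<Rightarrow> ('a \<Rightarrow> 'm \<Rightarrow> 'm) \<Rightarrow> ('a, 'm) module" where
  "tmod W act = \<lparr>carrier = W, mult = undefined, one = undefined, zero = 0, add = (+), smult = act\<rparr>"

lemma tmod_simps [simp]:
  "carrier (tmod W act) = W" "zero (tmod W act) = 0" "add (tmod W act) = (+)" "smult (tmod W act) = act"
  by (simp_all add: tmod_def)

lemma tmod_left_module:
  assumes "ring R" "0 \<in> W" "\<And>x y. x \<in> W \<Longrightarrow> y \<in> W \<Longrightarrow> x + y \<in> W" "\<And>x. x \<in> W \<Longrightarrow> - x \<in> W"
    "\<And>a x. a \<in> carrier R \<Longrightarrow> x \<in> W \<Longrightarrow> act a x \<in> W"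
    "\<And>a b x. a \<in> carrier R \<Longrightarrow> b \<in> carrier R \<Longrightarrow> x \<in> W \<Longrightarrow> act (a \<oplus>\<^bsub>R\<^esub> b) x = act a x + act b x"
    "\<And>a x y. a \<in> carrier R \<Longrightarrow> x \<in> W \<Longrightarrow> y \<in> W \<Longrightarrow> act a (x + y) = act a x + act a y"
    "\<And>a b x. a \<in> carrier R \<Longrightarrow> b \<in> carrier R \<Longrightarrow> x \<in> W \<Longrightarrow> act (a \<otimes>\<^bsub>R\<^esub> b) x = act a (act b x)"
    "\<And>x. x \<in> W \<Longrightarrow> act \<one>\<^bsub>R\<^esub> x = x"
  shows "left_module R (tmod W act)"
proof -
  have "abelian_group (tmod W act)"
    by (rule abelian_groupI) (use assms(2,3) in \<open>auto simp: add_ac intro: bexI[OF _ assms(4)]\<close>)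
  moreover have "left_module_axioms R (tmod W act)"
    by (rule left_module_axioms.intro) (use assms in auto)
  ultimately show ?thesis using assms(1) by (simp add: left_module_def)
qed

text \<open>The index set of the standard basis of \<open>bar xs\<close>.\<close>

definition cells :: "(nat \<times> nat) list \<Rightarrow> (nat \<times> nat) set" where
  "cells xs = {(t, p). t < length xs \<and> fst (xs ! t) \<le> p \<and> p \<le> snd (xs ! t)}"

definition intervals :: "nat \<Rightarrow> (nat \<times> nat) set" where
  "intervals n = {(a, b). a \<le> b \<and> b < n}"

text \<open>On each summand this is matrix times column vector, cut off to the interval. Lower
  triangular matrices preserve the columns supported on vertices from a on, and among these the
  columns supported beyond b; the interval module [a, b] is the quotient.\<close>

definition bar_act ::
  "(nat \<times> nat) list \<Rightarrow> 'k::field mat \<Rightarrow> (nat \<times> nat \<Rightarrow> 'k) \<Rightarrow> nat \<times> nat \<Rightarrow> 'k" where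
  "bar_act xs A v = (\<lambda>(t, p). if (t, p) \<in> cells xs then \<Sum>q\<le>p. A $$ (p, q) * v (t, q) else 0)"

text \<open>The direct sum of the interval modules listed in \<open>xs\<close>; the coordinate \<open>(t, p)\<close> is the entry at
  vertex \<open>p\<close> of the \<open>t\<close>-th summand. Vertices are numbered from 0.\<close>

definition bar :: "(nat \<times> nat) list \<Rightarrow> ('k::field mat, nat \<times> nat \<Rightarrow> 'k) module" where
  "bar xs = tmod {v. \<forall>z. z \<notin> cells xs \<longrightarrow> v z = 0} (bar_act xs)"

lemma bar_simps [simp]:
  "zero (bar xs) = 0" "add (bar xs) = (+)" "smult (bar xs) = bar_act xs"
  by (simp_all add: bar_def)

lemma bar_carrier: "v \<in> carrier (bar xs) \<longleftrightarrow> (\<forall>z. z \<notin> cells xs \<longrightarrow> v z = 0)"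
  by (simp add: bar_def)

lemma cells_lt: "set xs \<subseteq> intervals n \<Longrightarrow> (t, p) \<in> cells xs \<Longrightarrow> p < n"
  unfolding cells_def intervals_def using nth_mem by fastforce

lemma finite_cells: "finite (cells xs)"
proof -
  have "cells xs \<subseteq> (\<Union>t<length xs. {t} \<times> {..snd (xs ! t)})" by (auto simp: cells_def)
  thus ?thesis by (rule finite_subset) auto
qed

text \<open>Cutting off after \<open>B\<close> loses nothing: an intermediate vertex q that
  contributes to the entry (p, r) satisfies r \<le> q \<le> p, hence lies in the interval together
  with r and p.\<close>

lemma bar_act_mult:
  assumes xs: "set xs \<subseteq> intervals n" and A: "A \<in> carrier (Tri n)" and B: "B \<in> carrier (Tri n)"
    and v: "v \<in> carrier (bar xs)"
  shows "bar_act xs (A * B) v = bar_act xs A (bar_act xs B v)"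
proof (rule ext, clarify)
  fix t p
  show "bar_act xs (A * B) v (t, p) = bar_act xs A (bar_act xs B v) (t, p)"
  proof (cases "(t, p) \<in> cells xs")
    case False thus ?thesis by (simp add: bar_act_def)
  next
    case True
    hence p: "p < n" by (rule cells_lt[OF xs])
    have "bar_act xs A (bar_act xs B v) (t, p) = (\<Sum>q\<le>p. A $$ (p, q) * (if (t, q) \<in> cells xs then \<Sum>r\<le>q. B $$ (q, r) * v (t, r) else 0))"
      using True by (simp add: bar_act_def)
    also have "\<dots> = (\<Sum>q\<le>p. \<Sum>r\<le>p. if (t, q) \<in> cells xs \<and> r \<le> q then A $$ (p, q) * B $$ (q, r) * v (t, r) else 0)"
    proof (rule sum.cong[OF refl])
      fix q assume q: "q \<in> {..p}"
      have "(\<Sum>r\<le>q. B $$ (q, r) * v (t, r)) = (\<Sum>r\<le>p. if r \<le> q then B $$ (q, r) * v (t, r) else 0)"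
        using q by (intro sum.mono_neutral_cong_left) auto
      thus "A $$ (p, q) * (if (t, q) \<in> cells xs then \<Sum>r\<le>q. B $$ (q, r) * v (t, r) else 0) =
        (\<Sum>r\<le>p. if (t, q) \<in> cells xs \<and> r \<le> q then A $$ (p, q) * B $$ (q, r) * v (t, r) else 0)"
        by (auto simp: sum_distrib_left mult.assoc intro!: sum.cong)
    qed
    also have "\<dots> = (\<Sum>r\<le>p. \<Sum>q\<le>p. if (t, q) \<in> cells xs \<and> r \<le> q then A $$ (p, q) * B $$ (q, r) * v (t, r) else 0)"
      by (rule sum.swap)
    also have "\<dots> = (\<Sum>r\<le>p. (A * B) $$ (p, r) * v (t, r))"
    proof (rule sum.cong[OF refl])
      fix r assume r: "r \<in> {..p}"
      show "(\<Sum>q\<le>p. if (t, q) \<in> cells xs \<and> r \<le> q then A $$ (p, q) * B $$ (q, r) * v (t, r) else 0) = (A * B) $$ (p, r) * v (t, r)"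
      proof (cases "(t, r) \<in> cells xs")
        case False
        hence "v (t, r) = 0" using v by (simp add: bar_carrier)
        thus ?thesis by (simp cong: if_cong)
      next
        case rc: True
        have c: "(t, q) \<in> cells xs" if "r \<le> q" "q \<le> p" for q using rc True that by (auto simp: cells_def)
        have "(A * B) $$ (p, r) * v (t, r) = (\<Sum>q<n. A $$ (p, q) * B $$ (q, r) * v (t, r))"
          using Tri_mult_index[OF A B p, of r] r p by (simp add: sum_distrib_right)
        also have "\<dots> = (\<Sum>q\<le>p. if (t, q) \<in> cells xs \<and> r \<le> q then A $$ (p, q) * B $$ (q, r) * v (t, r) else 0)"
        proof (intro sum.mono_neutral_cong_right ballI)
          fix q assume "q \<in> {..<n} - {..p}"
          thus "A $$ (p, q) * B $$ (q, r) * v (t, r) = 0" using A p by (auto simp: Tri_carrier)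
        next
          fix q assume "q \<in> {..p}"
          thus "A $$ (p, q) * B $$ (q, r) * v (t, r) =
              (if (t, q) \<in> cells xs \<and> r \<le> q then A $$ (p, q) * B $$ (q, r) * v (t, r) else 0)"
            using B p r c[of q] by (cases "r \<le> q") (auto simp: Tri_carrier)
        qed (use p in auto)
        finally show ?thesis by simp
      qed
    qed
    finally show ?thesis using True by (simp add: bar_act_def)
  qed
qed

lemma bar_left_module:
  assumes xs: "set xs \<subseteq> intervals n"
  shows "left_module (Tri n) (bar xs :: ('k::field mat, _) module)"
  unfolding bar_def
proof (rule tmod_left_module)
  let ?W = "{v. \<forall>z. z \<notin> cells xs \<longrightarrow> v z = (0::'k)}"
  fix A B :: "'k mat" and v w :: "nat \<times> nat \<Rightarrow> 'k"
  assume A: "A \<in> carrier (Tri n)" and v: "v \<in> ?W"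
  show "bar_act xs A v \<in> ?W" by (auto simp: bar_act_def)
  show "bar_act xs A (v + w) = bar_act xs A v + bar_act xs A w" if "w \<in> ?W"
    by (intro ext) (auto simp: bar_act_def algebra_simps sum.distrib)
  assume B: "B \<in> carrier (Tri n)"
  show "bar_act xs (A \<oplus>\<^bsub>Tri n\<^esub> B) v = bar_act xs A v + bar_act xs B v"
  proof (intro ext, clarify)
    fix t p
    have "(A + B) $$ (p, q) * v (t, q) = A $$ (p, q) * v (t, q) + B $$ (p, q) * v (t, q)"
      if "(t, p) \<in> cells xs" "q \<le> p" for q
    proof -
      have "p < n" "q < n" "B \<in> carrier_mat n n" using that cells_lt[OF xs that(1)] B by (auto simp: Tri_carrier)
      thus ?thesis by (simp add: distrib_right)
    qed
    thus "bar_act xs (A \<oplus>\<^bsub>Tri n\<^esub> B) v (t, p) = (bar_act xs A v + bar_act xs B v) (t, p)"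
      by (auto simp: bar_act_def Tri_simps simp flip: sum.distrib intro!: sum.cong)
  qed
  show "bar_act xs (A \<otimes>\<^bsub>Tri n\<^esub> B) v = bar_act xs A (bar_act xs B v)"
    using bar_act_mult[OF xs A B] v by (simp add: Tri_simps bar_carrier)
next
  fix v :: "nat \<times> nat \<Rightarrow> 'k" assume v: "v \<in> {v. \<forall>z. z \<notin> cells xs \<longrightarrow> v z = (0::'k)}"
  show "bar_act xs \<one>\<^bsub>Tri n\<^esub> v = v"
  proof (rule ext, clarify)
    fix t p
    have "(\<Sum>q\<le>p. 1\<^sub>m n $$ (p, q) * v (t, q)) = (\<Sum>q\<le>p. if q = p then v (t, q) else 0)" if "(t, p) \<in> cells xs"
      using cells_lt[OF xs that] by (intro sum.cong) auto
    thus "bar_act xs \<one>\<^bsub>Tri n\<^esub> v (t, p) = v (t, p)" using v by (simp add: bar_act_def Tri_simps)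
  qed
qed (auto simp: Tri_ring)

definition delta :: "'i \<Rightarrow> 'k \<Rightarrow> 'i \<Rightarrow> 'k::zero" where
  "delta z c = (\<lambda>y. if y = z then c else 0)"

lemma delta_carrier: "z \<in> cells xs \<Longrightarrow> delta z c \<in> carrier (bar xs)"
  by (auto simp: bar_carrier delta_def)

lemma bar_act_munit:
  assumes xs: "set xs \<subseteq> intervals n" and "j \<le> i" "i < n"
  shows "bar_act xs (munit n c i j) v (t, p) = (if p = i \<and> (t, i) \<in> cells xs then c * v (t, j) else 0)"
proof (cases "(t, p) \<in> cells xs")
  case True
  have "(\<Sum>q\<le>p. munit n c i j $$ (p, q) * v (t, q)) = (\<Sum>q\<le>p. if q = j then (if p = i then c * v (t, j) else 0) else 0)"
    using cells_lt[OF xs True] by (intro sum.cong) auto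
  thus ?thesis using True assms by (auto simp: bar_act_def)
qed (auto simp: bar_act_def)

lemma bar_act_munit_delta:
  assumes xs: "set xs \<subseteq> intervals n" and "j \<le> i" "i < n"
  shows "bar_act xs (munit n c i j) (delta (t, p) d) =
    (if p = j \<and> (t, i) \<in> cells xs then delta (t, i) (c * d) else 0)"
  by (rule ext) (auto simp: bar_act_munit[OF assms] delta_def split: if_splits)

lemma bar_induct [consumes 1, case_names zero add]:
  fixes v :: "nat \<times> nat \<Rightarrow> 'k::field"
  assumes v: "v \<in> carrier (bar xs)" and zero: "P 0"
    and add: "\<And>v z c. v \<in> carrier (bar xs) \<Longrightarrow> z \<in> cells xs \<Longrightarrow> P v \<Longrightarrow> P (v + delta z c)"
  shows "P v"
  using v
proof (induction "card {z. v z \<noteq> 0}" arbitrary: v rule: less_induct)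
  case less
  have sub: "{z. v z \<noteq> 0} \<subseteq> cells xs" using less.prems by (auto simp: bar_carrier)
  hence fin: "finite {z. v z \<noteq> 0}" using finite_cells finite_subset by blast
  show ?case
  proof (cases "{z. v z \<noteq> 0} = {}")
    case True
    hence "v = 0" by (auto simp: fun_eq_iff)
    thus ?thesis using zero by simp
  next
    case False
    then obtain z where z: "v z \<noteq> 0" by auto
    define w where "w = (\<lambda>y. if y = z then 0 else v y)"
    have w: "w \<in> carrier (bar xs)" using less.prems by (auto simp: w_def bar_carrier)
    have "{y. w y \<noteq> 0} \<subset> {y. v y \<noteq> 0}" using z by (auto simp: w_def)
    hence "P w" using less.hyps[of w] w psubset_card_mono[OF fin] by blast
    moreover have "v = w + delta z (v z)" by (auto simp: w_def delta_def)
    ultimately show ?thesis using add[OF w, of z "v z"] z sub by auto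
  qed
qed

text \<open>Makes an entry of the matrix visible on every summand that contains both vertices. The
  longest interval therefore shows all entries on and below the diagonal.\<close>

lemma bar_act_Tri_delta:
  assumes xs: "set xs \<subseteq> intervals n" and A: "A \<in> carrier (Tri n)" and "(t, p) \<in> cells xs" "(t, q) \<in> cells xs"
  shows "bar_act xs A (delta (t, p) d) (t, q) = A $$ (q, p) * d"
proof -
  have "bar_act xs A (delta (t, p) d) (t, q) = (\<Sum>r\<le>q. if r = p then A $$ (q, p) * d else 0)"
    using assms by (simp add: bar_act_def delta_def if_distrib cong: if_cong)
  thus ?thesis using A cells_lt[OF xs assms(3)] cells_lt[OF xs assms(4)] by (auto simp: Tri_carrier)
qed

lemma bar_fg:
  assumes xs: "set xs \<subseteq> intervals n"
  shows "fg_module (Tri n) (bar xs :: ('k::field mat, _) module)"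
proof -
  let ?B = "bar xs :: ('k mat, _) module"
  let ?S = "(\<lambda>z. delta z (1::'k)) ` cells xs"
  note lm = bar_left_module[OF xs, where 'k = 'k]
  have "H = carrier ?B" if H: "submodule H (Tri n) ?B" and S: "?S \<subseteq> H" for H
  proof
    show "H \<subseteq> carrier ?B" using submoduleD(1)[OF lm H] .
    show "carrier ?B \<subseteq> H"
    proof
      fix v :: "nat \<times> nat \<Rightarrow> 'k" assume "v \<in> carrier ?B"
      thus "v \<in> H"
      proof (induction v rule: bar_induct)
        case zero thus ?case using submoduleD(2)[OF lm H] unfolding bar_simps .
      next
        case (add v z c)
        obtain t p where z: "z = (t, p)" by (cases z)
        have p: "p < n" using add.hyps cells_lt[OF xs] z by blast
        \<comment> \<open>The diagonal unit with entry \<open>c\<close> rescales a basis vector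
          inside the submodule.\<close>
        have "bar_act xs (munit n c p p) (delta z 1) \<in> H"
          using submoduleD(4)[OF lm H munit_carrier[of p p n c], of "delta z 1"] S add.hyps by auto
        hence "delta z c \<in> H" using bar_act_munit_delta[OF xs, of p p c t p 1] p add.hyps z by simp
        thus ?case using submoduleD(3)[OF lm H add.IH, of "delta z c"] unfolding bar_simps by blast
      qed
    qed
  qed
  moreover have "finite ?S" "?S \<subseteq> carrier ?B" using finite_cells delta_carrier by auto
  ultimately show ?thesis unfolding fg_module_def using lm by blast
qed

lemma bar_mset_iso:
  assumes xs: "set xs \<subseteq> intervals n" and eq: "mset xs = mset ys"
  shows "mod_iso (Tri n) (bar xs :: ('k::field mat, _) module) (bar ys)"
proof -
  have ys: "set ys \<subseteq> intervals n" using xs eq by (metis set_mset_mset)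
  obtain \<pi> where \<pi>: "bij_betw \<pi> {..<length xs} {..<length ys}" "\<forall>i<length xs. xs ! i = ys ! \<pi> i"
    using permutation_Ex_bij[OF eq] by blast
  have len: "length ys = length xs" using eq by (metis size_mset)
  define \<rho> where "\<rho> = inv_into {..<length xs} \<pi>"
  have \<rho>: "\<rho> t < length xs" "\<pi> (\<rho> t) = t" if "t < length xs" for t
    using that \<pi>(1) bij_betw_inv_into_right[OF \<pi>(1), of t] bij_betw_imp_surj_on[OF bij_betw_inv_into[OF \<pi>(1)]] len
    unfolding \<rho>_def by auto
  have \<pi>': "\<pi> t < length xs" "\<rho> (\<pi> t) = t" if "t < length xs" for t
    using that \<pi>(1) bij_betw_inv_into_left[OF \<pi>(1), of t] len
    unfolding \<rho>_def by (auto simp: bij_betw_def)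
  have c1: "(t, p) \<in> cells ys \<longleftrightarrow> t < length xs \<and> (\<rho> t, p) \<in> cells xs" for t p
    using \<rho> \<pi>(2) len by (auto simp: cells_def)
  have c2: "(t, p) \<in> cells xs \<longleftrightarrow> t < length xs \<and> (\<pi> t, p) \<in> cells ys" for t p
    using \<pi>(2) \<pi>' len by (auto simp: cells_def)
  let ?f = "\<lambda>v. (\<lambda>(t, p). if t < length xs then v (\<rho> t, p) else (0::'k))"
  let ?g = "\<lambda>v. (\<lambda>(t, p). if t < length xs then v (\<pi> t, p) else (0::'k))"
  have "lin (Tri n) (bar xs) (bar ys) ?f"
  proof (rule lin_TriI[OF bar_left_module[OF xs] bar_left_module[OF ys]])
    show "?f v \<in> carrier (bar ys)" if "v \<in> carrier (bar xs)" for v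
      using that c1 by (auto simp: bar_carrier)
    show "?f (munit n c i j \<odot>\<^bsub>bar xs\<^esub> x) = munit n c i j \<odot>\<^bsub>bar ys\<^esub> ?f x" if "j \<le> i" "i < n" for c i j x
      by (rule ext) (auto simp: bar_act_munit[OF xs that] bar_act_munit[OF ys that] c1)
  qed (auto simp: fun_eq_iff)
  moreover have "bij_betw ?f (carrier (bar xs)) (carrier (bar ys))"
  proof (rule bij_betw_byWitness[where f' = ?g])
    show "\<forall>v\<in>carrier (bar xs). ?g (?f v) = v" using \<pi>' by (auto simp: bar_carrier fun_eq_iff cells_def)
    show "\<forall>v\<in>carrier (bar ys). ?f (?g v) = v" using \<rho> len by (auto simp: bar_carrier fun_eq_iff cells_def)
    show "?f ` carrier (bar xs) \<subseteq> carrier (bar ys)" using c1 by (auto simp: bar_carrier)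
    show "?g ` carrier (bar ys) \<subseteq> carrier (bar xs)" using c2 by (auto simp: bar_carrier)
  qed
  ultimately show ?thesis using mod_iso_iff[OF bar_left_module[OF xs]] by (auto simp: lin_iso_def)
qed

text \<open>A one-element list has its summand at index 0, so the coordinate \<open>(t, p)\<close>
  of \<open>bar xs\<close> corresponds to the coordinate \<open>(0, p)\<close> of the
  \<open>t\<close>-th component.\<close>

lemma bar_direct_sum_iso:
  assumes xs: "set xs \<subseteq> intervals n"
  shows "mod_iso (Tri n) (bar xs :: ('k::field mat, _) module) (direct_sum {..<length xs} (\<lambda>t. bar [xs ! t]))"
proof -
  let ?D = "direct_sum {..<length xs} (\<lambda>t. bar [xs ! t] :: ('k mat, _) module)"
  have xt: "set [xs ! t] \<subseteq> intervals n" if "t < length xs" for t using xs that nth_mem by fastforce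
  have lmD: "left_module (Tri n) ?D"
    by (rule direct_sum_left_module[OF Tri_ring]) (simp_all add: bar_left_module[OF xt])
  have cD: "carrier ?D = (\<Pi>\<^sub>E t\<in>{..<length xs}. carrier (bar [xs ! t]))"
    by (rule direct_sum_carrier_finite) simp
  have c: "(s, p) \<in> cells [xs ! t] \<longleftrightarrow> s = 0 \<and> (t, p) \<in> cells xs" if "t < length xs" for s t p
    using that by (auto simp: cells_def)
  let ?f = "\<lambda>v. \<lambda>t\<in>{..<length xs}. (\<lambda>(s, p). if s = 0 then v (t, p) else (0::'k))"
  let ?g = "\<lambda>w (t, p). if t < length xs then w t (0, p) else (0::'k)"
  have f: "?f v \<in> carrier ?D" if "v \<in> carrier (bar xs)" for v
    using that c unfolding cD by (auto simp: bar_carrier PiE_iff)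
  have "lin (Tri n) (bar xs) ?D ?f"
  proof (rule lin_TriI[OF bar_left_module[OF xs] lmD f])
    show "?f (x \<oplus>\<^bsub>bar xs\<^esub> y) = ?f x \<oplus>\<^bsub>?D\<^esub> ?f y" for x y
      by (rule ext) (auto simp: direct_sum_def fun_eq_iff)
    show "?f (munit n d i j \<odot>\<^bsub>bar xs\<^esub> x) = munit n d i j \<odot>\<^bsub>?D\<^esub> ?f x" if "j \<le> i" "i < n" for d i j x
      by (rule ext) (auto simp: direct_sum_def fun_eq_iff bar_act_munit[OF xs that] bar_act_munit[OF xt that] c)
  qed
  moreover have "bij_betw ?f (carrier (bar xs)) (carrier ?D)"
  proof (rule bij_betw_byWitness[where f' = ?g])
    show "\<forall>v\<in>carrier (bar xs). ?g (?f v) = v" by (auto simp: bar_carrier fun_eq_iff cells_def)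
    show "\<forall>w\<in>carrier ?D. ?f (?g w) = w"
      unfolding cD by (auto simp: bar_carrier fun_eq_iff PiE_iff extensional_def c)
    show "?f ` carrier (bar xs) \<subseteq> carrier ?D" using f by blast
    have "?g w (t, p) = 0" if w: "w \<in> carrier ?D" and tp: "(t, p) \<notin> cells xs" for w t p
    proof (cases "t < length xs")
      case True
      hence "w t \<in> carrier (bar [xs ! t])" using w unfolding cD by auto
      moreover have "(0, p) \<notin> cells [xs ! t]" using c[OF True] tp by simp
      ultimately show ?thesis by (simp add: bar_carrier)
    qed simp
    thus "?g ` carrier ?D \<subseteq> carrier (bar xs)"
      unfolding bar_carrier image_subset_iff split_paired_All by blast
  qed
  ultimately show ?thesis using mod_iso_iff[OF bar_left_module[OF xs]] by (auto simp: lin_iso_def)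
qed

text \<open>A nonzero coordinate at a vertex p is carried to the last vertex by the unit at (b, p),
  which kills all other coordinates. So all nonzero submodules share a nonzero vector, and no two of
  them can be complementary.\<close>

lemma bar_submodule_socle:
  assumes ab: "(a, b) \<in> intervals n" and H: "submodule H (Tri n) (bar [(a, b)] :: ('k::field mat, _) module)"
    and "H \<noteq> {0}"
  shows "delta (0, b) 1 \<in> H"
proof -
  have xs: "set [(a, b)] \<subseteq> intervals n" using ab by simp
  note lm = bar_left_module[OF xs, where 'k = 'k]
  have "0 \<in> H" using submoduleD(2)[OF lm H] by simp
  then obtain v where v: "v \<in> H" "v \<noteq> 0" using assms(3) by blast
  then obtain z where z: "v z \<noteq> 0" by (auto simp: fun_eq_iff)
  have vc: "v \<in> carrier (bar [(a, b)])" using submoduleD(1)[OF lm H] v by blast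
  hence "z \<in> cells [(a, b)]" using z unfolding bar_carrier by metis
  then obtain p where p: "z = (0, p)" "a \<le> p" "p \<le> b" by (cases z) (auto simp: cells_def)
  have b: "b < n" using ab by (simp add: intervals_def)
  let ?A = "munit n (1 / v z) b p"
  have "bar_act [(a, b)] ?A v = delta (0, b) 1"
    using p b z by (auto simp: fun_eq_iff bar_act_munit[OF xs p(3) b] delta_def cells_def)
  thus ?thesis using submoduleD(4)[OF lm H munit_carrier[OF p(3), of n "1 / v z"] v(1)] by simp
qed

lemma bar_indecomposable:
  assumes ab: "(a, b) \<in> intervals n"
  shows "indecomposable (Tri n) (bar [(a, b)] :: ('k::field mat, _) module)"
proof -
  have "delta (0, b) (1::'k) \<in> carrier (bar [(a, b)])"
    using ab by (intro delta_carrier) (auto simp: cells_def intervals_def)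
  moreover have ne: "delta (0, b) (1::'k) \<noteq> 0" by (auto simp: delta_def fun_eq_iff)
  ultimately show ?thesis
    using bar_submodule_socle[OF ab, where 'k = 'k] unfolding indecomposable_def
    by (metis IntI bar_simps(1) singletonD)
qed

lemma bar_indecomposable_length:
  assumes xs: "set xs \<subseteq> intervals n" and ind: "indecomposable (Tri n) (bar xs :: ('k::field mat, _) module)"
  shows "length xs = 1"
proof -
  let ?B = "bar xs :: ('k mat, _) module"
  note lm = bar_left_module[OF xs, where 'k = 'k]
  have "xs \<noteq> []"
  proof
    assume "xs = []"
    hence "carrier ?B = {0}" by (auto simp: bar_carrier cells_def fun_eq_iff)
    thus False using ind by (simp add: indecomposable_def)
  qed
  moreover have "\<not> 2 \<le> length xs"
  proof
    assume l: "2 \<le> length xs"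
    \<comment> \<open>The vectors supported on the summands selected by \<open>Q\<close>; the module
      is split into its first summand and the rest.\<close>
    let ?H = "\<lambda>Q. {v \<in> carrier ?B. \<forall>t p. \<not> Q t \<longrightarrow> v (t, p) = 0}"
    have sub: "submodule (?H Q) (Tri n) ?B" for Q
      unfolding submodule_iff[OF lm] using left_module_ops(3,4)[OF lm]
      by (auto simp: bar_act_def bar_carrier)
    define P where "P = (\<lambda>t::nat. t = 0)"
    have "?H P \<inter> ?H (\<lambda>t. \<not> P t) = {0}" by (auto simp: bar_carrier fun_eq_iff) metis
    moreover have "?H P <+>\<^bsub>?B\<^esub> ?H (\<lambda>t. \<not> P t) = carrier ?B"
    proof
      show "?H P <+>\<^bsub>?B\<^esub> ?H (\<lambda>t. \<not> P t) \<subseteq> carrier ?B" by (auto simp: set_add_def set_mult_def bar_carrier)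
      show "carrier ?B \<subseteq> ?H P <+>\<^bsub>?B\<^esub> ?H (\<lambda>t. \<not> P t)"
      proof
        fix v assume v: "v \<in> carrier ?B"
        let ?r = "\<lambda>Q. (\<lambda>(t, p). if Q t then v (t, p) else 0)"
        have v_eq: "v = ?r P + ?r (\<lambda>t. \<not> P t)" by (auto simp: fun_eq_iff)
        have r: "?r Q \<in> ?H Q" for Q using v by (auto simp: bar_carrier)
        have sum: "x + y \<in> H <+>\<^bsub>?B\<^esub> K" if "x \<in> H" "y \<in> K" for x y H K
          using that by (auto simp: set_add_def set_mult_def)
        show "v \<in> ?H P <+>\<^bsub>?B\<^esub> ?H (\<lambda>t. \<not> P t)" by (subst v_eq, rule sum[OF r r])
      qed
    qed
    ultimately have or: "?H P = {0} \<or> ?H (\<lambda>t. \<not> P t) = {0}"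
      using ind[unfolded indecomposable_def, THEN conjunct2, THEN spec[of _ "?H P"],
          THEN spec[of _ "?H (\<lambda>t. \<not> P t)"]] sub[of P] sub[of "\<lambda>t. \<not> P t"]
      unfolding bar_simps by blast
    have ne: "?H Q \<noteq> {0}" if t: "t < length xs" "Q t" for Q t
    proof
      assume 0: "?H Q = {0}"
      have "xs ! t \<in> intervals n" using t xs nth_mem by blast
      hence "(t, fst (xs ! t)) \<in> cells xs" using t by (auto simp: cells_def intervals_def)
      hence "delta (t, fst (xs ! t)) 1 \<in> ?H Q" using delta_carrier t by (auto simp: delta_def)
      hence "delta (t, fst (xs ! t)) (1::'k) = 0" unfolding 0 by blast
      hence "delta (t, fst (xs ! t)) (1::'k) (t, fst (xs ! t)) = 0" by simp
      thus False by (simp add: delta_def)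
    qed
    have "0 < length xs" "1 < length xs" "P 0" "\<not> P 1" using l by (auto simp: P_def)
    thus False using or ne[of 0 P] ne[of 1 "\<lambda>t. \<not> P t"] by blast
  qed
  ultimately show ?thesis by (cases "length xs") auto
qed

section \<open>Coordinates for finitely generated modules\<close>

definition fscale :: "'k::field \<Rightarrow> ('i \<Rightarrow> 'k) \<Rightarrow> 'i \<Rightarrow> 'k" where
  "fscale c f = (\<lambda>i. c * f i)"

lemma fscale_apply [simp]: "fscale c f i = c * f i"
  by (simp add: fscale_def)

interpretation fn: vector_space "fscale :: 'k::field \<Rightarrow> ('i \<Rightarrow> 'k) \<Rightarrow> 'i \<Rightarrow> 'k"
  by unfold_locales (auto simp: fscale_def fun_eq_iff algebra_simps)

definition initial_space :: "nat \<Rightarrow> (nat \<Rightarrow> 'k::field) set" where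
  "initial_space d = {v. \<forall>i\<ge>d. v i = 0}"

lemma supported_in_span:
  fixes v :: "'i \<Rightarrow> 'k::field"
  assumes "finite A" "\<And>i. i \<notin> A \<Longrightarrow> v i = 0"
  shows "v \<in> fn.span ((\<lambda>i. delta i 1) ` A)"
proof -
  have "v = (\<Sum>i\<in>A. fscale (v i) (delta i 1))"
  proof
    fix j
    have "(\<Sum>i\<in>A. fscale (v i) (delta i 1)) j = (\<Sum>i\<in>A. fscale (v i) (delta i 1) j)"
      using assms(1) by (induction A rule: finite_induct) auto
    also have "\<dots> = (\<Sum>i\<in>A. if i = j then v j else 0)" by (intro sum.cong) (auto simp: delta_def)
    also have "\<dots> = v j" using assms by (auto simp: sum.delta)
    finally show "v j = (\<Sum>i\<in>A. fscale (v i) (delta i 1)) j" by simp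
  qed
  also have "\<dots> \<in> fn.span ((\<lambda>i. delta i 1) ` A)"
    by (intro fn.span_sum fn.span_scale fn.span_base) auto
  finally show ?thesis .
qed

text \<open>The ambient function space may have infinite dimension; the finite set \<open>T\<close>
  keeps the bases finite. A basis of \<open>K\<close> together with a vector of \<open>W\<close>
  outside \<open>K\<close> is still independent.\<close>

lemma dim_strict_mono:
  assumes "finite T" and WT: "W \<subseteq> fn.span T" and K: "fn.subspace K" "K \<subset> W"
  shows "fn.dim K < fn.dim W"
proof -
  obtain B where B: "B \<subseteq> K" "fn.independent B" "K \<subseteq> fn.span B" "card B = fn.dim K"
    using fn.basis_exists by blast
  obtain C where C: "C \<subseteq> W" "fn.independent C" "W \<subseteq> fn.span C" "card C = fn.dim W"
    using fn.basis_exists by blast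
  have finC: "finite C" using fn.independent_span_bound[OF assms(1) C(2)] C(1) WT by blast
  have finB: "finite B" using fn.independent_span_bound[OF assms(1) B(2)] B(1) K(2) WT by blast
  obtain y where y: "y \<in> W" "y \<notin> K" using K(2) by blast
  have "fn.span B \<subseteq> K" using B(1) K(1) by (rule fn.span_minimal)
  hence yB: "y \<notin> fn.span B" using y(2) by blast
  hence "fn.independent (insert y B)" using B(2) by (rule fn.independent_insertI)
  moreover have "insert y B \<subseteq> fn.span C" using y(1) B(1) K(2) C(3) by blast
  ultimately have "card (insert y B) \<le> card C" using fn.independent_span_bound[OF finC] by blast
  moreover have "card (insert y B) = Suc (card B)"
    using finB yB fn.span_base by (intro card_insert_disjoint) blast+
  ultimately show ?thesis using B(4) C(4) by simp
qed

text \<open>The field acts on every module through the scalar matrices.\<close>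

definition scal :: "nat \<Rightarrow> 'k::field \<Rightarrow> 'k mat" where
  "scal n c = c \<cdot>\<^sub>m 1\<^sub>m n"

lemma scal_carrier: "scal n c \<in> carrier (Tri n)"
  by (simp add: scal_def Tri_carrier)

lemma scal_one: "scal n 1 = 1\<^sub>m n"
  by (rule eq_matI) (auto simp: scal_def)

lemma scal_mult_left: "A \<in> carrier_mat n n \<Longrightarrow> scal n c * A = c \<cdot>\<^sub>m A"
  by (simp add: scal_def mult_smult_assoc_mat[of _ n n _ n])

lemma scal_mult_right: "A \<in> carrier_mat n n \<Longrightarrow> A * scal n c = c \<cdot>\<^sub>m A"
  by (simp add: scal_def mult_smult_distrib[of _ n n _ n])

lemma munit_carrier_mat: "munit n c i j \<in> carrier_mat n n"
  by (rule carrier_matI) simp_all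

lemma smult_munit: "c \<cdot>\<^sub>m munit n d i j = munit n (c * d) i j"
  by (rule eq_matI) auto

lemma munit_mult_neq:
  assumes "i < n" "j \<noteq> k" "j \<le> i" "l \<le> k" "k < n"
  shows "munit n c i j * munit n d k l = 0\<^sub>m n n"
proof (rule eq_matI)
  fix r s assume "r < dim_row (0\<^sub>m n n :: 'a mat)" "s < dim_col (0\<^sub>m n n :: 'a mat)"
  hence rs: "r < n" "s < n" by simp_all
  have "(munit n c i j * munit n d k l) $$ (r, s) =
      (\<Sum>m<n. (if r = i \<and> m = j then c else 0) * (if m = k \<and> s = l then d else 0))"
    using Tri_mult_index[OF munit_carrier munit_carrier rs] assms rs by simp
  also have "\<dots> = 0" using assms by (intro sum.neutral) auto
  finally show "(munit n c i j * munit n d k l) $$ (r, s) = 0\<^sub>m n n $$ (r, s)" using rs by simp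
qed simp_all

text \<open>A module on an arbitrary type carries no type class structure, so a linearly independent
  \<open>d\<close>-tuple in it is encoded as an injective linear map from the
  \<open>d\<close>-dimensional coordinate space.\<close>

definition linear_embedding ::
  "nat \<Rightarrow> ('k::field mat, 'm) module \<Rightarrow> nat \<Rightarrow> ((nat \<Rightarrow> 'k) \<Rightarrow> 'm) \<Rightarrow> bool" where
  "linear_embedding n M d \<beta> \<longleftrightarrow> \<beta> ` initial_space d \<subseteq> carrier M \<and>
    (\<forall>v\<in>initial_space d. \<forall>w\<in>initial_space d. \<beta> (v + w) = \<beta> v \<oplus>\<^bsub>M\<^esub> \<beta> w) \<and>
    (\<forall>c. \<forall>v\<in>initial_space d. \<beta> (fscale c v) = scal n c \<odot>\<^bsub>M\<^esub> \<beta> v) \<and>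
    inj_on \<beta> (initial_space d)"

lemma linear_embeddingD:
  assumes "linear_embedding n M d \<beta>"
  shows "v \<in> initial_space d \<Longrightarrow> \<beta> v \<in> carrier M"
    and "v \<in> initial_space d \<Longrightarrow> w \<in> initial_space d \<Longrightarrow> \<beta> (v + w) = \<beta> v \<oplus>\<^bsub>M\<^esub> \<beta> w"
    and "v \<in> initial_space d \<Longrightarrow> \<beta> (fscale c v) = scal n c \<odot>\<^bsub>M\<^esub> \<beta> v"
    and "inj_on \<beta> (initial_space d)"
  using assms unfolding linear_embedding_def by blast+

text \<open>The elements of \<open>G\<close> are taken in turn; one that lies outside the range
  reached so far receives a new coordinate.\<close>

lemma finite_subset_coordinates:
  fixes M :: "('k::field mat, 'm) module"
  assumes M: "left_module (Tri n) M" and G: "finite G" "G \<subseteq> carrier M"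
  shows "\<exists>d \<beta>. linear_embedding n M d \<beta> \<and> G \<subseteq> \<beta> ` initial_space d"
  using G
proof (induction G rule: finite_induct)
  case empty
  interpret left_module "Tri n" M by fact
  show ?case
    by (rule exI[of _ 0], rule exI[of _ "\<lambda>_. \<zero>\<^bsub>M\<^esub>"])
      (auto simp: linear_embedding_def initial_space_def inj_on_def fun_eq_iff smult_zero_right scal_carrier)
next
  case (insert g G)
  interpret left_module "Tri n" M by fact
  have g: "g \<in> carrier M" using insert.prems by simp
  obtain d \<beta> where \<beta>: "linear_embedding n M d \<beta>" and G: "G \<subseteq> \<beta> ` initial_space d"
    using insert.IH insert.prems by (meson insert_subset)
  note \<beta>c = linear_embeddingD(1)[OF \<beta>] and add = linear_embeddingD(2)[OF \<beta>]
    and sc = linear_embeddingD(3)[OF \<beta>] and inj = linear_embeddingD(4)[OF \<beta>]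
  have V0: "0 \<in> initial_space d" by (simp add: initial_space_def)
  have Vadd: "v + w \<in> initial_space d" if "v \<in> initial_space d" "w \<in> initial_space d" for v w :: "nat \<Rightarrow> 'k"
    using that by (simp add: initial_space_def)
  have Vsc: "fscale c v \<in> initial_space d" if "v \<in> initial_space d" for v :: "nat \<Rightarrow> 'k" and c
    using that by (simp add: initial_space_def)
  have \<beta>0: "\<beta> 0 = \<zero>\<^bsub>M\<^esub>" using add[OF V0 V0] \<beta>c[OF V0] by simp
  show ?case
  proof (cases "g \<in> \<beta> ` initial_space d")
    case True
    hence "insert g G \<subseteq> \<beta> ` initial_space d" using G by blast
    thus ?thesis using \<beta> by blast
  next
    case False
    \<comment> \<open>\<open>tr\<close> forgets the new coordinate \<open>d\<close>, which serves as
      the coefficient of \<open>g\<close> in \<open>\<gamma>\<close>.\<close>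
    define tr where "tr = (\<lambda>(v :: nat \<Rightarrow> 'k) i. if i = d then 0 else v i)"
    have tr: "tr v \<in> initial_space d" if "v \<in> initial_space (Suc d)" for v
      using that by (auto simp: tr_def initial_space_def)
    have tr_add: "tr (v + w) = tr v + tr w" for v w by (auto simp: tr_def fun_eq_iff)
    have tr_sc: "tr (fscale c v) = fscale c (tr v)" for c v by (auto simp: tr_def fun_eq_iff)
    define \<gamma> where "\<gamma> = (\<lambda>v. \<beta> (tr v) \<oplus>\<^bsub>M\<^esub> scal n (v d) \<odot>\<^bsub>M\<^esub> g)"
    have sg: "scal n c \<odot>\<^bsub>M\<^esub> g \<in> carrier M" for c using smult_closed[OF scal_carrier g] .
    have scadd: "scal n (a + b) = scal n a \<oplus>\<^bsub>Tri n\<^esub> scal n b" for a b :: 'k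
      by (rule eq_matI) (auto simp: scal_def Tri_simps)
    have scmult: "scal n (a * b) = scal n a \<otimes>\<^bsub>Tri n\<^esub> scal n b" for a b :: 'k
      using scal_mult_left[of "scal n b" n a] by (auto simp: scal_def Tri_simps)
    have \<gamma>c: "\<gamma> v \<in> carrier M" if "v \<in> initial_space (Suc d)" for v
      using \<beta>c[OF tr[OF that]] sg by (simp add: \<gamma>_def)
    have \<gamma>add: "\<gamma> (v + w) = \<gamma> v \<oplus>\<^bsub>M\<^esub> \<gamma> w"
      if "v \<in> initial_space (Suc d)" "w \<in> initial_space (Suc d)" for v w
      using \<beta>c[OF tr[OF that(1)]] \<beta>c[OF tr[OF that(2)]] sg add[OF tr[OF that(1)] tr[OF that(2)]]
      by (simp add: \<gamma>_def tr_add scadd smult_l_distr[OF scal_carrier scal_carrier g] M.a_ac)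
    have \<gamma>sc: "\<gamma> (fscale c v) = scal n c \<odot>\<^bsub>M\<^esub> \<gamma> v" if "v \<in> initial_space (Suc d)" for c v
      using \<beta>c[OF tr[OF that]] sg sc[OF tr[OF that]]
      by (simp add: \<gamma>_def tr_sc scmult smult_assoc[OF scal_carrier scal_carrier g] smult_r_distr[OF scal_carrier])
    have ker: "v = 0" if v: "v \<in> initial_space (Suc d)" "\<gamma> v = \<zero>\<^bsub>M\<^esub>" for v
    proof (cases "v d = 0")
      case True
      have "scal n (0::'k) = \<zero>\<^bsub>Tri n\<^esub>" by (rule eq_matI) (auto simp: scal_def Tri_simps)
      hence "\<beta> (tr v) = \<zero>\<^bsub>M\<^esub>" using v True \<beta>c[OF tr[OF v(1)]] g by (simp add: \<gamma>_def smult_zero_left)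
      hence "tr v = 0" using inj_onD[OF inj _ tr[OF v(1)] V0] \<beta>0 by metis
      thus ?thesis using True by (auto simp: tr_def fun_eq_iff split: if_splits)
    next
      case nz: False
      \<comment> \<open>Rescaled to last coordinate \<open>- 1\<close>, a vector of the kernel
        expresses \<open>g\<close> by the old coordinates, contrary to the case assumption.\<close>
      let ?u = "fscale (- 1 / v d) v"
      have u: "?u \<in> initial_space (Suc d)" using v(1) by (simp add: initial_space_def)
      have "\<gamma> ?u = \<zero>\<^bsub>M\<^esub>" unfolding \<gamma>sc[OF v(1)] v(2) by (rule smult_zero_right[OF scal_carrier])
      moreover have "?u d = - 1" using nz by simp
      ultimately have eq: "\<beta> (tr ?u) \<oplus>\<^bsub>M\<^esub> scal n (- 1) \<odot>\<^bsub>M\<^esub> g = \<zero>\<^bsub>M\<^esub>" unfolding \<gamma>_def by metis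
      have "scal n (- 1 :: 'k) \<oplus>\<^bsub>Tri n\<^esub> \<one>\<^bsub>Tri n\<^esub> = \<zero>\<^bsub>Tri n\<^esub>"
        by (rule eq_matI) (auto simp: scal_def Tri_simps)
      hence neg: "scal n (- 1) \<odot>\<^bsub>M\<^esub> g \<oplus>\<^bsub>M\<^esub> g = \<zero>\<^bsub>M\<^esub>"
        using smult_l_distr[OF scal_carrier[of n "- 1"] R.one_closed g] g by (simp add: smult_zero_left)
      have "\<beta> (tr ?u) = g"
        using eq neg \<beta>c[OF tr[OF u]] sg[of "- 1"] g
        by (metis M.add.inv_comm M.minus_equality M.minus_minus)
      thus ?thesis using False tr[OF u] by blast
    qed
    have \<gamma>inj: "inj_on \<gamma> (initial_space (Suc d))"
    proof (rule inj_onI)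
      fix v w assume vw: "v \<in> initial_space (Suc d)" "w \<in> initial_space (Suc d)" "\<gamma> v = \<gamma> w"
      have vw': "v - w \<in> initial_space (Suc d)" using vw by (simp add: initial_space_def)
      have "\<gamma> w = \<gamma> (v - w) \<oplus>\<^bsub>M\<^esub> \<gamma> w" using \<gamma>add[OF vw' vw(2)] vw(3) by simp
      hence "\<gamma> (v - w) = \<zero>\<^bsub>M\<^esub>" using \<gamma>c[OF vw'] \<gamma>c[OF vw(2)] by (metis M.l_zero M.add.right_cancel M.zero_closed)
      thus "v = w" using ker[OF vw'] by simp
    qed
    have "insert g G \<subseteq> \<gamma> ` initial_space (Suc d)"
    proof -
      have "\<gamma> (delta d 1) = g"
      proof -
        have "tr (delta d 1) = 0" by (auto simp: tr_def delta_def fun_eq_iff)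
        moreover have "scal n (1::'k) = \<one>\<^bsub>Tri n\<^esub>" by (simp add: scal_one Tri_simps)
        ultimately show ?thesis using g \<beta>0 by (simp add: \<gamma>_def delta_def)
      qed
      moreover have "delta d (1::'k) \<in> initial_space (Suc d)" by (auto simp: delta_def initial_space_def)
      moreover have "\<beta> ` initial_space d \<subseteq> \<gamma> ` initial_space (Suc d)"
      proof (rule image_subsetI)
        fix v :: "nat \<Rightarrow> 'k" assume v: "v \<in> initial_space d"
        have "tr v = v" "v d = 0" using v by (auto simp: tr_def initial_space_def fun_eq_iff)
        moreover have "scal n (0::'k) = \<zero>\<^bsub>Tri n\<^esub>" by (rule eq_matI) (auto simp: scal_def Tri_simps)
        ultimately have "\<gamma> v = \<beta> v" using \<beta>c[OF v] g by (simp add: \<gamma>_def smult_zero_left)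
        moreover have "v \<in> initial_space (Suc d)" using v by (simp add: initial_space_def)
        ultimately show "\<beta> v \<in> \<gamma> ` initial_space (Suc d)" by force
      qed
      ultimately show ?thesis using G by blast
    qed
    moreover have "linear_embedding n M (Suc d) \<gamma>"
      unfolding linear_embedding_def using \<gamma>c \<gamma>add \<gamma>sc \<gamma>inj by (intro conjI ballI allI) blast+
    ultimately show ?thesis by blast
  qed
qed

text \<open>Finitely generated modules are finite dimensional: the products of the units
  \<open>munit n 1 i j\<close> with the generators span the module over the field.\<close>

lemma fg_module_coordinates:
  fixes M :: "('k::field mat, 'm) module"
  assumes M: "fg_module (Tri n) M"
  obtains d and act :: "'k mat \<Rightarrow> (nat \<Rightarrow> 'k) \<Rightarrow> nat \<Rightarrow> 'k"
  where "left_module (Tri n) (tmod (initial_space d) act)"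
    "\<And>c v. v \<in> initial_space d \<Longrightarrow> act (scal n c) v = fscale c v"
    "mod_iso (Tri n) M (tmod (initial_space d) act)"
proof -
  have lm: "left_module (Tri n) M" using M by (simp add: fg_module_def)
  interpret left_module "Tri n" M by fact
  obtain S where S': "finite S \<and> S \<subseteq> carrier M \<and> (\<forall>H. submodule H (Tri n) M \<and> S \<subseteq> H \<longrightarrow> H = carrier M)"
    using M unfolding fg_module_def by (elim conjE exE) metis
  hence S: "finite S" "S \<subseteq> carrier M"
    and gen: "submodule H (Tri n) M \<Longrightarrow> S \<subseteq> H \<Longrightarrow> H = carrier M" for H by auto
  define G where "G = (\<lambda>(i, j, s). munit n 1 i j \<odot>\<^bsub>M\<^esub> s) ` {(i, j, s). j \<le> i \<and> i < n \<and> s \<in> S}"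
  have "finite G"
  proof -
    have "{(i, j, s). j \<le> i \<and> i < n \<and> s \<in> S} \<subseteq> {..<n} \<times> {..<n} \<times> S" by auto
    thus ?thesis unfolding G_def using S(1) by (meson finite_SigmaI finite_imageI finite_lessThan finite_subset)
  qed
  moreover have "G \<subseteq> carrier M" unfolding G_def using S(2) by (auto intro!: smult_closed munit_carrier)
  ultimately obtain d \<beta> where \<beta>: "linear_embedding n M d \<beta>" and G: "G \<subseteq> \<beta> ` initial_space d"
    using finite_subset_coordinates[OF lm, of G] by meson
  note \<beta>c = linear_embeddingD(1)[OF \<beta>] and add = linear_embeddingD(2)[OF \<beta>]
    and sc = linear_embeddingD(3)[OF \<beta>] and inj = linear_embeddingD(4)[OF \<beta>]
  let ?V = "initial_space d :: (nat \<Rightarrow> 'k) set"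
  have V0: "0 \<in> ?V" by (simp add: initial_space_def)
  have Vadd: "v + w \<in> ?V" if "v \<in> ?V" "w \<in> ?V" for v w using that by (simp add: initial_space_def)
  have Vneg: "- v \<in> ?V" if "v \<in> ?V" for v using that by (simp add: initial_space_def)
  have Vsc: "fscale c v \<in> ?V" if "v \<in> ?V" for v c using that by (simp add: initial_space_def)
  have \<beta>0: "\<beta> 0 = \<zero>\<^bsub>M\<^esub>" using add[OF V0 V0] \<beta>c[OF V0] by simp
  have radd: "x \<oplus>\<^bsub>M\<^esub> y \<in> \<beta> ` ?V" if "x \<in> \<beta> ` ?V" "y \<in> \<beta> ` ?V" for x y
    using that add Vadd by (metis (no_types, lifting) imageE image_eqI)
  have r0: "\<zero>\<^bsub>M\<^esub> \<in> \<beta> ` ?V" using \<beta>0 V0 by (metis image_eqI)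
  have rsc: "scal n c \<odot>\<^bsub>M\<^esub> x \<in> \<beta> ` ?V" if "x \<in> \<beta> ` ?V" for x c
    using that sc Vsc by (metis (no_types, lifting) imageE image_eqI)
  \<comment> \<open>So far the range of \<open>\<beta>\<close> is only known to be a subspace.
    \<open>H\<close> is the largest submodule inside it, and it contains the generators.\<close>
  define H where "H = {x \<in> carrier M. \<forall>A\<in>carrier (Tri n). A \<odot>\<^bsub>M\<^esub> x \<in> \<beta> ` ?V}"
  have "submodule H (Tri n) M"
    unfolding submodule_iff[OF lm] H_def
  proof (intro conjI ballI CollectI; (elim CollectE conjE)?)
    fix A B :: "'k mat" and x assume "A \<in> carrier (Tri n)" "B \<in> carrier (Tri n)" "x \<in> carrier M"
      "\<forall>A\<in>carrier (Tri n). A \<odot>\<^bsub>M\<^esub> x \<in> \<beta> ` ?V"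
    thus "B \<odot>\<^bsub>M\<^esub> (A \<odot>\<^bsub>M\<^esub> x) \<in> \<beta> ` ?V"
      using smult_assoc[of B A x] R.m_closed[of B A] by metis
  qed (use radd r0 in \<open>auto simp: smult_r_distr smult_zero_right\<close>)
  moreover have "S \<subseteq> H"
  proof
    fix s assume s: "s \<in> S"
    hence sM: "s \<in> carrier M" using S(2) by blast
    have "A \<odot>\<^bsub>M\<^esub> s \<in> \<beta> ` ?V" if "A \<in> carrier (Tri n)" for A
      using that
    proof (induction A rule: Tri_induct)
      case zero
      show ?case using smult_zero_left[OF sM] r0 by (simp add: Tri_simps)
    next
      case (add A B)
      thus ?case using smult_l_distr[OF add.hyps sM] radd by (simp add: Tri_simps)
    next
      case (munit c i j)
      have "munit n 1 i j \<odot>\<^bsub>M\<^esub> s \<in> G"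
        unfolding G_def by (rule image_eqI[of _ _ "(i, j, s)"]) (use munit s in auto)
      hence "munit n 1 i j \<odot>\<^bsub>M\<^esub> s \<in> \<beta> ` ?V" using G by blast
      hence "scal n c \<odot>\<^bsub>M\<^esub> (munit n 1 i j \<odot>\<^bsub>M\<^esub> s) \<in> \<beta> ` ?V" by (rule rsc)
      moreover have "scal n c \<otimes>\<^bsub>Tri n\<^esub> munit n 1 i j = munit n c i j"
        using scal_mult_left[OF munit_carrier_mat, of n c 1 i j] by (simp add: Tri_simps smult_munit)
      ultimately show ?case
        using smult_assoc[OF scal_carrier munit_carrier[OF munit(1)] sM, of c 1] by simp
    qed
    thus "s \<in> H" using sM by (simp add: H_def)
  qed
  ultimately have HM: "H = carrier M" by (rule gen)
  have surj: "\<beta> ` ?V = carrier M"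
  proof
    show "\<beta> ` ?V \<subseteq> carrier M" using \<beta>c by blast
    show "carrier M \<subseteq> \<beta> ` ?V"
    proof
      fix x assume x: "x \<in> carrier M"
      hence "\<one>\<^bsub>Tri n\<^esub> \<odot>\<^bsub>M\<^esub> x \<in> \<beta> ` ?V" using HM unfolding H_def by blast
      thus "x \<in> \<beta> ` ?V" using x by simp
    qed
  qed
  define g where "g = inv_into ?V \<beta>"
  have g\<beta>: "g (\<beta> v) = v" if "v \<in> ?V" for v using that inj by (simp add: g_def)
  have gc: "g x \<in> ?V" and \<beta>g: "\<beta> (g x) = x" if "x \<in> carrier M" for x
    using that surj by (auto simp: g_def inv_into_into f_inv_into_f)
  define act where "act = (\<lambda>A v. g (A \<odot>\<^bsub>M\<^esub> \<beta> v))"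
  have gadd: "g (x \<oplus>\<^bsub>M\<^esub> y) = g x + g y" if "x \<in> carrier M" "y \<in> carrier M" for x y
    using add[OF gc gc, of x y] that \<beta>g g\<beta>[OF Vadd[OF gc gc]] by metis
  have \<beta>act: "\<beta> (act A v) = A \<odot>\<^bsub>M\<^esub> \<beta> v" if "A \<in> carrier (Tri n)" "v \<in> ?V" for A v
    using that \<beta>g \<beta>c by (simp add: act_def)
  have "left_module (Tri n) (tmod ?V act)"
  proof (rule tmod_left_module[OF Tri_ring V0 Vadd Vneg])
    fix A B :: "'k mat" and v assume A: "A \<in> carrier (Tri n)" and v: "v \<in> ?V"
    show "act A v \<in> ?V" using A v \<beta>c gc by (simp add: act_def)
    show "act A (v + w) = act A v + act A w" if "w \<in> ?V" for w
      using A v that \<beta>c by (simp add: act_def add smult_r_distr gadd)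
    assume B: "B \<in> carrier (Tri n)"
    show "act (A \<oplus>\<^bsub>Tri n\<^esub> B) v = act A v + act B v"
      using A B v \<beta>c by (simp add: act_def smult_l_distr gadd)
    show "act (A \<otimes>\<^bsub>Tri n\<^esub> B) v = act A (act B v)"
      using A B v \<beta>c \<beta>g by (simp add: act_def smult_assoc)
  qed (use \<beta>c g\<beta> in \<open>auto simp: act_def\<close>)
  moreover have "act (scal n c) v = fscale c v" if "v \<in> ?V" for c v
    unfolding act_def using sc[OF that, of c] g\<beta>[OF Vsc[OF that]] by metis
  moreover have "mod_iso (Tri n) M (tmod ?V act)"
  proof -
    have "lin (Tri n) (tmod ?V act) M \<beta>" using \<beta>c add \<beta>act by (auto simp: lin_def)
    hence "lin_iso (Tri n) (tmod ?V act) M \<beta>"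
      using inj surj by (simp add: lin_iso_def bij_betw_def)
    thus ?thesis
      using mod_iso_sym[OF calculation(1) lm] mod_iso_iff[OF calculation(1)] by blast
  qed
  ultimately show ?thesis by (rule that)
qed

section \<open>Decomposition into interval modules\<close>

text \<open>\<open>act_scal\<close> ties scalar matrices to the pointwise scaling, so
  \<open>W\<close> is a subspace and has a dimension. \<open>W\<close> is not fixed to be a
  coordinate space, since the decomposition passes to kernels.\<close>

locale tri_tmod =
  fixes n :: nat and W :: "(nat \<Rightarrow> 'k::field) set" and act :: "'k mat \<Rightarrow> (nat \<Rightarrow> 'k) \<Rightarrow> nat \<Rightarrow> 'k"
  assumes lm: "left_module (Tri n) (tmod W act)"
    and act_scal: "\<And>c v. v \<in> W \<Longrightarrow> act (scal n c) v = fscale c v"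
begin

text \<open>\<open>E i i\<close> is the projection onto the space at vertex \<open>i\<close>; for
  \<open>j \<le> i\<close>, \<open>E i j\<close> takes the component at \<open>j\<close> along the
  quiver to vertex \<open>i\<close>.\<close>

abbreviation E :: "nat \<Rightarrow> nat \<Rightarrow> (nat \<Rightarrow> 'k) \<Rightarrow> nat \<Rightarrow> 'k" where
  "E i j \<equiv> act (munit n 1 i j)"

lemma act_closed: "A \<in> carrier (Tri n) \<Longrightarrow> v \<in> W \<Longrightarrow> act A v \<in> W"
  using left_module_ops(4)[OF lm] by simp

lemma W_add: "v \<in> W \<Longrightarrow> w \<in> W \<Longrightarrow> v + w \<in> W"
  using left_module_ops(3)[OF lm] unfolding tmod_simps .

lemma W_zero: "0 \<in> W"
  using left_module_ops(5)[OF lm] unfolding tmod_simps .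

lemma W_scale: "v \<in> W \<Longrightarrow> fscale c v \<in> W"
  using act_closed[OF scal_carrier, of v c] act_scal by simp

lemma W_subspace: "fn.subspace W"
  using W_add W_zero W_scale by (intro fn.subspaceI)

lemma W_diff: "v \<in> W \<Longrightarrow> w \<in> W \<Longrightarrow> v - w \<in> W"
  by (rule fn.subspace_diff[OF W_subspace])

lemma act_add: "A \<in> carrier (Tri n) \<Longrightarrow> v \<in> W \<Longrightarrow> w \<in> W \<Longrightarrow> act A (v + w) = act A v + act A w"
  using left_module.smult_r_distr[OF lm] unfolding tmod_simps .

lemma act_zero: "A \<in> carrier (Tri n) \<Longrightarrow> act A 0 = 0"
  using act_add[of A 0 0] W_zero by simp

lemma act_add_left: "A \<in> carrier (Tri n) \<Longrightarrow> B \<in> carrier (Tri n) \<Longrightarrow> v \<in> W \<Longrightarrow> act (A + B) v = act A v + act B v"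
  using left_module.smult_l_distr[OF lm] unfolding tmod_simps Tri_simps .

lemma act_zero_left: "v \<in> W \<Longrightarrow> act (0\<^sub>m n n) v = 0"
  using left_module.smult_zero_left[OF lm] unfolding tmod_simps Tri_simps .

lemma act_mult: "A \<in> carrier (Tri n) \<Longrightarrow> B \<in> carrier (Tri n) \<Longrightarrow> v \<in> W \<Longrightarrow> act (A * B) v = act A (act B v)"
  using left_module.smult_assoc[OF lm] unfolding tmod_simps Tri_simps .

lemma act_one: "v \<in> W \<Longrightarrow> act (1\<^sub>m n) v = v"
  using left_module.smult_one[OF lm] unfolding tmod_simps Tri_simps .

text \<open>Scalar matrices are central.\<close>

lemma act_scale:
  assumes "A \<in> carrier (Tri n)" "v \<in> W" shows "act A (fscale c v) = fscale c (act A v)"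
proof -
  have A: "A \<in> carrier_mat n n" using assms(1) by (simp add: Tri_carrier)
  have "act A (act (scal n c) v) = act (scal n c) (act A v)"
    using act_mult[OF assms(1) scal_carrier assms(2), of c] act_mult[OF scal_carrier assms(1,2), of c]
      scal_mult_left[OF A, of c] scal_mult_right[OF A, of c] by simp
  thus ?thesis using act_scal assms act_closed by simp
qed

lemma act_sum:
  assumes "A \<in> carrier (Tri n)" "\<And>i. i \<in> S \<Longrightarrow> f i \<in> W"
  shows "act A (sum f S) = (\<Sum>i\<in>S. act A (f i))"
  using assms(2)
proof (induction S rule: infinite_finite_induct)
  case (insert x S)
  hence "sum f S \<in> W" by (intro fn.subspace_sum[OF W_subspace]) auto
  moreover have "f x \<in> W" "act A (sum f S) = (\<Sum>i\<in>S. act A (f i))" using insert by auto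
  ultimately show ?case using act_add[OF assms(1), of "f x" "sum f S"]
    by (simp only: sum.insert[OF insert.hyps(1,2)])
qed (simp_all add: act_zero[OF assms(1)])

lemma act_munit:
  assumes "v \<in> W" "j \<le> i" shows "act (munit n c i j) v = fscale c (E i j v)"
proof -
  have "munit n c i j = scal n c * munit n 1 i j"
    using scal_mult_left[OF munit_carrier_mat, of n c 1 i j] by (simp add: smult_munit)
  thus ?thesis using act_mult[OF scal_carrier munit_carrier[OF assms(2)] assms(1)] act_scal
      act_closed[OF munit_carrier[OF assms(2)] assms(1)] by simp
qed

lemma E_closed: "v \<in> W \<Longrightarrow> j \<le> i \<Longrightarrow> E i j v \<in> W"
  using act_closed munit_carrier by blast

lemma E_E:
  assumes "v \<in> W" "l \<le> k" "j \<le> i" "i < n" "k < n"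
  shows "E i j (E k l v) = (if j = k then E i l v else 0)"
proof -
  have "E i j (E k l v) = act (munit n 1 i j * munit n 1 k l) v"
    using act_mult[OF munit_carrier[OF assms(3)] munit_carrier[OF assms(2)] assms(1)] by simp
  thus ?thesis using munit_mult[of i n k l "1::'k" 1] munit_mult_neq[of i n j k l "1::'k" 1] assms act_zero_left
    by (auto)
qed

text \<open>If all projections to vertices kill \<open>v\<close>, then so does every unit, as it
  factors through one of them; hence so does every matrix, in particular the identity.\<close>

lemma exists_vertex:
  assumes "v \<in> W" "v \<noteq> 0"
  shows "\<exists>i<n. E i i v \<noteq> 0"
proof (rule ccontr)
  assume "\<not> (\<exists>i<n. E i i v \<noteq> 0)"
  hence 0: "E i i v = 0" if "i < n" for i using that by blast
  have "act A v = 0" if "A \<in> carrier (Tri n)" for A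
    using that
  proof (induction A rule: Tri_induct)
    case zero show ?case using act_zero_left assms(1) by blast
  next
    case (add A B) thus ?case using act_add_left assms(1) by simp
  next
    case (munit c i j)
    have "act (munit n c i j) v = fscale c (E i j (E j j v))"
      using act_munit[OF assms(1) munit(1), of c] E_E[OF assms(1), of j j j i] munit by simp
    thus ?case using 0[of j] munit act_zero[OF munit_carrier] by (simp add: fun_eq_iff)
  qed
  hence "act (1\<^sub>m n) v = 0" using scal_carrier[of n 1] unfolding scal_one .
  thus False using act_one[OF assms(1)] assms(2) by simp
qed

text \<open>At the first vertex \<open>a\<close> where the module lives, any nonzero \<open>x\<close> generates a direct summand: if
  \<open>b\<close> is the last vertex where \<open>x\<close> survives, then a linear form that is 1 on \<open>E b a x\<close> extends to a
  retraction onto the submodule generated by \<open>x\<close>, there being no condition to check at \<open>a\<close>.\<close>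

lemma split_interval:
  assumes "W \<noteq> {0}"
  shows "\<exists>a b r \<iota>. (a, b) \<in> intervals n \<and>
    lin (Tri n) (tmod W act) (bar [(a, b)]) r \<and> lin (Tri n) (bar [(a, b)]) (tmod W act) \<iota> \<and>
    (\<forall>u\<in>carrier (bar [(a, b)]). r (\<iota> u) = u)"
proof -
  obtain v0 where "v0 \<in> W" "v0 \<noteq> 0" using assms W_zero by blast
  hence ex: "\<exists>i. i < n \<and> (\<exists>v\<in>W. E i i v \<noteq> 0)" using exists_vertex by blast
  define a where "a = (LEAST i. i < n \<and> (\<exists>v\<in>W. E i i v \<noteq> 0))"
  have a: "a < n" "\<exists>v\<in>W. E a a v \<noteq> 0" using LeastI_ex[OF ex] unfolding a_def by auto
  \<comment> \<open>\<open>E i j\<close> factors through vertex \<open>j\<close>, where the module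
    vanishes by the minimality of \<open>a\<close>.\<close>
  have below: "E i j v = 0" if "j < a" "j \<le> i" "i < n" "v \<in> W" for i j v
  proof -
    have "\<not> (j < n \<and> (\<exists>v\<in>W. E j j v \<noteq> 0))" using not_less_Least that(1) unfolding a_def by fast
    hence "E j j v = 0" using that by auto
    moreover have "E i j v = E i j (E j j v)" using E_E[OF that(4), of j j j i] that by simp
    ultimately show ?thesis using act_zero[OF munit_carrier[OF that(2)]] by simp
  qed
  obtain v where v: "v \<in> W" "E a a v \<noteq> 0" using a by blast
  define x where "x = E a a v"
  have x: "x \<in> W" "x \<noteq> 0" "E a a x = x"
    using v E_closed E_E[OF v(1), of a a a a] a by (auto simp: x_def)
  define b where "b = Max {i. a \<le> i \<and> i < n \<and> E i a x \<noteq> 0}"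
  have fin: "finite {i. a \<le> i \<and> i < n \<and> E i a x \<noteq> 0}" by simp
  have "a \<in> {i. a \<le> i \<and> i < n \<and> E i a x \<noteq> 0}" using a x by simp
  hence "b \<in> {i. a \<le> i \<and> i < n \<and> E i a x \<noteq> 0}" unfolding b_def by (intro Max_in[OF fin]) blast
  hence b: "a \<le> b" "b < n" "E b a x \<noteq> 0" by blast+
  have above: "E i a x = 0" if "b < i" "i < n" for i
    using Max_ge[OF fin, of i] that b(1) unfolding b_def[symmetric] by fastforce
  \<comment> \<open>Coordinates make the linear form explicit: it reads off a coordinate in which
    \<open>E b a x\<close> is nonzero and normalizes it.\<close>
  obtain i0 where i0: "E b a x i0 \<noteq> 0" using b(3) by (auto simp: fun_eq_iff)
  define l where "l = (\<lambda>v::nat \<Rightarrow> 'k. v i0 / E b a x i0)"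
  have l_add: "l (v + w) = l v + l w" and l_scale: "l (fscale c v) = c * l v" and l_zero: "l 0 = 0" for v w c
    by (simp_all add: l_def add_divide_distrib)
  have l_sum: "l (sum f S) = (\<Sum>i\<in>S. l (f i))" for f :: "nat \<Rightarrow> nat \<Rightarrow> 'k" and S
    by (induction S rule: infinite_finite_induct) (simp_all only: sum.infinite sum.empty sum.insert l_zero l_add simp_thms)
  \<comment> \<open>The component of \<open>w\<close> at \<open>p\<close> is carried on to the last
    vertex \<open>b\<close> and measured there by \<open>l\<close>.\<close>
  define r where "r = (\<lambda>w (t, p). if (t, p) \<in> cells [(a, b)] then l (E b p w) else 0)"
  \<comment> \<open>The basis vector at \<open>p\<close> goes to \<open>E p a x\<close>, the image
    of the generator \<open>x\<close> at that vertex.\<close>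
  define \<iota> where "\<iota> = (\<lambda>u :: nat \<times> nat \<Rightarrow> 'k. \<Sum>p=a..b. fscale (u (0, p)) (E p a x))"
  have ab: "set [(a, b)] \<subseteq> intervals n" using b by (simp add: intervals_def)
  have cell: "(t, p) \<in> cells [(a, b)] \<longleftrightarrow> t = 0 \<and> a \<le> p \<and> p \<le> b" for t p by (auto simp: cells_def)
  have Ex: "E p a x \<in> W" if "a \<le> p" for p using that E_closed x(1) by blast
  have \<iota>W: "\<iota> u \<in> W" for u unfolding \<iota>_def
    by (rule fn.subspace_sum[OF W_subspace]) (use Ex W_scale in auto)
  have r: "lin (Tri n) (tmod W act) (bar [(a, b)]) r"
  proof (rule lin_TriI[OF lm bar_left_module[OF ab]])
    fix w assume w: "w \<in> carrier (tmod W act)"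
    show "r w \<in> carrier (bar [(a, b)])" by (auto simp: r_def bar_carrier)
    show "r (w \<oplus>\<^bsub>tmod W act\<^esub> w') = r w \<oplus>\<^bsub>bar [(a, b)]\<^esub> r w'" if "w' \<in> carrier (tmod W act)" for w'
    proof (rule ext, clarify)
      fix t p
      show "r (w \<oplus>\<^bsub>tmod W act\<^esub> w') (t, p) = (r w \<oplus>\<^bsub>bar [(a, b)]\<^esub> r w') (t, p)"
      proof (cases "(t, p) \<in> cells [(a, b)]")
        case True
        hence pb: "p \<le> b" by (simp add: cell)
        have ww': "w \<in> W" "w' \<in> W" using w that by simp_all
        have "l (E b p (w + w')) = l (E b p w) + l (E b p w')"
          by (simp only: act_add[OF munit_carrier[OF pb] ww'] l_add)
        thus ?thesis by (simp only: tmod_simps bar_simps plus_fun_apply r_def prod.case True if_True)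
      qed (simp add: r_def)
    qed
    show "r (munit n c i j \<odot>\<^bsub>tmod W act\<^esub> w) = munit n c i j \<odot>\<^bsub>bar [(a, b)]\<^esub> r w"
      if ij: "j \<le> i" "i < n" for c i j
    proof (rule ext, clarify)
      fix t p
      show "r (munit n c i j \<odot>\<^bsub>tmod W act\<^esub> w) (t, p) = (munit n c i j \<odot>\<^bsub>bar [(a, b)]\<^esub> r w) (t, p)"
      proof (cases "t = 0 \<and> a \<le> p \<and> p \<le> b")
        case True
        have wW: "w \<in> W" using w by simp
        have "E b p (act (munit n c i j) w) = fscale c (E b p (E i j w))"
          using act_munit[OF wW ij(1), of c] act_scale[OF munit_carrier E_closed[OF wW ij(1)], of p b] True by simp
        also have "\<dots> = (if p = i then fscale c (E b j w) else 0)"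
          using E_E[OF wW ij(1), of p b] True b ij by (simp add: fun_eq_iff)
        finally have "l (E b p (act (munit n c i j) w)) = (if p = i then c * l (E b j w) else 0)"
          using l_scale l_zero by simp
        \<comment> \<open>Here the choice of \<open>a\<close> enters: a unit starting at
          \<open>j < a\<close> acts as zero on the interval module, and by \<open>below\<close> its
          contribution on \<open>W\<close> vanishes as well.\<close>
        moreover have "l (E b j w) = 0" if "j < a" "p = i" using below[of j b w] that True b wW ij l_zero by simp
        ultimately show ?thesis
          using True ij unfolding tmod_simps bar_simps bar_act_munit[OF ab ij] by (auto simp: r_def cell not_le)
      next
        case False
        thus ?thesis unfolding tmod_simps bar_simps bar_act_munit[OF ab ij] by (auto simp: r_def cell)
      qed
    qed
  qed
  have \<iota>: "lin (Tri n) (bar [(a, b)]) (tmod W act) \<iota>"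
  proof (rule lin_TriI[OF bar_left_module[OF ab] lm])
    fix u :: "nat \<times> nat \<Rightarrow> 'k" assume u: "u \<in> carrier (bar [(a, b)])"
    show "\<iota> u \<in> carrier (tmod W act)" using \<iota>W by simp
    show "\<iota> (u \<oplus>\<^bsub>bar [(a, b)]\<^esub> u') = \<iota> u \<oplus>\<^bsub>tmod W act\<^esub> \<iota> u'" for u'
      unfolding bar_simps tmod_simps \<iota>_def plus_fun_apply fn.scale_left_distrib sum.distrib ..
    show "\<iota> (munit n c i j \<odot>\<^bsub>bar [(a, b)]\<^esub> u) = munit n c i j \<odot>\<^bsub>tmod W act\<^esub> \<iota> u"
      if ij: "j \<le> i" "i < n" for c i j
    proof -
      have "\<iota> (bar_act [(a, b)] (munit n c i j) u) = (\<Sum>p=a..b. if p = i then fscale (c * u (0, j)) (E i a x) else 0)"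
        unfolding \<iota>_def by (intro sum.cong refl) (simp add: bar_act_munit[OF ab ij] cell fun_eq_iff)
      also have "\<dots> = (if a \<le> i \<and> i \<le> b then fscale (c * u (0, j)) (E i a x) else 0)"
        by (simp only: sum.delta finite_atLeastAtMost atLeastAtMost_iff)
      \<comment> \<open>The two conditions give the same value, since \<open>u\<close> vanishes at
        \<open>j < a\<close> and \<open>E i a x\<close> vanishes for \<open>i\<close> beyond
        \<open>b\<close>.\<close>
      also have "\<dots> = (if a \<le> j \<and> j \<le> b then fscale (c * u (0, j)) (E i a x) else 0)"
      proof -
        have "u (0, j) = 0" if "\<not> (a \<le> j \<and> j \<le> b)" using u that by (auto simp: bar_carrier cell)
        moreover have "E i a x = 0" if "b < i" using above that ij by blast
        ultimately show ?thesis using ij by (cases "a \<le> j \<and> j \<le> b"; cases "i \<le> b") (auto simp: fun_eq_iff)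
      qed
      also have "\<dots> = (\<Sum>p=a..b. if p = j then fscale (c * u (0, j)) (E i a x) else 0)"
        by (simp only: sum.delta finite_atLeastAtMost atLeastAtMost_iff)
      also have "\<dots> = (\<Sum>p=a..b. act (munit n c i j) (fscale (u (0, p)) (E p a x)))"
      proof (rule sum.cong[OF refl])
        fix p assume p: "p \<in> {a..b}"
        have "act (munit n c i j) (fscale (u (0, p)) (E p a x)) = fscale (u (0, p)) (fscale c (E i j (E p a x)))"
          using act_scale[OF munit_carrier[OF ij(1)] Ex, of p] act_munit[OF Ex ij(1), of p c] p by simp
        thus "(if p = j then fscale (c * u (0, j)) (E i a x) else 0) = act (munit n c i j) (fscale (u (0, p)) (E p a x))"
          using E_E[OF x(1), of a p j i] p ij b by (auto simp: fun_eq_iff mult_ac)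
      qed
      also have "\<dots> = act (munit n c i j) (\<iota> u)"
        unfolding \<iota>_def by (rule act_sum[OF munit_carrier[OF ij(1)], symmetric]) (use Ex W_scale in auto)
      finally show ?thesis by simp
    qed
  qed
  have "r (\<iota> u) = u" if u: "u \<in> carrier (bar [(a, b)])" for u
  proof (rule ext, clarify)
    fix t q
    show "r (\<iota> u) (t, q) = u (t, q)"
    proof (cases "(t, q) \<in> cells [(a, b)]")
      case True
      hence q: "t = 0" "a \<le> q" "q \<le> b" by (auto simp: cell)
      have "E b q (\<iota> u) = (\<Sum>p=a..b. E b q (fscale (u (0, p)) (E p a x)))"
        unfolding \<iota>_def by (rule act_sum[OF munit_carrier[OF q(3)]]) (use Ex W_scale in auto)
      also have "\<dots> = (\<Sum>p=a..b. if p = q then fscale (u (0, q)) (E b a x) else 0)"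
      proof (rule sum.cong[OF refl])
        fix p assume p: "p \<in> {a..b}"
        show "E b q (fscale (u (0, p)) (E p a x)) = (if p = q then fscale (u (0, q)) (E b a x) else 0)"
          using act_scale[of "munit n 1 b q" "E p a x" "u (0, p)", OF munit_carrier[OF q(3)] Ex] E_E[OF x(1), of a p q b] p q b
          by (auto simp: fun_eq_iff)
      qed
      also have "\<dots> = fscale (u (0, q)) (E b a x)"
        using q by (simp only: sum.delta finite_atLeastAtMost atLeastAtMost_iff) simp
      finally have "l (E b q (\<iota> u)) = u (0, q)" using l_scale i0 by (simp add: l_def)
      thus ?thesis using True q by (simp add: r_def)
    next
      case False thus ?thesis using u by (auto simp: r_def bar_carrier)
    qed
  qed
  moreover have "(a, b) \<in> intervals n" using ab by simp
  ultimately show ?thesis using r \<iota> by blast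
qed

end

text \<open>As \<open>r\<close> is a left inverse of \<open>\<iota>\<close>, \<open>W\<close> is the
  direct sum of the range of \<open>\<iota>\<close> and the kernel \<open>K\<close>. The isomorphism
  records \<open>r w\<close> at list position 0 and the component \<open>w - \<iota> (r w)\<close>
  in \<open>K\<close>, read through \<open>g\<close>, at the later positions.\<close>

lemma (in tri_tmod) bar_Cons_iso:
  assumes ab: "(a, b) \<in> intervals n" and xs: "set xs \<subseteq> intervals n"
    and r: "lin (Tri n) (tmod W act) (bar [(a, b)]) r" and \<iota>: "lin (Tri n) (bar [(a, b)]) (tmod W act) \<iota>"
    and r\<iota>: "\<And>u. u \<in> carrier (bar [(a, b)]) \<Longrightarrow> r (\<iota> u) = u"
    and K: "K = {w \<in> W. r w = 0}" and lmK: "left_module (Tri n) (tmod K act)"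
    and iso: "mod_iso (Tri n) (tmod K act) (bar xs)"
  shows "mod_iso (Tri n) (tmod W act) (bar ((a, b) # xs))"
proof -
  have ab': "set [(a, b)] \<subseteq> intervals n" and axs: "set ((a, b) # xs) \<subseteq> intervals n" using ab xs by simp_all
  obtain g where g: "lin_iso (Tri n) (tmod K act) (bar xs) g" using iso mod_iso_iff[OF lmK] by blast
  obtain h where h: "lin_iso (Tri n) (bar xs) (tmod K act) h"
    and hg: "\<And>x. x \<in> K \<Longrightarrow> h (g x) = x" and gh: "\<And>y. y \<in> carrier (bar xs) \<Longrightarrow> g (h y) = y"
    using lin_iso_inverse[OF lmK g] by (metis tmod_simps(1))
  have lg: "lin (Tri n) (tmod K act) (bar xs) g" and lh: "lin (Tri n) (bar xs) (tmod K act) h"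
    using g h by (auto simp: lin_iso_def)
  note rl = linD[OF r, unfolded tmod_simps bar_simps] and il = linD[OF \<iota>, unfolded tmod_simps bar_simps]
    and gl = linD[OF lg, unfolded tmod_simps bar_simps] and hl = linD[OF lh, unfolded tmod_simps bar_simps]
  have KW: "w \<in> K \<Longrightarrow> w \<in> W" for w using K by simp
  have radd0: "r (v + w) = r v + r w" if "v \<in> W" "w \<in> W" for v w using rl(2)[OF that] .
  have iW: "\<iota> (r w) \<in> W" if "w \<in> W" for w using il(1) rl(1) that by blast
  have rdiff: "w - \<iota> (r w) \<in> K" if w: "w \<in> W" for w
  proof -
    have "r w = r (w - \<iota> (r w)) + r (\<iota> (r w))"
      using radd0[OF W_diff[OF w iW[OF w]] iW[OF w]] by simp
    hence "r (w - \<iota> (r w)) = 0" using r\<iota>[OF rl(1)[OF w]] by simp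
    thus ?thesis using W_diff[OF w iW[OF w]] K by simp
  qed
  have cell0: "(0, p) \<in> cells ((a, b) # xs) \<longleftrightarrow> (0, p) \<in> cells [(a, b)]" for p by (simp add: cells_def)
  have cellS: "(Suc t, p) \<in> cells ((a, b) # xs) \<longleftrightarrow> (t, p) \<in> cells xs" for t p by (simp add: cells_def)
  have cell1: "(t, p) \<in> cells [(a, b)] \<Longrightarrow> t = 0" for t p by (simp add: cells_def)
  define F where "F = (\<lambda>w (t, p). case t of 0 \<Rightarrow> r w (0, p) | Suc t' \<Rightarrow> g (w - \<iota> (r w)) (t', p))"
  have F0: "F w (0, p) = r w (0, p)" and FS: "F w (Suc t, p) = g (w - \<iota> (r w)) (t, p)" for w t p
    by (simp_all add: F_def)
  have ext2: "f = f'" if "\<And>p. f (0, p) = f' (0, p)" "\<And>t p. f (Suc t, p) = f' (Suc t, p)" for f f' :: "nat \<times> nat \<Rightarrow> 'k"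
  proof (rule ext, clarify)
    fix t p show "f (t, p) = f' (t, p)" using that by (cases t) auto
  qed
  have Fc: "F w \<in> carrier (bar ((a, b) # xs))" if w: "w \<in> W" for w
    unfolding bar_carrier
  proof (clarify)
    fix t p assume "(t, p) \<notin> cells ((a, b) # xs)"
    thus "F w (t, p) = 0" using rl(1)[OF w] gl(1)[OF rdiff[OF w]] cell0 cellS
      by (cases t) (auto simp: F0 FS bar_carrier)
  qed
  have lF: "lin (Tri n) (tmod W act) (bar ((a, b) # xs)) F"
  proof (rule lin_TriI[OF lm bar_left_module[OF axs]])
    fix w assume "w \<in> carrier (tmod W act)"
    hence w: "w \<in> W" by simp
    show "F w \<in> carrier (bar ((a, b) # xs))" by (rule Fc[OF w])
    show "F (w \<oplus>\<^bsub>tmod W act\<^esub> w') = F w \<oplus>\<^bsub>bar ((a, b) # xs)\<^esub> F w'" if "w' \<in> carrier (tmod W act)" for w'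
    proof -
      have w': "w' \<in> W" using that by simp
      have "w + w' - \<iota> (r (w + w')) = (w - \<iota> (r w)) + (w' - \<iota> (r w'))"
        using radd0[OF w w'] il(2)[OF rl(1)[OF w] rl(1)[OF w']] by simp
      hence "g (w + w' - \<iota> (r (w + w'))) = g (w - \<iota> (r w)) + g (w' - \<iota> (r w'))"
        by (simp only: gl(2)[OF rdiff[OF w] rdiff[OF w']])
      thus ?thesis unfolding tmod_simps bar_simps using radd0[OF w w']
        by (intro ext2) (simp_all only: F0 FS plus_fun_apply)
    qed
    show "F (munit n c i j \<odot>\<^bsub>tmod W act\<^esub> w) = munit n c i j \<odot>\<^bsub>bar ((a, b) # xs)\<^esub> F w"
      if ij: "j \<le> i" "i < n" for c i j
    proof -
      let ?A = "munit n c i j"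
      note A = munit_carrier[OF ij(1), of n c]
      have "act ?A w = act ?A (w - \<iota> (r w)) + act ?A (\<iota> (r w))"
        using act_add[OF A W_diff[OF w iW[OF w]] iW[OF w]] by simp
      moreover have "\<iota> (r (act ?A w)) = act ?A (\<iota> (r w))"
        using rl(3)[OF A w] il(3)[OF A rl(1)[OF w]] by simp
      ultimately have "act ?A w - \<iota> (r (act ?A w)) = act ?A (w - \<iota> (r w))" by simp
      hence "g (act ?A w - \<iota> (r (act ?A w))) = bar_act xs ?A (g (w - \<iota> (r w)))"
        using gl(3)[OF A rdiff[OF w]] by simp
      moreover have "r (act ?A w) = bar_act [(a, b)] ?A (r w)" using rl(3)[OF A w] .
      ultimately show ?thesis unfolding tmod_simps bar_simps
        by (intro ext2) (simp_all add: F0 FS bar_act_munit[OF axs ij] bar_act_munit[OF ab' ij] bar_act_munit[OF xs ij] cell0 cellS)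
    qed
  qed
  have "bij_betw F (carrier (tmod W act)) (carrier (bar ((a, b) # xs)))"
    unfolding bij_betw_def
  proof
    show "inj_on F (carrier (tmod W act))"
    proof (rule inj_onI)
      fix w w' assume "w \<in> carrier (tmod W act)" "w' \<in> carrier (tmod W act)" and eq: "F w = F w'"
      hence w: "w \<in> W" "w' \<in> W" by simp_all
      have "r w = r w'"
      proof (rule ext2)
        show "r w (0, p) = r w' (0, p)" for p using fun_cong[OF eq, of "(0, p)"] by (simp add: F0)
        show "r w (Suc t, p) = r w' (Suc t, p)" for t p
          using rl(1)[OF w(1)] rl(1)[OF w(2)] cell1[of "Suc t" p] unfolding bar_carrier by (metis nat.distinct(1))
      qed
      moreover have "g (w - \<iota> (r w)) = g (w' - \<iota> (r w'))"
      proof (rule ext, clarify)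
        fix t p show "g (w - \<iota> (r w)) (t, p) = g (w' - \<iota> (r w')) (t, p)"
          using fun_cong[OF eq, of "(Suc t, p)"] by (simp only: FS)
      qed
      hence "w - \<iota> (r w) = w' - \<iota> (r w')" using hg[OF rdiff[OF w(1)]] hg[OF rdiff[OF w(2)]] by metis
      ultimately show "w = w'" by simp
    qed
    show "F ` carrier (tmod W act) = carrier (bar ((a, b) # xs))"
    proof
      show "F ` carrier (tmod W act) \<subseteq> carrier (bar ((a, b) # xs))" using Fc by auto
      show "carrier (bar ((a, b) # xs)) \<subseteq> F ` carrier (tmod W act)"
      proof
        fix v :: "nat \<times> nat \<Rightarrow> 'k" assume v: "v \<in> carrier (bar ((a, b) # xs))"
        define u where "u = (\<lambda>(t :: nat, p :: nat). if t = 0 then v (0, p) else 0)"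
        define y where "y = (\<lambda>(t, p). v (Suc t, p))"
        have v': "v z = 0" if "z \<notin> cells ((a, b) # xs)" for z using v that unfolding bar_carrier by blast
        have u: "u \<in> carrier (bar [(a, b)])"
          unfolding bar_carrier u_def using v'[of "(0, _)"] cell0 by auto
        have y: "y \<in> carrier (bar xs)"
          unfolding bar_carrier y_def using v'[of "(Suc _, _)"] cellS by auto
        have hy: "h y \<in> K" using hl(1)[OF y] .
        have iu: "\<iota> u \<in> W" using il(1)[OF u] .
        define w where "w = \<iota> u + h y"
        have w: "w \<in> W" unfolding w_def by (rule W_add[OF iu KW[OF hy]])
        have rw: "r w = u" using radd0[OF iu KW[OF hy]] r\<iota>[OF u] hy K by (simp add: w_def)
        have "F w = v"
          by (rule ext2) (simp_all add: F0 FS rw, simp_all add: w_def gh[OF y], simp_all add: u_def y_def)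
        thus "v \<in> F ` carrier (tmod W act)" using w by auto
      qed
    qed
  qed
  thus ?thesis using lF mod_iso_iff[OF lm] by (auto simp: lin_iso_def)
qed

text \<open>Splitting off one interval leaves the kernel of the retraction, which has smaller
  dimension. The ambient \<open>initial_space d\<close> makes dimensions finite and is inherited by
  the kernel.\<close>

lemma tmod_interval_decomposition:
  fixes W :: "(nat \<Rightarrow> 'k::field) set"
  assumes "tri_tmod n W act" "W \<subseteq> initial_space d"
  shows "\<exists>xs. set xs \<subseteq> intervals n \<and> mod_iso (Tri n) (tmod W act) (bar xs)"
  using assms
proof (induction "fn.dim W" arbitrary: W rule: less_induct)
  case less
  interpret tri_tmod n W act by fact
  show ?case
  proof (cases "W = {0}")
    case True
    have c: "carrier (bar [] :: ('k mat, _) module) = {0}" by (auto simp: bar_carrier cells_def fun_eq_iff)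
    have "lin (Tri n) (tmod W act) (bar []) (\<lambda>_. 0)"
      by (auto simp: lin_def bar_carrier bar_act_def fun_eq_iff)
    moreover have "bij_betw (\<lambda>_. 0) (carrier (tmod W act)) (carrier (bar [] :: ('k mat, _) module))"
      using c True by (auto simp: bij_betw_def)
    ultimately have "mod_iso (Tri n) (tmod W act) (bar [])"
      using mod_iso_iff[OF lm] by (auto simp: lin_iso_def)
    thus ?thesis by (intro exI[of _ "[]"]) simp
  next
    case False
    then obtain a b r \<iota> where ab: "(a, b) \<in> intervals n"
      and r: "lin (Tri n) (tmod W act) (bar [(a, b)]) r" and \<iota>: "lin (Tri n) (bar [(a, b)]) (tmod W act) \<iota>"
      and r\<iota>: "\<And>u. u \<in> carrier (bar [(a, b)]) \<Longrightarrow> r (\<iota> u) = u"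
      using split_interval by metis
    have ab': "set [(a, b)] \<subseteq> intervals n" using ab by simp
    note rl = linD[OF r, unfolded tmod_simps bar_simps] and il = linD[OF \<iota>, unfolded tmod_simps bar_simps]
    have r0: "r 0 = 0" using lin_zero[OF lm bar_left_module[OF ab'] r] unfolding tmod_simps bar_simps .
    define K where "K = {w \<in> W. r w = 0}"
    have Kadd: "v + w \<in> K" if "v \<in> K" "w \<in> K" for v w
    proof -
      have "v \<in> W" "w \<in> W" "r v = 0" "r w = 0" using that by (auto simp: K_def)
      thus ?thesis using rl(2)[of v w] W_add[of v w] by (simp add: K_def)
    qed
    have Kact: "act A w \<in> K" if A: "A \<in> carrier (Tri n)" and w: "w \<in> K" for A w
    proof -
      have w': "w \<in> W" "r w = 0" using w by (auto simp: K_def)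
      have "bar_act [(a, b)] A 0 = 0" by (auto simp: bar_act_def fun_eq_iff)
      thus ?thesis using rl(3)[OF A w'(1)] w' act_closed[OF A w'(1)] by (simp add: K_def)
    qed
    have K0: "0 \<in> K" using W_zero r0 by (simp add: K_def)
    have Ksc: "fscale c w \<in> K" if "w \<in> K" for c w
      using Kact[OF scal_carrier that, of c] act_scal that by (simp add: K_def)
    have Kneg: "- w \<in> K" if "w \<in> K" for w
    proof -
      have "- w = fscale (- 1) w" by (auto simp: fun_eq_iff)
      thus ?thesis using Ksc[OF that, of "- 1"] by metis
    qed
    have KW: "K \<subseteq> W" by (auto simp: K_def)
    have lmK: "left_module (Tri n) (tmod K act)"
    proof (rule tmod_left_module[OF Tri_ring K0 Kadd Kneg Kact])
      fix A B :: "'k mat" and v assume A: "A \<in> carrier (Tri n)" and v: "v \<in> K"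
      have vW: "v \<in> W" using v KW by blast
      show "act A (v + w) = act A v + act A w" if "w \<in> K" for w using act_add[OF A vW] that KW by blast
      assume B: "B \<in> carrier (Tri n)"
      show "act (A \<oplus>\<^bsub>Tri n\<^esub> B) v = act A v + act B v" using act_add_left[OF A B vW] by (simp only: Tri_simps)
      show "act (A \<otimes>\<^bsub>Tri n\<^esub> B) v = act A (act B v)" using act_mult[OF A B vW] by (simp only: Tri_simps)
    next
      fix v assume "v \<in> K"
      thus "act \<one>\<^bsub>Tri n\<^esub> v = v" using act_one[of v] KW by (auto simp only: Tri_simps)
    qed
    have trK: "tri_tmod n K act" using lmK act_scal KW by (intro tri_tmod.intro) auto
    have "fn.subspace K" using Kadd K0 Ksc by (intro fn.subspaceI)
    \<comment> \<open>Otherwise \<open>r\<close> would vanish on the range of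
      \<open>\<iota>\<close>, although it restores the nonzero basis vector at
      \<open>a\<close>.\<close>
    moreover have "K \<noteq> W"
    proof
      assume KW': "K = W"
      have c: "(0, a) \<in> cells [(a, b)]" using ab by (auto simp: cells_def intervals_def)
      note d = delta_carrier[OF c, of "1::'k"]
      have "r (\<iota> (delta (0, a) 1)) = 0" using il(1)[OF d] KW' by (auto simp: K_def)
      hence "delta (0::nat, a) (1::'k) = 0" using r\<iota>[OF d] by metis
      hence "delta (0::nat, a) (1::'k) (0, a) = 0" by simp
      thus False by (simp add: delta_def)
    qed
    moreover have "W \<subseteq> fn.span ((\<lambda>i. delta i (1::'k)) ` {..<d})"
    proof
      fix v assume "v \<in> W"
      hence "\<forall>i\<ge>d. v i = 0" using less.prems(2) by (auto simp: initial_space_def)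
      thus "v \<in> fn.span ((\<lambda>i. delta i (1::'k)) ` {..<d})" by (intro supported_in_span) auto
    qed
    ultimately have "fn.dim K < fn.dim W" using KW by (intro dim_strict_mono) auto
    moreover have "K \<subseteq> initial_space d" using KW less.prems(2) by blast
    ultimately obtain xs where xs: "set xs \<subseteq> intervals n" "mod_iso (Tri n) (tmod K act) (bar xs)"
      using less.hyps trK by blast
    have "mod_iso (Tri n) (tmod W act) (bar ((a, b) # xs))"
      by (rule bar_Cons_iso[OF ab xs(1) r \<iota> r\<iota> K_def lmK xs(2)])
    moreover have "set ((a, b) # xs) \<subseteq> intervals n" using ab xs(1) by simp
    ultimately show ?thesis by blast
  qed
qed

theorem interval_decomposition:
  fixes M :: "('k::field mat, 'm) module"
  assumes "fg_module (Tri n) M"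
  obtains xs where "set xs \<subseteq> intervals n" "mod_iso (Tri n) M (bar xs)"
proof -
  obtain d and act :: "'k mat \<Rightarrow> (nat \<Rightarrow> 'k) \<Rightarrow> nat \<Rightarrow> 'k"
    where lm: "left_module (Tri n) (tmod (initial_space d) act)"
      and sc: "\<And>c v. v \<in> initial_space d \<Longrightarrow> act (scal n c) v = fscale c v"
      and iso: "mod_iso (Tri n) M (tmod (initial_space d) act)"
    using fg_module_coordinates[OF assms] by metis
  have "tri_tmod n (initial_space d) act" using lm sc by (rule tri_tmod.intro)
  then obtain xs where xs: "set xs \<subseteq> intervals n" "mod_iso (Tri n) (tmod (initial_space d) act) (bar xs)"
    using tmod_interval_decomposition by blast
  have "left_module (Tri n) M" using assms by (simp add: fg_module_def)
  hence "mod_iso (Tri n) M (bar xs)" using mod_iso_trans[OF _ lm iso xs(2)] by blast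
  thus ?thesis using that xs(1) by blast
qed

section \<open>Uniqueness of the interval decomposition\<close>

text \<open>The comparison of dimensions for an injective linear map. Linearity is asked only on
  vectors supported on \<open>A\<close>, because the map in \<open>rank_le\<close> comes from a
  homomorphism that is controlled only on its carrier.\<close>

lemma linear_injection_card_le:
  fixes L :: "('i \<Rightarrow> 'k::field) \<Rightarrow> 'j \<Rightarrow> 'k"
  assumes fin: "finite A" "finite B"
    and add: "\<And>v w. (\<forall>i. i \<notin> A \<longrightarrow> v i = 0) \<Longrightarrow> (\<forall>i. i \<notin> A \<longrightarrow> w i = 0) \<Longrightarrow> L (v + w) = L v + L w"
    and sc: "\<And>c v. (\<forall>i. i \<notin> A \<longrightarrow> v i = 0) \<Longrightarrow> L (fscale c v) = fscale c (L v)"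
    and ker: "\<And>v. (\<forall>i. i \<notin> A \<longrightarrow> v i = 0) \<Longrightarrow> L v = 0 \<Longrightarrow> v = 0"
    and B: "\<And>v j. (\<forall>i. i \<notin> A \<longrightarrow> v i = 0) \<Longrightarrow> j \<notin> B \<Longrightarrow> L v j = 0"
  shows "card A \<le> card B"
proof -
  let ?d = "\<lambda>i. delta i (1::'k)"
  have d: "\<forall>k. k \<notin> A \<longrightarrow> ?d i k = 0" if "i \<in> A" for i using that by (auto simp: delta_def)
  have "L (fscale 0 0) = fscale 0 (L 0)" by (rule sc) simp
  hence L0: "L 0 = 0" by (simp only: fn.scale_zero_left)
  have Lsum: "L (\<Sum>i\<in>S. fscale (c i) (?d i)) = (\<Sum>i\<in>S. fscale (c i) (L (?d i)))
      \<and> (\<forall>k. k \<notin> A \<longrightarrow> (\<Sum>i\<in>S. fscale (c i) (?d i)) k = 0)" if "S \<subseteq> A" for S c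
    using finite_subset[OF that fin(1)] that
  proof (induction S rule: finite_induct)
    case empty show ?case by (simp only: sum.empty L0) simp
  next
    case (insert x S)
    have "\<forall>k. k \<notin> A \<longrightarrow> fscale (c x) (?d x) k = 0" using insert by (auto simp: delta_def)
    moreover have IH: "L (\<Sum>i\<in>S. fscale (c i) (?d i)) = (\<Sum>i\<in>S. fscale (c i) (L (?d i)))"
        "\<forall>k. k \<notin> A \<longrightarrow> (\<Sum>i\<in>S. fscale (c i) (?d i)) k = 0" using insert by blast+
    moreover have "L (fscale (c x) (?d x)) = fscale (c x) (L (?d x))" using sc[OF d] insert by blast
    ultimately have "L (\<Sum>i\<in>insert x S. fscale (c i) (?d i)) = (\<Sum>i\<in>insert x S. fscale (c i) (L (?d i)))"
      using add[of "fscale (c x) (?d x)" "\<Sum>i\<in>S. fscale (c i) (?d i)"]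
      by (simp only: sum.insert[OF insert.hyps(1,2)])
    moreover have "(\<Sum>i\<in>insert x S. fscale (c i) (?d i)) k = 0" if "k \<notin> A" for k
      using IH(2) that insert.prems by (auto simp: sum.insert[OF insert.hyps(1,2)] delta_def)
    ultimately show ?case by blast
  qed
  have coef: "(\<Sum>i\<in>A. fscale (c i) (?d i)) k = c k" if "k \<in> A" for c k
  proof -
    have "(\<Sum>i\<in>S. fscale (c i) (?d i)) k = (\<Sum>i\<in>S. if i = k then c k else 0)" if "finite S" for S
      using that by (induction S rule: finite_induct) (auto simp: delta_def)
    thus ?thesis using fin(1) that by simp
  qed
  \<comment> \<open>Independence is a property of the set of images, so their number is known only
    once the images are distinct.\<close>
  have inj: "inj_on (\<lambda>i. L (?d i)) A"
  proof (rule inj_onI, rule ccontr)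
    fix i j assume ij: "i \<in> A" "j \<in> A" "L (?d i) = L (?d j)" "i \<noteq> j"
    have z: "\<forall>k. k \<notin> A \<longrightarrow> fscale (- 1) (?d j) k = 0" using ij by (auto simp: delta_def)
    have "L (?d i + fscale (- 1) (?d j)) = L (?d i) + fscale (- 1) (L (?d j))"
      using add[OF d[OF ij(1)] z] sc[OF d[OF ij(2)], of "- 1"] by metis
    also have "\<dots> = 0" unfolding ij(3) by (simp only: fn.scale_minus_left fn.scale_one add.right_inverse)
    finally have "L (?d i + fscale (- 1) (?d j)) = 0" .
    hence "?d i + fscale (- 1) (?d j) = 0" using d[OF ij(1)] z by (intro ker) auto
    hence "(?d i + fscale (- 1) (?d j)) i = 0" by simp
    thus False using ij(4) by (simp add: delta_def)
  qed
  have ind: "fn.independent ((\<lambda>i. L (?d i)) ` A)"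
  proof (rule fn.independent_if_scalars_zero)
    show "finite ((\<lambda>i. L (?d i)) ` A)" using fin(1) by simp
    fix f x assume 0: "(\<Sum>x\<in>(\<lambda>i. L (?d i)) ` A. fscale (f x) x) = 0" and x: "x \<in> (\<lambda>i. L (?d i)) ` A"
    obtain i where i: "i \<in> A" "x = L (?d i)" using x by blast
    let ?v = "\<Sum>i\<in>A. fscale (f (L (?d i))) (?d i)"
    have "L ?v = 0" using 0 Lsum[of A "\<lambda>i. f (L (?d i))"] by (simp add: sum.reindex[OF inj] comp_def)
    hence "?v = 0" using Lsum[of A "\<lambda>i. f (L (?d i))"] by (intro ker) auto
    thus "f x = 0" using coef[OF i(1), of "\<lambda>i. f (L (?d i))"] i(2) by simp
  qed
  have "(\<lambda>i. L (?d i)) ` A \<subseteq> fn.span ((\<lambda>j. delta j (1::'k)) ` B)"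
    using supported_in_span[OF fin(2)] B d by blast
  hence "card ((\<lambda>i. L (?d i)) ` A) \<le> card ((\<lambda>j. delta j (1::'k)) ` B)"
    using fn.independent_span_bound[OF _ ind] fin(2) by blast
  also have "\<dots> \<le> card B" using fin(2) by (rule card_image_le)
  finally show ?thesis using card_image[OF inj] by simp
qed

text \<open>The number of intervals containing \<open>p\<close> and \<open>q\<close> is the rank of the map from vertex \<open>p\<close> to
  vertex \<open>q\<close>.\<close>

lemma rank_le:
  assumes xs: "set xs \<subseteq> intervals n" and ys: "set ys \<subseteq> intervals n"
    and iso: "mod_iso (Tri n) (bar xs :: ('k::field mat, _) module) (bar ys)" and pq: "p \<le> q" "q < n"
  shows "card {t. (t, p) \<in> cells xs \<and> (t, q) \<in> cells xs} \<le> card {t. (t, p) \<in> cells ys \<and> (t, q) \<in> cells ys}"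
proof -
  note lx = bar_left_module[OF xs, where 'k = 'k] and ly = bar_left_module[OF ys, where 'k = 'k]
  obtain f where f: "lin_iso (Tri n) (bar xs :: ('k mat, _) module) (bar ys) f"
    using iso mod_iso_iff[OF lx] by blast
  hence lf: "lin (Tri n) (bar xs :: ('k mat, _) module) (bar ys) f" and inj: "inj_on f (carrier (bar xs))"
    by (auto simp: lin_iso_def bij_betw_def)
  note fl = linD[OF lf, unfolded bar_simps]
  let ?A = "{t. (t, p) \<in> cells xs \<and> (t, q) \<in> cells xs}" and ?B = "{t. (t, p) \<in> cells ys \<and> (t, q) \<in> cells ys}"
  have fin: "finite {t. (t, p) \<in> cells zs \<and> (t, q) \<in> cells zs}" for zs
    by (rule finite_subset[of _ "{..<length zs}"]) (auto simp: cells_def)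
  \<comment> \<open>For \<open>v\<close> supported on \<open>?A\<close>, this puts the scalars
    \<open>v t\<close> at vertex \<open>r\<close> of the summands that contain both \<open>p\<close>
    and \<open>q\<close>.\<close>
  define e where "e = (\<lambda>(r :: nat) (v :: nat \<Rightarrow> 'k) (t :: nat, s). if s = r then v t else 0)"
  have ec: "e r v \<in> carrier (bar xs)" if "\<forall>t. t \<notin> ?A \<longrightarrow> v t = 0" "r = p \<or> r = q" for r v
    using that by (auto simp: e_def bar_carrier)
  have eq: "e q v = bar_act xs (munit n 1 q p) (e p v)" if v: "\<forall>t. t \<notin> ?A \<longrightarrow> v t = 0" for v
  proof (rule ext, clarify)
    fix t s
    have "(t, q) \<in> cells xs" if "v t \<noteq> 0" using v that by auto
    thus "e q v (t, s) = bar_act xs (munit n 1 q p) (e p v) (t, s)"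
      by (auto simp: bar_act_munit[OF xs pq] e_def)
  qed
  have esc: "e q (fscale c v) = bar_act xs (munit n c q q) (e q v)" if v: "\<forall>t. t \<notin> ?A \<longrightarrow> v t = 0" for v c
  proof (rule ext, clarify)
    fix t s
    have "(t, q) \<in> cells xs" if "v t \<noteq> 0" using v that by auto
    thus "e q (fscale c v) (t, s) = bar_act xs (munit n c q q) (e q v) (t, s)"
      by (auto simp: bar_act_munit[OF xs order_refl pq(2)] e_def)
  qed
  define L where "L = (\<lambda>v t. f (e q v) (t, q))"
  \<comment> \<open>\<open>e q v\<close> is the image of a vector at \<open>p\<close> under the unit
    at (q, p), and this persists under \<open>f\<close>; such images live only on summands
    containing both vertices.\<close>
  have supp: "f (e q v) (t, s) = 0" if v: "\<forall>t. t \<notin> ?A \<longrightarrow> v t = 0" and ts: "s \<noteq> q \<or> t \<notin> ?B" for v t s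
  proof -
    have "f (e q v) = bar_act ys (munit n 1 q p) (f (e p v))"
      using fl(3)[OF munit_carrier[OF pq(1)] ec[OF v]] eq[OF v] by simp
    moreover have "f (e p v) (t, p) = 0" if "(t, p) \<notin> cells ys"
      using fl(1)[OF ec[OF v]] that by (simp add: bar_carrier)
    ultimately show ?thesis using ts by (auto simp: bar_act_munit[OF ys pq])
  qed
  show ?thesis
  proof (rule linear_injection_card_le[OF fin fin, where L = L])
    fix v w :: "nat \<Rightarrow> 'k" and c :: 'k
    assume v: "\<forall>t. t \<notin> ?A \<longrightarrow> v t = 0"
    show "L v t = 0" if "t \<notin> ?B" for t using supp[OF v] that by (simp add: L_def)
    show "L (fscale c v) = fscale c (L v)"
    proof (rule ext)
      fix t
      have "f (e q (fscale c v)) = bar_act ys (munit n c q q) (f (e q v))"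
        using fl(3)[OF munit_carrier[of q q] ec[OF v]] esc[OF v] by simp
      moreover have "f (e q v) (t, q) = 0" if "(t, q) \<notin> cells ys"
        using fl(1)[OF ec[OF v]] that by (simp add: bar_carrier)
      ultimately show "L (fscale c v) t = fscale c (L v) t"
        by (auto simp: L_def bar_act_munit[OF ys order_refl pq(2)])
    qed
    show "v = 0" if "L v = 0"
    proof -
      have "f (e q v) (t, s) = 0" for t s using supp[OF v, of s t] fun_cong[OF that, of t] by (cases "s = q") (auto simp: L_def)
      hence "f (e q v) = f 0" using lin_zero[OF lx ly lf] by (auto simp: fun_eq_iff)
      hence "e q v = 0" using inj ec[OF v] by (auto simp: inj_on_def bar_carrier)
      hence "e q v (t, q) = 0" for t by simp
      thus ?thesis by (simp add: e_def fun_eq_iff)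
    qed
    assume w: "\<forall>t. t \<notin> ?A \<longrightarrow> w t = 0"
    have "e q (v + w) = e q v + e q w" by (auto simp: e_def fun_eq_iff)
    hence "f (e q (v + w)) = f (e q v) + f (e q w)" using fl(2)[OF ec[OF v] ec[OF w]] by simp
    thus "L (v + w) = L v + L w" by (simp add: L_def fun_eq_iff)
  qed
qed

lemma rank_count:
  assumes xs: "set xs \<subseteq> intervals n" and "p \<le> q"
  shows "card {t. (t, p) \<in> cells xs \<and> (t, q) \<in> cells xs} =
    (\<Sum>x\<in>{(a, b)\<in>intervals n. a \<le> p \<and> q \<le> b}. count (mset xs) x)"
proof -
  have "{t. (t, p) \<in> cells xs \<and> (t, q) \<in> cells xs} = {t. t < length xs \<and> fst (xs ! t) \<le> p \<and> q \<le> snd (xs ! t)}"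
    using assms(2) by (auto simp: cells_def)
  also have "card \<dots> = length (filter (\<lambda>x. fst x \<le> p \<and> q \<le> snd x) xs)"
    by (simp add: length_filter_conv_card)
  also have "\<dots> = size (filter_mset (\<lambda>x. fst x \<le> p \<and> q \<le> snd x) (mset xs))"
    unfolding mset_filter[symmetric] size_mset ..
  also have "\<dots> = (\<Sum>x\<in>set_mset (filter_mset (\<lambda>x. fst x \<le> p \<and> q \<le> snd x) (mset xs)).
      count (filter_mset (\<lambda>x. fst x \<le> p \<and> q \<le> snd x) (mset xs)) x)"
    by (rule size_multiset_overloaded_eq)
  also have "\<dots> = (\<Sum>x\<in>{(a, b)\<in>intervals n. a \<le> p \<and> q \<le> b}. count (mset xs) x)"
  proof (rule sum.mono_neutral_cong_left)
    show "finite {(a, b)\<in>intervals n. a \<le> p \<and> q \<le> b}"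
      by (rule finite_subset[of _ "{..<n} \<times> {..<n}"]) (auto simp: intervals_def)
    show "set_mset (filter_mset (\<lambda>x. fst x \<le> p \<and> q \<le> snd x) (mset xs)) \<subseteq> {(a, b)\<in>intervals n. a \<le> p \<and> q \<le> b}"
      using xs by auto
  qed (auto simp: count_eq_zero_iff)
  finally show ?thesis .
qed

text \<open>Each rank is the sum of the multiplicities of all intervals containing [p, q]. All of
  these except [p, q] are longer, so the multiplicities are recovered from the longest intervals
  downwards.\<close>

theorem bar_iso_iff:
  assumes xs: "set xs \<subseteq> intervals n" and ys: "set ys \<subseteq> intervals n"
  shows "mod_iso (Tri n) (bar xs :: ('k::field mat, _) module) (bar ys) \<longleftrightarrow> mset xs = mset ys"
proof
  assume iso: "mod_iso (Tri n) (bar xs :: ('k mat, _) module) (bar ys)"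
  have iso': "mod_iso (Tri n) (bar ys :: ('k mat, _) module) (bar xs)"
    using mod_iso_sym[OF bar_left_module[OF xs] bar_left_module[OF ys] iso] .
  have rk: "(\<Sum>x\<in>{(a, b)\<in>intervals n. a \<le> p \<and> q \<le> b}. count (mset xs) x) =
      (\<Sum>x\<in>{(a, b)\<in>intervals n. a \<le> p \<and> q \<le> b}. count (mset ys) x)" if "p \<le> q" "q < n" for p q
    using rank_le[OF xs ys iso that] rank_le[OF ys xs iso' that]
    unfolding rank_count[OF xs that(1)] rank_count[OF ys that(1)] by simp
  have "count (mset xs) (p, q) = count (mset ys) (p, q)" if "p \<le> q" "q < n" for p q
    using that
  proof (induction "n - (q - p)" arbitrary: p q rule: less_induct)
    case less
    let ?I = "{(a, b)\<in>intervals n. a \<le> p \<and> q \<le> b}"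
    have fin: "finite ?I" by (rule finite_subset[of _ "{..<n} \<times> {..<n}"]) (auto simp: intervals_def)
    have pq: "(p, q) \<in> ?I" using less.prems by (simp add: intervals_def)
    have "count (mset xs) x = count (mset ys) x" if xI: "x \<in> ?I - {(p, q)}" for x
    proof -
      obtain a b where x: "x = (a, b)" "a \<le> b" "b < n" "a \<le> p" "q \<le> b" "(a, b) \<noteq> (p, q)"
        using xI by (cases x) (auto simp: intervals_def)
      hence "n - (b - a) < n - (q - p)" using less.prems by auto
      thus ?thesis using less.hyps x by blast
    qed
    hence "(\<Sum>x\<in>?I - {(p, q)}. count (mset xs) x) = (\<Sum>x\<in>?I - {(p, q)}. count (mset ys) x)"
      by (rule sum.cong[OF refl])
    thus ?case using rk[OF less.prems] sum.remove[OF fin pq, of "count (mset xs)"]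
        sum.remove[OF fin pq, of "count (mset ys)"] by simp
  qed
  moreover have "count (mset xs) (p, q) = 0" "count (mset ys) (p, q) = 0" if "\<not> (p \<le> q \<and> q < n)" for p q
    using that xs ys by (auto simp: intervals_def count_eq_zero_iff)
  ultimately show "mset xs = mset ys" by (intro multiset_eqI) (metis prod.exhaust)
next
  assume "mset xs = mset ys"
  thus "mod_iso (Tri n) (bar xs :: ('k mat, _) module) (bar ys)" by (rule bar_mset_iso[OF xs])
qed

section \<open>Counting balanced sets of intervals\<close>

definition balanced :: "nat \<Rightarrow> (nat \<times> nat) set \<Rightarrow> bool" where
  "balanced n S \<longleftrightarrow> S \<subseteq> intervals n \<and> (0, n - 1) \<in> S \<and>
    (\<forall>(a, b)\<in>S. (a, b) = (0, n - 1) \<or> (\<exists>c<a. (c, b) \<in> S) \<or> (\<exists>d>b. (a, d) \<in> S)) \<and>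
    (\<forall>p. 1 \<le> p \<and> p < n \<longrightarrow> (\<exists>b. (p, b) \<in> S) \<or> (\<exists>a. (a, p - 1) \<in> S))"

text \<open>The part of \<open>balanced\<close> that is left for the columns with right end point
  below \<open>m\<close>, when the columns from \<open>m\<close> on are filled and \<open>R\<close>
  is the set of their occupied rows. The vertex \<open>p = m\<close> is included: no remaining
  interval starts there, but one may still end at \<open>m - 1\<close>.\<close>

definition completes :: "nat \<Rightarrow> nat set \<Rightarrow> (nat \<times> nat) set \<Rightarrow> bool" where
  "completes m R S \<longleftrightarrow>
    (\<forall>(a, b)\<in>S. a \<in> R \<or> (\<exists>c<a. (c, b) \<in> S) \<or> (\<exists>d>b. (a, d) \<in> S)) \<and>
    (\<forall>p. 1 \<le> p \<and> p \<le> m \<longrightarrow> p \<in> R \<or> (\<exists>b. (p, b) \<in> S) \<or> (\<exists>a. (a, p - 1) \<in> S))"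

definition completion_weight :: "'r::comm_ring_1 \<Rightarrow> nat \<Rightarrow> nat set \<Rightarrow> 'r" where
  "completion_weight x m R = (\<Sum>S\<in>Pow (intervals m). if completes m R S then x ^ card S else 0)"

lemma finite_intervals: "finite (intervals n)"
  by (rule finite_subset[of _ "{..<n} \<times> {..<n}"]) (auto simp: intervals_def)

lemma sum_Pow_insert:
  assumes "finite A" "a \<notin> A"
  shows "sum f (Pow (insert a A)) = sum f (Pow A) + sum (\<lambda>X. f (insert a X)) (Pow A)"
proof -
  have "inj_on (insert a) (Pow A)" using assms(2) by (auto simp: inj_on_def)
  moreover have "Pow A \<inter> insert a ` Pow A = {}" using assms(2) by auto
  ultimately show ?thesis
    using assms(1) by (simp add: Pow_insert sum.union_disjoint sum.reindex comp_def)
qed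

lemma sum_Pow_Un:
  assumes "finite A" "finite B" "A \<inter> B = {}"
  shows "sum f (Pow (A \<union> B)) = (\<Sum>X\<in>Pow A. \<Sum>Y\<in>Pow B. f (X \<union> Y))"
  using assms(1,3)
proof (induction A arbitrary: f rule: finite_induct)
  case (insert a A)
  have "sum f (Pow (insert a A \<union> B)) = sum f (Pow (A \<union> B)) + sum (\<lambda>X. f (insert a X)) (Pow (A \<union> B))"
    using insert assms(2) sum_Pow_insert[of "A \<union> B" a f] by simp
  also have "\<dots> = (\<Sum>X\<in>Pow A. \<Sum>Y\<in>Pow B. f (X \<union> Y)) + (\<Sum>X\<in>Pow A. \<Sum>Y\<in>Pow B. f (insert a X \<union> Y))"
    using insert by simp
  also have "\<dots> = (\<Sum>X\<in>Pow (insert a A). \<Sum>Y\<in>Pow B. f (X \<union> Y))"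
    using insert by (simp add: sum_Pow_insert)
  finally show ?case .
qed simp

lemma sum_Pow_intervals_Suc:
  "sum f (Pow (intervals (Suc m))) = (\<Sum>C\<in>Pow {..m}. \<Sum>S\<in>Pow (intervals m). f (C \<times> {m} \<union> S))"
proof -
  have "intervals (Suc m) = {..m} \<times> {m} \<union> intervals m" by (auto simp: intervals_def)
  moreover have "{..m} \<times> {m} \<inter> intervals m = {}" by (auto simp: intervals_def)
  ultimately have "sum f (Pow (intervals (Suc m))) = (\<Sum>X\<in>Pow ({..m} \<times> {m}). \<Sum>S\<in>Pow (intervals m). f (X \<union> S))"
    by (simp add: sum_Pow_Un finite_intervals)
  also have "Pow ({..m} \<times> {m}) = (\<lambda>C. C \<times> {m}) ` Pow {..m}"
  proof
    show "Pow ({..m} \<times> {m}) \<subseteq> (\<lambda>C. C \<times> {m}) ` Pow {..m}"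
    proof
      fix X assume "X \<in> Pow ({..m} \<times> {m})"
      hence "X = fst ` X \<times> {m}" "fst ` X \<in> Pow {..m}" by force+
      thus "X \<in> (\<lambda>C. C \<times> {m}) ` Pow {..m}" by blast
    qed
  qed auto
  also have "(\<Sum>X\<in>\<dots>. \<Sum>S\<in>Pow (intervals m). f (X \<union> S)) =
      (\<Sum>C\<in>Pow {..m}. \<Sum>S\<in>Pow (intervals m). f (C \<times> {m} \<union> S))"
    by (subst sum.reindex) (auto simp: inj_on_def)
  finally show ?thesis .
qed

lemma card_column_Un:
  assumes "C \<subseteq> {..m}" "S \<subseteq> intervals m"
  shows "card (C \<times> {m} \<union> S) = card C + card S"
proof -
  have "finite C" "finite S" using assms finite_intervals finite_subset by blast+
  moreover have "C \<times> {m} \<inter> S = {}" using assms(2) by (auto simp: intervals_def)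
  ultimately show ?thesis by (simp add: card_Un_disjoint card_cartesian_product)
qed

text \<open>Only the set \<open>R\<close> of rows that are already occupied in the columns to the right matters for
  the admissible fillings of the remaining columns.\<close>

lemma balanced_column:
  assumes C: "C \<subseteq> {..m}" and S: "S \<subseteq> intervals m"
  shows "balanced (Suc m) (C \<times> {m} \<union> S) \<longleftrightarrow> 0 \<in> C \<and> completes m C S"
proof -
  have S': "(a, b) \<in> S \<Longrightarrow> a \<le> b \<and> b < m" for a b using S by (auto simp: intervals_def)
  have sub: "C \<times> {m} \<union> S \<subseteq> intervals (Suc m)" using C S by (auto simp: intervals_def)
  show ?thesis
  proof
    assume bal: "balanced (Suc m) (C \<times> {m} \<union> S)"
    have "0 \<in> C" using bal S'[of 0 m] by (auto simp: balanced_def)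
    moreover have "a \<in> C \<or> (\<exists>c<a. (c, b) \<in> S) \<or> (\<exists>d>b. (a, d) \<in> S)" if ab: "(a, b) \<in> S" for a b
    proof -
      have "(a, b) = (0, m) \<or> (\<exists>c<a. (c, b) \<in> C \<times> {m} \<union> S) \<or> (\<exists>d>b. (a, d) \<in> C \<times> {m} \<union> S)"
        using bal ab by (auto simp: balanced_def)
      thus ?thesis using S'[OF ab] by auto
    qed
    moreover have "p \<in> C \<or> (\<exists>b. (p, b) \<in> S) \<or> (\<exists>a. (a, p - 1) \<in> S)" if "1 \<le> p" "p \<le> m" for p
    proof -
      have "(\<exists>b. (p, b) \<in> C \<times> {m} \<union> S) \<or> (\<exists>a. (a, p - 1) \<in> C \<times> {m} \<union> S)"
        using bal that by (simp add: balanced_def)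
      moreover have "p - 1 \<noteq> m" using that by simp
      ultimately show ?thesis by auto
    qed
    ultimately show "0 \<in> C \<and> completes m C S" by (auto simp: completes_def)
  next
    assume c: "0 \<in> C \<and> completes m C S"
    have "(a, b) = (0, m) \<or> (\<exists>c<a. (c, b) \<in> C \<times> {m} \<union> S) \<or> (\<exists>d>b. (a, d) \<in> C \<times> {m} \<union> S)"
      if ab: "(a, b) \<in> C \<times> {m} \<union> S" for a b
    proof (cases "(a, b) \<in> S")
      case True
      hence "a \<in> C \<or> (\<exists>c<a. (c, b) \<in> S) \<or> (\<exists>d>b. (a, d) \<in> S)" using c by (auto simp: completes_def)
      thus ?thesis using S'[OF True] by auto
    next
      case False
      thus ?thesis using ab c by (cases "a = 0") auto
    qed
    moreover have "(\<exists>b. (p, b) \<in> C \<times> {m} \<union> S) \<or> (\<exists>a. (a, p - 1) \<in> C \<times> {m} \<union> S)" if "1 \<le> p" "p \<le> m" for p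
      using c that unfolding completes_def by blast
    ultimately show "balanced (Suc m) (C \<times> {m} \<union> S)"
      using sub c by (auto simp: balanced_def)
  qed
qed

text \<open>Equivalently, \<open>C\<close> is empty or its least element belongs to
  \<open>R\<close>: only the topmost cell of a column cannot be prolonged within the column, so it
  has to be prolonged to the right.\<close>

definition top_in :: "nat set \<Rightarrow> nat set \<Rightarrow> bool" where
  "top_in R C \<longleftrightarrow> (\<forall>c\<in>C. c \<in> R \<or> (\<exists>c'\<in>C. c' < c))"

text \<open>A cell of column \<open>m\<close> is prolonged to the right through \<open>R\<close> and
  to the left through a smaller row of \<open>C\<close>. The vertex \<open>Suc m\<close> is no
  starting point of the remaining intervals, so unless it lies in \<open>R\<close> some interval
  must end at \<open>m\<close>.\<close>

lemma completes_column:
  assumes C: "C \<subseteq> {..m}" and S: "S \<subseteq> intervals m"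
  shows "completes (Suc m) R (C \<times> {m} \<union> S) \<longleftrightarrow>
    top_in R C \<and> (Suc m \<in> R \<or> C \<noteq> {}) \<and> completes m (R \<union> C) S"
proof -
  have S': "(a, b) \<in> S \<Longrightarrow> a \<le> b \<and> b < m" for a b using S by (auto simp: intervals_def)
  have col: "(a, m) \<in> C \<times> {m} \<union> S \<longleftrightarrow> a \<in> C" for a using S'[of a m] by auto
  have oth: "b \<noteq> m \<Longrightarrow> (a, b) \<in> C \<times> {m} \<union> S \<longleftrightarrow> (a, b) \<in> S" for a b by auto
  show ?thesis
  proof
    assume c: "completes (Suc m) R (C \<times> {m} \<union> S)"
    hence A: "a \<in> R \<or> (\<exists>c<a. (c, b) \<in> C \<times> {m} \<union> S) \<or> (\<exists>d>b. (a, d) \<in> C \<times> {m} \<union> S)"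
      if "(a, b) \<in> C \<times> {m} \<union> S" for a b using that by (auto simp: completes_def)
    have B: "p \<in> R \<or> (\<exists>b. (p, b) \<in> C \<times> {m} \<union> S) \<or> (\<exists>a. (a, p - 1) \<in> C \<times> {m} \<union> S)"
      if "1 \<le> p" "p \<le> Suc m" for p using c that by (simp add: completes_def)
    have "top_in R C" unfolding top_in_def using A[of _ m] S' col by fastforce
    moreover have "Suc m \<in> R \<or> C \<noteq> {}" using B[of "Suc m"] C S' by fastforce
    moreover have "a \<in> R \<union> C \<or> (\<exists>c<a. (c, b) \<in> S) \<or> (\<exists>d>b. (a, d) \<in> S)" if ab: "(a, b) \<in> S" for a b
      using A[of a b] ab S'[OF ab] by auto
    moreover have "p \<in> R \<union> C \<or> (\<exists>b. (p, b) \<in> S) \<or> (\<exists>a. (a, p - 1) \<in> S)" if "1 \<le> p" "p \<le> m" for p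
      using B[of p] that by auto
    ultimately show "top_in R C \<and> (Suc m \<in> R \<or> C \<noteq> {}) \<and> completes m (R \<union> C) S"
      by (auto simp: completes_def)
  next
    assume c: "top_in R C \<and> (Suc m \<in> R \<or> C \<noteq> {}) \<and> completes m (R \<union> C) S"
    have "a \<in> R \<or> (\<exists>c<a. (c, b) \<in> C \<times> {m} \<union> S) \<or> (\<exists>d>b. (a, d) \<in> C \<times> {m} \<union> S)"
      if ab: "(a, b) \<in> C \<times> {m} \<union> S" for a b
    proof (cases "(a, b) \<in> S")
      case True
      hence "a \<in> R \<union> C \<or> (\<exists>c<a. (c, b) \<in> S) \<or> (\<exists>d>b. (a, d) \<in> S)" using c by (auto simp: completes_def)
      thus ?thesis using S'[OF True] by auto
    next
      case False
      thus ?thesis using ab c by (auto simp: top_in_def)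
    qed
    moreover have "p \<in> R \<or> (\<exists>b. (p, b) \<in> C \<times> {m} \<union> S) \<or> (\<exists>a. (a, p - 1) \<in> C \<times> {m} \<union> S)"
      if p: "1 \<le> p" "p \<le> Suc m" for p
    proof (cases "p = Suc m")
      case True thus ?thesis using c by auto
    next
      case False
      hence "p \<in> R \<union> C \<or> (\<exists>b. (p, b) \<in> S) \<or> (\<exists>a. (a, p - 1) \<in> S)"
        using p c by (simp add: completes_def)
      thus ?thesis by auto
    qed
    ultimately show "completes (Suc m) R (C \<times> {m} \<union> S)" by (auto simp: completes_def)
  qed
qed

lemma completion_weight_Suc:
  "completion_weight x (Suc m) R = (\<Sum>C\<in>Pow {..m}. if top_in R C \<and> (Suc m \<in> R \<or> C \<noteq> {})
     then x ^ card C * completion_weight x m (R \<union> C) else 0)"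
  unfolding completion_weight_def sum_Pow_intervals_Suc
proof (rule sum.cong[OF refl])
  fix C assume "C \<in> Pow {..m}"
  hence C: "C \<subseteq> {..m}" by simp
  show "(\<Sum>S\<in>Pow (intervals m). if completes (Suc m) R (C \<times> {m} \<union> S) then x ^ card (C \<times> {m} \<union> S) else 0) =
    (if top_in R C \<and> (Suc m \<in> R \<or> C \<noteq> {}) then x ^ card C *
      (\<Sum>S\<in>Pow (intervals m). if completes m (R \<union> C) S then x ^ card S else 0) else 0)"
  proof -
    have eq: "(if completes (Suc m) R (C \<times> {m} \<union> S) then x ^ card (C \<times> {m} \<union> S) else 0) =
        (if top_in R C \<and> (Suc m \<in> R \<or> C \<noteq> {}) then x ^ card C * (if completes m (R \<union> C) S then x ^ card S else 0) else 0)"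
      if "S \<in> Pow (intervals m)" for S
      using completes_column[OF C, of S R] card_column_Un[OF C, of S] that by (auto simp: power_add)
    show ?thesis
      by (rule trans[OF sum.cong[OF refl]], rule eq, assumption)
        (cases "top_in R C \<and> (Suc m \<in> R \<or> C \<noteq> {})"; simp only: simp_thms if_True if_False sum_distrib_left sum.neutral_const)
  qed
qed

text \<open>Serves to discard row \<open>Suc m\<close> once the column with right end point
  \<open>Suc m\<close> has been absorbed.\<close>

lemma completion_weight_restrict:
  "completion_weight x m (R \<inter> {..m}) = completion_weight x m R"
  unfolding completion_weight_def
proof (rule sum.cong[OF refl])
  fix S assume "S \<in> Pow (intervals m)"
  hence "completes m (R \<inter> {..m}) S \<longleftrightarrow> completes m R S"
    by (fastforce simp: completes_def intervals_def)
  thus "(if completes m (R \<inter> {..m}) S then x ^ card S else 0) = (if completes m R S then x ^ card S else 0)"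
    by simp
qed

text \<open>Every element of \<open>D\<close> lies independently in \<open>R\<close> only, in
  \<open>C\<close> only or in both, with weights u, x and u * x.\<close>

lemma sum_covers:
  fixes u x :: "'r::comm_ring_1" and D :: "nat set"
  assumes "finite D"
  shows "(\<Sum>R\<in>Pow D. \<Sum>C\<in>Pow D. if R \<union> C = D then u ^ card R * x ^ card C else 0) =
    (u + x + u * x) ^ card D"
  using assms
proof (induction D rule: finite_induct)
  case (insert d D)
  have [simp]: "R \<union> C \<noteq> insert d D" "insert d (R \<union> C) = insert d D \<longleftrightarrow> R \<union> C = D"
     "card (insert d R) = Suc (card R)"
    if "R \<in> Pow D" "C \<in> Pow D" for R C using that insert finite_subset[of R D] by (auto simp: card_insert_if)
  let ?F = "\<Sum>R\<in>Pow D. \<Sum>C\<in>Pow D. if R \<union> C = D then u ^ card R * x ^ card C else 0"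
  have 0: "(\<Sum>R\<in>Pow D. \<Sum>C\<in>Pow D. if R \<union> C = insert d D then u ^ card R * x ^ card C else 0) = 0"
    by (intro sum.neutral ballI) auto
  have 1: "(\<Sum>R\<in>Pow D. \<Sum>C\<in>Pow D. if insert d R \<union> C = insert d D then u ^ card (insert d R) * x ^ card C else 0) = u * ?F"
    unfolding sum_distrib_left by (intro sum.cong refl) auto
  have 2: "(\<Sum>R\<in>Pow D. \<Sum>C\<in>Pow D. if R \<union> insert d C = insert d D then u ^ card R * x ^ card (insert d C) else 0) = x * ?F"
    unfolding sum_distrib_left by (intro sum.cong refl) auto
  have 3: "(\<Sum>R\<in>Pow D. \<Sum>C\<in>Pow D. if insert d R \<union> insert d C = insert d D then u ^ card (insert d R) * x ^ card (insert d C) else 0) = u * x * ?F"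
    unfolding sum_distrib_left by (intro sum.cong refl) auto
  show ?case
    using insert.hyps insert.IH
    by (simp only: sum_Pow_insert[OF insert.hyps] sum.distrib 0 1 2 3) (simp add: algebra_simps)
qed simp

text \<open>Induction by adding a new minimum d. If d lies in \<open>C\<close> only,
  \<open>top_in\<close> fails; if it lies in \<open>R\<close> only, nothing changes and a factor u
  appears; if it lies in both, \<open>top_in\<close> holds automatically, \<open>C\<close> is
  nonempty and the rest is the unrestricted sum of \<open>sum_covers\<close>. With y = u + x + u * x
  the step is u * u + u * x * (1 + u) = u * y. The last factor of the summand stands for one further
  row, which \<open>row_weight_Suc\<close> treats apart.\<close>

lemma sum_covers_top_in:
  fixes u x :: "'r::comm_ring_1" and D :: "nat set"
  assumes "finite D"
  shows "(\<Sum>R\<in>Pow D. \<Sum>C\<in>Pow D. if R \<union> C = D \<and> top_in R C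
      then u ^ card R * x ^ card C * ((if C = {} then 0 else 1) + u) else 0) = u * (u + x + u * x) ^ card D"
  using assms
proof (induction D rule: finite_linorder_min_induct)
  case empty
  show ?case by (simp add: top_in_def)
next
  case (insert d D)
  have nD: "d \<notin> D" using insert by auto
  have s: "R \<union> C \<noteq> insert d D" "insert d R \<union> C = insert d D \<longleftrightarrow> R \<union> C = D"
      "insert d R \<union> insert d C = insert d D \<longleftrightarrow> R \<union> C = D" "insert d (R \<union> C) = insert d D \<longleftrightarrow> R \<union> C = D"
     "card (insert d R) = Suc (card R)" "card (insert d C) = Suc (card C)"
     "\<not> top_in R (insert d C)" "top_in (insert d R) (insert d C)" "top_in (insert d R) C \<longleftrightarrow> top_in R C"
    if "R \<in> Pow D" "C \<in> Pow D" for R C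
  proof -
    have fin: "finite R" "finite C" "d \<notin> R" "d \<notin> C" using that insert nD finite_subset by blast+
    show "R \<union> C \<noteq> insert d D" "insert d R \<union> C = insert d D \<longleftrightarrow> R \<union> C = D"
      "insert d R \<union> insert d C = insert d D \<longleftrightarrow> R \<union> C = D"
      "insert d (R \<union> C) = insert d D \<longleftrightarrow> R \<union> C = D" using that nD by auto
    show "card (insert d R) = Suc (card R)" "card (insert d C) = Suc (card C)" using fin by simp_all
    have lt: "d < c" if "c \<in> C" for c using that \<open>C \<in> Pow D\<close> insert by auto
    show "\<not> top_in R (insert d C)" using fin lt by (fastforce simp: top_in_def)
    show "top_in (insert d R) (insert d C)" using lt by (auto simp: top_in_def)
    show "top_in (insert d R) C \<longleftrightarrow> top_in R C" using fin by (auto simp: top_in_def)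
  qed
  let ?w = "\<lambda>R C. u ^ card R * x ^ card C * ((if C = {} then 0 else 1) + u)"
  let ?F = "\<Sum>R\<in>Pow D. \<Sum>C\<in>Pow D. if R \<union> C = D \<and> top_in R C then ?w R C else 0"
  let ?G = "\<Sum>R\<in>Pow D. \<Sum>C\<in>Pow D. if R \<union> C = D then u ^ card R * x ^ card C else 0"
  have 0: "(\<Sum>R\<in>Pow D. \<Sum>C\<in>Pow D. if R \<union> C = insert d D \<and> top_in R C then ?w R C else 0) = 0"
    by (intro sum.neutral ballI) (simp add: s)
  have 1: "(\<Sum>R\<in>Pow D. \<Sum>C\<in>Pow D. if insert d R \<union> C = insert d D \<and> top_in (insert d R) C then ?w (insert d R) C else 0) = u * ?F"
    unfolding sum_distrib_left by (intro sum.cong refl) (simp add: s mult.assoc)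
  have 2: "(\<Sum>R\<in>Pow D. \<Sum>C\<in>Pow D. if R \<union> insert d C = insert d D \<and> top_in R (insert d C) then ?w R (insert d C) else 0) = 0"
    by (intro sum.neutral ballI) (simp add: s)
  have 3: "(\<Sum>R\<in>Pow D. \<Sum>C\<in>Pow D. if insert d R \<union> insert d C = insert d D \<and> top_in (insert d R) (insert d C) then ?w (insert d R) (insert d C) else 0) = u * x * (1 + u) * ?G"
    unfolding sum_distrib_left by (intro sum.cong refl) (simp add: s algebra_simps)
  have "(\<Sum>R\<in>Pow (insert d D). \<Sum>C\<in>Pow (insert d D). if R \<union> C = insert d D \<and> top_in R C then ?w R C else 0)
     = u * ?F + u * x * (1 + u) * ?G"
    by (simp only: sum_Pow_insert[OF insert(1) nD] sum.distrib 0 1 2 3) simp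
  also have "\<dots> = u * (u * (u + x + u * x) ^ card D) + u * x * (1 + u) * (u + x + u * x) ^ card D"
    by (simp only: insert.IH sum_covers[OF insert(1)])
  also have "\<dots> = u * (u + x + u * x) ^ card (insert d D)"
    using insert(1) nD by (simp add: algebra_simps)
  finally show ?case .
qed

text \<open>The function F (m + 1) of the overview, where \<open>C\<close> is the column with right
  end point \<open>m\<close>; the condition \<open>0 \<in> C\<close> is the presence of the longest
  interval.\<close>

definition row_weight :: "'r::comm_ring_1 \<Rightarrow> nat \<Rightarrow> 'r \<Rightarrow> 'r" where
  "row_weight x m u = (\<Sum>C\<in>Pow {..m}. if 0 \<in> C then u ^ card C * completion_weight x m C else 0)"

text \<open>The pairs of the columns \<open>R\<close> and \<open>C\<close> with right end points
  \<open>Suc m\<close> and \<open>m\<close> are sorted by their union \<open>D\<close>, on which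
  alone the weight of the remaining columns depends. For fixed \<open>D\<close> they are summed by
  \<open>sum_covers_top_in\<close>.\<close>

lemma row_weight_Suc: "row_weight x (Suc m) u = u * row_weight x m (u + x + u * x)"
proof -
  let ?P = "Pow {..m}" and ?H = "completion_weight x m"
  let ?w = "\<lambda>R C. u ^ card R * x ^ card C * ((if C = {} then 0 else 1) + u)"
  have R: "Suc m \<notin> R" "card (insert (Suc m) R) = Suc (card R)" if "R \<in> ?P" for R
    using that finite_subset[of R "{..m}"] by (auto simp: card_insert_if)
  have H: "?H (insert (Suc m) (R \<union> C)) = ?H (R \<union> C)" if "R \<in> ?P" "C \<in> ?P" for R C
  proof -
    have "insert (Suc m) (R \<union> C) \<inter> {..m} = R \<union> C" using that by auto
    thus ?thesis using completion_weight_restrict[of x m "insert (Suc m) (R \<union> C)"] by simp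
  qed
  have top: "top_in (insert (Suc m) R) C \<longleftrightarrow> top_in R C" if "C \<in> ?P" for R C
    using that by (fastforce simp: top_in_def)
  have at: "{..Suc m} = insert (Suc m) {..m}" by auto
  \<comment> \<open>The two sums differ in the cell in row \<open>Suc m\<close>, which is taken out
    of \<open>R\<close>. If it is empty, \<open>C\<close> must be nonempty; if it is filled,
    \<open>C\<close> is free of this demand and there is an extra u. Together this gives the last
    factor of \<open>?w\<close>.\<close>
  have "row_weight x (Suc m) u =
      (\<Sum>R\<in>?P. if 0 \<in> R then u ^ card R * completion_weight x (Suc m) R else 0) +
      (\<Sum>R\<in>?P. if 0 \<in> R then u ^ Suc (card R) * completion_weight x (Suc m) (insert (Suc m) R) else 0)"
    unfolding row_weight_def at
    by (subst sum_Pow_insert) (simp_all, intro sum.cong refl, simp add: R)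
  also have "\<dots> = (\<Sum>R\<in>?P. \<Sum>C\<in>?P. if 0 \<in> R \<and> top_in R C then ?w R C * ?H (R \<union> C) else 0)"
    unfolding sum.distrib[symmetric] completion_weight_Suc
  proof (rule sum.cong[OF refl])
    fix R assume R': "R \<in> ?P"
    show "(if 0 \<in> R then u ^ card R * (\<Sum>C\<in>?P. if top_in R C \<and> (Suc m \<in> R \<or> C \<noteq> {}) then x ^ card C * ?H (R \<union> C) else 0) else 0) +
        (if 0 \<in> R then u ^ Suc (card R) * (\<Sum>C\<in>?P. if top_in (insert (Suc m) R) C \<and> (Suc m \<in> insert (Suc m) R \<or> C \<noteq> {})
           then x ^ card C * ?H (insert (Suc m) R \<union> C) else 0) else 0) =
        (\<Sum>C\<in>?P. if 0 \<in> R \<and> top_in R C then ?w R C * ?H (R \<union> C) else 0)"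
    proof (cases "0 \<in> R")
      case True
      have "u ^ card R * (if top_in R C \<and> (Suc m \<in> R \<or> C \<noteq> {}) then x ^ card C * ?H (R \<union> C) else 0) +
          u ^ Suc (card R) * (if top_in (insert (Suc m) R) C \<and> (Suc m \<in> insert (Suc m) R \<or> C \<noteq> {})
            then x ^ card C * ?H (insert (Suc m) R \<union> C) else 0) =
          (if 0 \<in> R \<and> top_in R C then ?w R C * ?H (R \<union> C) else 0)" if "C \<in> ?P" for C
        using R(1)[OF R'] True H[OF R' that] top[OF that, of R] by (auto simp: algebra_simps)
      from sum.cong[OF refl this] show ?thesis
        using True by (simp only: if_True sum_distrib_left sum.distrib[symmetric])
    qed simp
  qed
  also have "\<dots> = (\<Sum>R\<in>?P. \<Sum>C\<in>?P. \<Sum>D\<in>?P. if D = R \<union> C \<and> 0 \<in> D \<and> top_in R C then ?w R C * ?H D else 0)"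
  proof (intro sum.cong refl)
    fix R C assume RC: "R \<in> ?P" "C \<in> ?P"
    hence "R \<union> C \<in> ?P" by auto
    \<comment> \<open>Row 0 can lie in the union only by lying in \<open>R\<close>, because
      \<open>top_in\<close> leaves no other way for the element 0 of \<open>C\<close>.\<close>
    moreover have "0 \<in> R \<union> C \<and> top_in R C \<longleftrightarrow> 0 \<in> R \<and> top_in R C" by (auto simp: top_in_def)
    moreover have "(\<Sum>D\<in>?P. if D = R \<union> C \<and> 0 \<in> D \<and> top_in R C then ?w R C * ?H D else 0) =
       (\<Sum>D\<in>?P. if D = R \<union> C then (if 0 \<in> R \<union> C \<and> top_in R C then ?w R C * ?H (R \<union> C) else 0) else 0)"
      by (intro sum.cong) auto
    ultimately show "(if 0 \<in> R \<and> top_in R C then ?w R C * ?H (R \<union> C) else 0) =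
        (\<Sum>D\<in>?P. if D = R \<union> C \<and> 0 \<in> D \<and> top_in R C then ?w R C * ?H D else 0)"
      by (simp add: sum.delta)
  qed
  also have "\<dots> = (\<Sum>R\<in>?P. \<Sum>D\<in>?P. \<Sum>C\<in>?P. if D = R \<union> C \<and> 0 \<in> D \<and> top_in R C then ?w R C * ?H D else 0)"
    by (intro sum.cong refl sum.swap)
  also have "\<dots> = (\<Sum>D\<in>?P. \<Sum>R\<in>?P. \<Sum>C\<in>?P. if D = R \<union> C \<and> 0 \<in> D \<and> top_in R C then ?w R C * ?H D else 0)"
    by (rule sum.swap)
  also have "\<dots> = (\<Sum>D\<in>?P. if 0 \<in> D then u * (u + x + u * x) ^ card D * ?H D else 0)"
  proof (rule sum.cong[OF refl])
    fix D assume D: "D \<in> ?P"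
    show "(\<Sum>R\<in>?P. \<Sum>C\<in>?P. if D = R \<union> C \<and> 0 \<in> D \<and> top_in R C then ?w R C * ?H D else 0) =
      (if 0 \<in> D then u * (u + x + u * x) ^ card D * ?H D else 0)"
    proof (cases "0 \<in> D")
      case True
      have "(\<Sum>R\<in>?P. \<Sum>C\<in>?P. if D = R \<union> C \<and> 0 \<in> D \<and> top_in R C then ?w R C * ?H D else 0) =
        (\<Sum>R\<in>Pow D. \<Sum>C\<in>?P. if D = R \<union> C \<and> 0 \<in> D \<and> top_in R C then ?w R C * ?H D else 0)"
        using D by (intro sum.mono_neutral_right) (auto intro!: sum.neutral)
      also have "\<dots> = (\<Sum>R\<in>Pow D. \<Sum>C\<in>Pow D. if D = R \<union> C \<and> 0 \<in> D \<and> top_in R C then ?w R C * ?H D else 0)"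
        using D by (intro sum.cong refl sum.mono_neutral_right) auto
      also have "\<dots> = (\<Sum>R\<in>Pow D. \<Sum>C\<in>Pow D. if R \<union> C = D \<and> top_in R C then ?w R C else 0) * ?H D"
        unfolding sum_distrib_right using True by (intro sum.cong refl) auto
      finally show ?thesis using True D sum_covers_top_in[of D u x] finite_subset[of D "{..m}"] by simp
    qed simp
  qed
  also have "\<dots> = u * row_weight x m (u + x + u * x)"
    unfolding row_weight_def sum_distrib_left by (intro sum.cong) (auto simp: mult.assoc)
  finally show ?thesis .
qed

text \<open>The leading u in the recursion is the factor for \<open>i = 0\<close>; the substitution
  multiplies 1 + u by 1 + x and thereby shifts the remaining exponents by one.\<close>

lemma row_weight_prod: "row_weight x m u = (\<Prod>i\<le>m. (1 + u) * (1 + x) ^ i - 1)"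
proof (induction m arbitrary: u)
  case 0
  have "Pow {..0::nat} = {{}, {0}}" by auto
  moreover have "intervals 0 = {}" by (auto simp: intervals_def)
  ultimately show ?case by (simp add: row_weight_def completion_weight_def completes_def)
next
  case (Suc m)
  have "1 + (u + x + u * x) = (1 + u) * (1 + x)" by (simp add: algebra_simps)
  thus ?case by (simp add: row_weight_Suc Suc.IH prod.atMost_Suc_shift mult.assoc del: prod.atMost_Suc)
qed

text \<open>The case u = x of the product. The ring is general because x is later taken to be
  \<open>fps_X\<close> for the generating function and an integer for bounded
  multiplicities.\<close>

theorem sum_balanced:
  fixes x :: "'r::comm_ring_1"
  assumes "n \<ge> 1"
  shows "(\<Sum>S\<in>{S. balanced n S}. x ^ card S) = (\<Prod>i=1..n. (1 + x) ^ i - 1)"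
proof -
  obtain m where n: "n = Suc m" using assms by (cases n) auto
  have "(\<Sum>S\<in>{S. balanced n S}. x ^ card S) = (\<Sum>S\<in>Pow (intervals n). if balanced n S then x ^ card S else 0)"
    by (intro sum.mono_neutral_cong_left) (auto simp: finite_intervals balanced_def)
  also have "\<dots> = (\<Sum>C\<in>Pow {..m}. \<Sum>S\<in>Pow (intervals m). if balanced (Suc m) (C \<times> {m} \<union> S) then x ^ card (C \<times> {m} \<union> S) else 0)"
    unfolding n by (rule sum_Pow_intervals_Suc)
  also have "\<dots> = row_weight x m x"
    unfolding row_weight_def
  proof (rule sum.cong[OF refl])
    fix C assume "C \<in> Pow {..m}"
    hence C: "C \<subseteq> {..m}" by simp
    show "(\<Sum>S\<in>Pow (intervals m). if balanced (Suc m) (C \<times> {m} \<union> S) then x ^ card (C \<times> {m} \<union> S) else 0) =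
      (if 0 \<in> C then x ^ card C * completion_weight x m C else 0)"
    proof -
      have eq: "(if balanced (Suc m) (C \<times> {m} \<union> S) then x ^ card (C \<times> {m} \<union> S) else 0) =
          (if 0 \<in> C then x ^ card C * (if completes m C S then x ^ card S else 0) else 0)"
        if "S \<in> Pow (intervals m)" for S
        using balanced_column[OF C, of S] card_column_Un[OF C, of S] that by (auto simp: power_add)
      show ?thesis
        by (rule trans[OF sum.cong[OF refl]], rule eq, assumption)
          (cases "0 \<in> C"; simp only: if_True if_False sum_distrib_left sum.neutral_const completion_weight_def)
    qed
  qed
  also have "\<dots> = (\<Prod>i\<le>m. (1 + x) ^ Suc i - 1)" by (simp add: row_weight_prod)
  also have "\<dots> = (\<Prod>i=1..n. (1 + x) ^ i - 1)"
    unfolding n by (rule prod.reindex_bij_witness[of _ "\<lambda>i. i - 1" Suc]) auto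
  finally show ?thesis .
qed

section \<open>The faithfully balanced criterion\<close>

text \<open>\<open>arrow xs t u\<close> says that there is a nonzero map from the \<open>t\<close>-th to the \<open>u\<close>-th interval module; it
  is then unique up to scalars, being the identity on the common vertices.\<close>

definition arrow :: "(nat \<times> nat) list \<Rightarrow> nat \<Rightarrow> nat \<Rightarrow> bool" where
  "arrow xs t u \<longleftrightarrow> t < length xs \<and> u < length xs \<and> fst (xs ! u) \<le> fst (xs ! t) \<and>
    fst (xs ! t) \<le> snd (xs ! u) \<and> snd (xs ! u) \<le> snd (xs ! t)"

definition arrow_map ::
  "(nat \<times> nat) list \<Rightarrow> nat \<Rightarrow> nat \<Rightarrow> (nat \<times> nat \<Rightarrow> 'k::field) \<Rightarrow> nat \<times> nat \<Rightarrow> 'k" where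
  "arrow_map xs t u v = (\<lambda>(s, p). if s = u \<and> (t, p) \<in> cells xs \<and> (u, p) \<in> cells xs then v (t, p) else 0)"

text \<open>If the intervals are [a, b] and [c, d], an arrow means c \<le> a \<le> d \<le> b. Then
  [a, d] is a quotient of the first module and a submodule of the second, and the map is the
  composite.\<close>

lemma arrow_map_lin:
  assumes xs: "set xs \<subseteq> intervals n" and tu: "arrow xs t u"
  shows "lin (Tri n) (bar xs) (bar xs) (arrow_map xs t u :: _ \<Rightarrow> _ \<Rightarrow> 'k::field)"
proof (rule lin_TriI[OF bar_left_module[OF xs] bar_left_module[OF xs]])
  fix v :: "nat \<times> nat \<Rightarrow> 'k" assume v: "v \<in> carrier (bar xs)"
  show "arrow_map xs t u v \<in> carrier (bar xs)" by (auto simp: bar_carrier arrow_map_def)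
  show "arrow_map xs t u (v \<oplus>\<^bsub>bar xs\<^esub> w) = arrow_map xs t u v \<oplus>\<^bsub>bar xs\<^esub> arrow_map xs t u w" for w
    by (auto simp: arrow_map_def fun_eq_iff)
  show "arrow_map xs t u (munit n c i j \<odot>\<^bsub>bar xs\<^esub> v) = munit n c i j \<odot>\<^bsub>bar xs\<^esub> arrow_map xs t u v"
    if ij: "j \<le> i" "i < n" for c i j
  proof (rule ext, clarify)
    fix s p
    have v0: "v (t, j) = 0" if "(t, j) \<notin> cells xs" using v that by (simp add: bar_carrier)
    have "(t, i) \<in> cells xs \<longleftrightarrow> (u, j) \<in> cells xs" if "(u, i) \<in> cells xs" "(t, j) \<in> cells xs"
      using tu ij that by (auto simp: arrow_def cells_def)
    moreover have "(u, j) \<in> cells xs" if "(u, i) \<in> cells xs" "(t, j) \<in> cells xs"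
      using tu ij that by (auto simp: arrow_def cells_def)
    ultimately show "arrow_map xs t u (munit n c i j \<odot>\<^bsub>bar xs\<^esub> v) (s, p) =
        (munit n c i j \<odot>\<^bsub>bar xs\<^esub> arrow_map xs t u v) (s, p)"
      using v0 by (auto simp: arrow_map_def bar_act_munit[OF xs ij])
  qed
qed

lemma arrow_map_delta:
  "(t, p) \<in> cells xs \<Longrightarrow> arrow_map xs t u (delta (t, p) c) = (if (u, p) \<in> cells xs then delta (u, p) c else 0)"
  by (rule ext) (auto simp: arrow_map_def delta_def split: if_splits)

text \<open>Commuting with these endomorphisms makes bicommuting maps homogeneous.\<close>

lemma scale_lin:
  assumes xs: "set xs \<subseteq> intervals n"
  shows "lin (Tri n) (bar xs) (bar xs) (fscale (c::'k::field))"
  by (rule lin_TriI[OF bar_left_module[OF xs] bar_left_module[OF xs]])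
    (auto simp: bar_carrier fun_eq_iff bar_act_munit[OF xs] algebra_simps)

text \<open>The basis vector at its first vertex generates the \<open>t\<close>-th summand, so the
  component of \<open>h\<close> into another summand is a single scalar: the coefficient of the
  image of this generator at that vertex.\<close>

lemma lin_bar_delta:
  assumes xs: "set xs \<subseteq> intervals n" and h: "lin (Tri n) (bar xs) (bar xs) h"
    and tp: "(t, p) \<in> cells xs"
  shows "h (delta (t, p) (c::'k::field)) (u, q) = (if q = p \<and> (u, p) \<in> cells xs \<and> arrow xs t u
      then c * h (delta (t, fst (xs ! t)) 1) (u, fst (xs ! t)) else 0)"
proof -
  define a b where "a = fst (xs ! t)" and "b = snd (xs ! t)"
  note hl = linD[OF h, unfolded bar_simps]
  note lm = bar_left_module[OF xs, where 'k = 'k]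
  have t: "t < length xs" "a \<le> p" "p \<le> b" using tp by (auto simp: cells_def a_def b_def)
  have "xs ! t \<in> intervals n" using xs t nth_mem by blast
  hence b: "b < n" by (auto simp: intervals_def b_def)
  have ta: "(t, a) \<in> cells xs" using t by (auto simp: cells_def a_def b_def)
  note da = delta_carrier[OF ta, of "1::'k"]
  have p: "p < n" using cells_lt[OF xs tp] .
  have "delta (t, p) c = bar_act xs (munit n c p a) (delta (t, a) 1)"
    using bar_act_munit_delta[OF xs t(2) p, of c t a 1] tp by simp
  hence "h (delta (t, p) c) = bar_act xs (munit n c p a) (h (delta (t, a) 1))"
    using hl(3)[OF munit_carrier[OF t(2)] da] by simp
  hence 1: "h (delta (t, p) c) (u, q) = (if q = p \<and> (u, p) \<in> cells xs then c * h (delta (t, a) 1) (u, a) else 0)"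
    by (simp add: bar_act_munit[OF xs t(2) p])
  have "h (delta (t, a) 1) (u, a) = 0" if up: "(u, p) \<in> cells xs" and na: "\<not> arrow xs t u"
  proof (cases "(u, a) \<in> cells xs")
    case False
    thus ?thesis using hl(1)[OF da] unfolding bar_carrier by blast
  next
    case True
    \<comment> \<open>Without an arrow the target reaches beyond \<open>b\<close>. The unit from
      \<open>a\<close> to \<open>Suc b\<close> kills the generator, yet it would carry the
      coefficient at \<open>(u, a)\<close> to \<open>(u, Suc b)\<close>; so this coefficient is
      zero.\<close>
    hence u: "b < snd (xs ! u)" "u < length xs" "fst (xs ! u) \<le> a"
      using na t by (auto simp: arrow_def cells_def a_def b_def)
    hence ub: "(u, Suc b) \<in> cells xs" using t by (auto simp: cells_def)
    have sb: "Suc b < n" using cells_lt[OF xs ub] .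
    have ab: "a \<le> Suc b" using t by simp
    have "(t, Suc b) \<notin> cells xs" by (auto simp: cells_def b_def)
    hence "bar_act xs (munit n 1 (Suc b) a) (delta (t, a) (1::'k)) = 0"
      using bar_act_munit_delta[OF xs ab sb, of "1::'k" t a 1] by simp
    hence "bar_act xs (munit n 1 (Suc b) a) (h (delta (t, a) 1)) = h 0"
      using hl(3)[OF munit_carrier[OF ab, of n 1] da] by metis
    also have "\<dots> = 0" using lin_zero[OF lm lm h] unfolding bar_simps .
    finally have "bar_act xs (munit n 1 (Suc b) a) (h (delta (t, a) 1)) (u, Suc b) = 0" by simp
    thus ?thesis using ub by (simp add: bar_act_munit[OF xs ab sb])
  qed
  thus ?thesis using 1 unfolding a_def by auto
qed

text \<open>The candidates for bicommuting maps that no matrix induces: the entry at position (q0,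
  p0) is 1 on the summands in \<open>T\<close> and 0 elsewhere. The condition \<open>arr\<close>
  says that no arrow relevant for this position leads into or out of \<open>T\<close>.\<close>

lemma bicommuting_component:
  assumes xs: "set xs \<subseteq> intervals n"
    and T: "\<And>t. t \<in> T \<Longrightarrow> (t, p0) \<in> cells xs \<and> (t, q0) \<in> cells xs"
    and arr: "\<And>t u. arrow xs t u \<Longrightarrow> (t, p0) \<in> cells xs \<Longrightarrow> (u, q0) \<in> cells xs \<Longrightarrow> t \<in> T \<longleftrightarrow> u \<in> T"
  shows "bicommuting (Tri n) (bar xs) (\<lambda>v (t, q). if q = q0 \<and> t \<in> T then v (t, p0) else (0::'k::field))"
proof -
  define \<phi> where "\<phi> = (\<lambda>v (t, q). if q = q0 \<and> t \<in> T then v (t, p0) else (0::'k))"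
  have \<phi>_apply: "\<phi> v (t, q) = (if q = q0 \<and> t \<in> T then v (t, p0) else 0)" for v t q by (simp add: \<phi>_def)
  note lm = bar_left_module[OF xs, where 'k = 'k]
  have \<phi>_add: "\<phi> (v + w) = \<phi> v + \<phi> w" for v w by (auto simp: fun_eq_iff \<phi>_apply)
  have "\<phi> (h v) = h (\<phi> v)" if h: "lin (Tri n) (bar xs) (bar xs) h" and v: "v \<in> carrier (bar xs)" for h v
    using v
  proof (induction v rule: bar_induct)
    case zero
    have "h 0 = 0" using lin_zero[OF lm lm h] unfolding bar_simps .
    moreover have "\<phi> 0 = 0" by (auto simp: fun_eq_iff \<phi>_apply)
    ultimately show ?case by metis
  next
    case (add v z c)
    note hl = linD[OF h, unfolded bar_simps]
    obtain t p where z: "z = (t, p)" by (cases z)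
    have tp: "(t, p) \<in> cells xs" using add.hyps z by simp
    have c: "\<phi> w \<in> carrier (bar xs)" for w using T by (auto simp: bar_carrier \<phi>_apply)
    have "\<phi> (delta (t, p) c) = (if t \<in> T \<and> p = p0 then delta (t, q0) c else 0)"
      by (auto simp: fun_eq_iff delta_def \<phi>_apply)
    moreover have "h 0 = 0" using lin_zero[OF lm lm h] unfolding bar_simps .
    ultimately have 1: "h (\<phi> (delta (t, p) c)) = (if t \<in> T \<and> p = p0 then h (delta (t, q0) c) else 0)" by simp
    have 2: "\<phi> (h (delta (t, p) c)) = h (\<phi> (delta (t, p) c))"
    proof (rule ext, clarify)
      fix u q
      let ?k = "h (delta (t, fst (xs ! t)) 1) (u, fst (xs ! t))"
      have "\<phi> (h (delta (t, p) c)) (u, q) =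
          (if q = q0 \<and> u \<in> T \<and> p = p0 \<and> arrow xs t u then c * ?k else 0)"
        using T[of u] by (auto simp: \<phi>_apply lin_bar_delta[OF xs h tp])
      also have "\<dots> = (if t \<in> T \<and> p = p0 then (if q = q0 \<and> (u, q0) \<in> cells xs \<and> arrow xs t u then c * ?k else 0) else 0)"
        using T[of u] arr[of t u] tp by auto
      also have "\<dots> = h (\<phi> (delta (t, p) c)) (u, q)"
        unfolding 1 using T[of t] lin_bar_delta[OF xs h, of t q0 c u q] by auto
      finally show "\<phi> (h (delta (t, p) c)) (u, q) = h (\<phi> (delta (t, p) c)) (u, q)" .
    qed
    have "\<phi> (h (v + delta z c)) = \<phi> (h v) + \<phi> (h (delta z c))"
      using hl(2)[OF add.hyps(1) delta_carrier[OF add.hyps(2)]] \<phi>_add by metis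
    also have "\<dots> = h (\<phi> v) + h (\<phi> (delta z c))" using add.IH 2 z by metis
    also have "\<dots> = h (\<phi> (v + delta z c))"
      using hl(2)[OF c c] \<phi>_add by metis
    finally show ?case .
  qed
  thus ?thesis
    unfolding \<phi>_def[symmetric] bicommuting_def bar_simps
    using \<phi>_add T by (auto simp: bar_carrier \<phi>_apply)
qed

text \<open>Faithfulness yields the longest interval, since the unit at (n - 1, 0) acts as zero on
  all others. A violation of either of the remaining conditions yields a set \<open>T\<close> for
  \<open>bicommuting_component\<close> whose map is not induced by a lower triangular
  matrix.\<close>

lemma faithfully_balanced_imp_balanced:
  assumes xs: "set xs \<subseteq> intervals n" and "n \<ge> 1"
    and fb: "faithfully_balanced (Tri n) (bar xs :: ('k::field mat, _) module)"
  shows "balanced n (set xs)"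
proof -
  note lm = bar_left_module[OF xs, where 'k = 'k]
  have inj: "A = B" if "A \<in> carrier (Tri n)" "B \<in> carrier (Tri n)"
      "\<And>v. v \<in> carrier (bar xs) \<Longrightarrow> bar_act xs A v = bar_act xs B v" for A B :: "'k mat"
    using fb that unfolding faithfully_balanced_iff[OF lm] bar_simps by blast
  have surj: "\<exists>A\<in>carrier (Tri n). \<forall>v\<in>carrier (bar xs). \<phi> v = bar_act xs A v"
    if "bicommuting (Tri n) (bar xs) \<phi>" for \<phi> :: "(nat \<times> nat \<Rightarrow> 'k) \<Rightarrow> _"
    using fb that unfolding faithfully_balanced_iff[OF lm] bar_simps by blast
  have iv: "xs ! t \<in> intervals n" if "t < length xs" for t using xs that nth_mem by blast
  have "\<exists>t. (t, 0) \<in> cells xs \<and> (t, n - 1) \<in> cells xs"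
  proof (rule ccontr)
    assume no: "\<not> (\<exists>t. (t, 0) \<in> cells xs \<and> (t, n - 1) \<in> cells xs)"
    have n: "0 \<le> n - 1" "n - 1 < n" using assms(2) by simp_all
    have "munit n (1::'k) (n - 1) 0 = 0\<^sub>m n n"
    proof (rule inj)
      show "munit n (1::'k) (n - 1) 0 \<in> carrier (Tri n)" by (rule munit_carrier) simp
      show "(0\<^sub>m n n :: 'k mat) \<in> carrier (Tri n)" by (simp add: Tri_carrier)
      fix v :: "nat \<times> nat \<Rightarrow> 'k" assume v: "v \<in> carrier (bar xs)"
      have "bar_act xs (0\<^sub>m n n) v = 0"
        using left_module.smult_zero_left[OF lm v] unfolding bar_simps Tri_simps .
      moreover have "bar_act xs (munit n 1 (n - 1) 0) v = 0"
      proof (rule ext, clarify)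
        fix s p show "bar_act xs (munit n 1 (n - 1) 0) v (s, p) = 0 (s, p)"
          unfolding bar_act_munit[OF xs n] using no v by (auto simp: bar_carrier)
      qed
      ultimately show "bar_act xs (munit n 1 (n - 1) 0) v = bar_act xs (0\<^sub>m n n) v" by metis
    qed
    hence "munit n (1::'k) (n - 1) 0 $$ (n - 1, 0) = 0\<^sub>m n n $$ (n - 1, 0)" by simp
    thus False using assms(2) by simp
  qed
  then obtain t0 where t0: "(t0, 0) \<in> cells xs" "(t0, n - 1) \<in> cells xs" by blast
  have t0': "t0 < length xs" "xs ! t0 = (0, n - 1)"
    using t0 iv[of t0] by (auto simp: cells_def intervals_def prod_eq_iff)
  have top: "(t0, p) \<in> cells xs" if "p < n" for p using that t0' by (auto simp: cells_def)
  have A: "(\<exists>c<a. (c, b) \<in> set xs) \<or> (\<exists>d>b. (a, d) \<in> set xs)"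
    if ab: "(a, b) \<in> set xs" "(a, b) \<noteq> (0, n - 1)" for a b
  proof (rule ccontr)
    assume no: "\<not> ?thesis"
    obtain t where t: "t < length xs" "xs ! t = (a, b)" using ab(1) by (auto simp: in_set_conv_nth)
    have abn: "a \<le> b" "b < n" using xs ab(1) by (auto simp: intervals_def)
    have tab: "(t, a) \<in> cells xs" "(t, b) \<in> cells xs" using t abn by (auto simp: cells_def)
    \<comment> \<open>All copies of an interval [a, b] without prolongation. At position (b, a) no
      arrow joins them to other summands, so the map would need a matrix entry that is 1 on these
      copies and 0 on the longest interval.\<close>
    define T where "T = {t. t < length xs \<and> xs ! t = (a, b)}"
    have "bicommuting (Tri n) (bar xs) (\<lambda>v (t, q). if q = b \<and> t \<in> T then v (t, a) else (0::'k))"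
    proof (rule bicommuting_component[OF xs])
      show "(t, a) \<in> cells xs \<and> (t, b) \<in> cells xs" if "t \<in> T" for t
        using that abn by (auto simp: T_def cells_def)
      fix t u assume arr: "arrow xs t u" and c: "(t, a) \<in> cells xs" "(u, b) \<in> cells xs"
      obtain a' b' c' d' where X: "xs ! t = (a', b')" "xs ! u = (c', d')" by (meson surj_pair)
      have len: "t < length xs" "u < length xs" using arr by (auto simp: arrow_def)
      have mem: "(a', b') \<in> set xs" "(c', d') \<in> set xs" using len X nth_mem by metis+
      have le: "c' \<le> a'" "a' \<le> d'" "d' \<le> b'" "a' \<le> a" "a \<le> b'" "c' \<le> b" "b \<le> d'"
        using arr c X by (auto simp: arrow_def cells_def)
      show "t \<in> T \<longleftrightarrow> u \<in> T"
      proof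
        assume "t \<in> T"
        hence "a' = a" "b' = b" using X by (auto simp: T_def)
        hence "d' = b" using le by simp
        moreover have "\<not> c' < a" using mem no \<open>d' = b\<close> by blast
        ultimately show "u \<in> T" using X len \<open>a' = a\<close> le by (auto simp: T_def)
      next
        assume "u \<in> T"
        hence "c' = a" "d' = b" using X by (auto simp: T_def)
        hence "a' = a" using le by simp
        moreover have "\<not> b < b'" using mem no \<open>a' = a\<close> by blast
        ultimately show "t \<in> T" using X len \<open>d' = b\<close> le by (auto simp: T_def)
      qed
    qed
    from surj[OF this] obtain A :: "'k mat" where A: "A \<in> carrier (Tri n)"
      "\<And>v. v \<in> carrier (bar xs) \<Longrightarrow> (\<lambda>(t, q). if q = b \<and> t \<in> T then v (t, a) else 0) = bar_act xs A v"
      by blast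
    have val: "A $$ (b, a) = (if s \<in> T then 1 else 0)" if "(s, a) \<in> cells xs" "(s, b) \<in> cells xs" for s
      using bar_act_Tri_delta[OF xs A(1) that, of 1] fun_cong[OF A(2)[OF delta_carrier[OF that(1)]], of 1 "(s, b)"]
      by (simp add: delta_def split: if_splits)
    have "t0 \<notin> T" using t0' ab(2) by (auto simp: T_def)
    moreover have "t \<in> T" using t by (simp add: T_def)
    ultimately show False using val[OF tab] val[OF top top] abn by simp
  qed
  have B: "(\<exists>b. (p, b) \<in> set xs) \<or> (\<exists>a. (a, p - 1) \<in> set xs)" if p: "1 \<le> p" "p < n" for p
  proof (rule ccontr)
    assume no: "\<not> ?thesis"
    \<comment> \<open>All summands through both vertices. As no interval starts at \<open>p\<close>
      or ends at \<open>p - 1\<close>, a summand containing one of them contains the other; the map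
      runs backwards from \<open>p\<close> to \<open>p - 1\<close> and would need a matrix entry
      above the diagonal.\<close>
    define T where "T = {t. (t, p) \<in> cells xs \<and> (t, p - 1) \<in> cells xs}"
    have "bicommuting (Tri n) (bar xs) (\<lambda>v (t, q). if q = p - 1 \<and> t \<in> T then v (t, p) else (0::'k))"
    proof (rule bicommuting_component[OF xs])
      show "(t, p) \<in> cells xs \<and> (t, p - 1) \<in> cells xs" if "t \<in> T" for t using that by (simp add: T_def)
      fix t u assume arr: "arrow xs t u" and c: "(t, p) \<in> cells xs" "(u, p - 1) \<in> cells xs"
      obtain a' b' c' d' where X: "xs ! t = (a', b')" "xs ! u = (c', d')" by (meson surj_pair)
      have len: "t < length xs" "u < length xs" using arr by (auto simp: arrow_def)
      have mem: "(a', b') \<in> set xs" "(c', d') \<in> set xs" using len X nth_mem by metis+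
      have "a' \<noteq> p" "d' \<noteq> p - 1" using no mem by blast+
      hence "(t, p - 1) \<in> cells xs" "(u, p) \<in> cells xs" using c X by (auto simp: cells_def)
      thus "t \<in> T \<longleftrightarrow> u \<in> T" using c by (simp add: T_def)
    qed
    from surj[OF this] obtain A :: "'k mat" where A: "A \<in> carrier (Tri n)"
      "\<And>v. v \<in> carrier (bar xs) \<Longrightarrow> (\<lambda>(t, q). if q = p - 1 \<and> t \<in> T then v (t, p) else 0) = bar_act xs A v"
      by blast
    have c: "(t0, p) \<in> cells xs" "(t0, p - 1) \<in> cells xs" using top p by auto
    have "A $$ (p - 1, p) = 1"
      using bar_act_Tri_delta[OF xs A(1) c, of 1] fun_cong[OF A(2)[OF delta_carrier[OF c(1)]], of 1 "(t0, p - 1)"] c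
      by (simp add: delta_def T_def)
    moreover have "A $$ (p - 1, p) = 0" using A(1) p by (simp add: Tri_carrier)
    ultimately show False by simp
  qed
  have "(0, n - 1) \<in> set xs" using t0' nth_mem by metis
  moreover have "\<forall>(a, b)\<in>set xs. (a, b) = (0, n - 1) \<or> (\<exists>c<a. (c, b) \<in> set xs) \<or> (\<exists>d>b. (a, d) \<in> set xs)"
  proof
    fix z assume z: "z \<in> set xs"
    obtain a b where "z = (a, b)" by (cases z)
    thus "case z of (a, b) \<Rightarrow> (a, b) = (0, n - 1) \<or> (\<exists>c<a. (c, b) \<in> set xs) \<or> (\<exists>d>b. (a, d) \<in> set xs)"
      using A[of a b] z by (simp only: prod.case) blast
  qed
  ultimately show ?thesis unfolding balanced_def using xs B by blast
qed

text \<open>The entries of a bicommuting map on the longest interval \<open>t0\<close> form the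
  required matrix. It has to be shown that every other summand has the same entries and that those
  above the diagonal vanish.\<close>

lemma balanced_imp_faithfully_balanced:
  assumes xs: "set xs \<subseteq> intervals n" and "n \<ge> 1" and bal: "balanced n (set xs)"
  shows "faithfully_balanced (Tri n) (bar xs :: ('k::field mat, _) module)"
proof -
  note lm = bar_left_module[OF xs, where 'k = 'k]
  have iv: "xs ! t \<in> intervals n" if "t < length xs" for t using xs that nth_mem by blast
  have A: "\<exists>u<length xs. (\<exists>c<fst (xs ! t). xs ! u = (c, snd (xs ! t))) \<or> (\<exists>d>snd (xs ! t). xs ! u = (fst (xs ! t), d))"
    if t: "t < length xs" "xs ! t \<noteq> (0, n - 1)" for t
  proof -
    obtain a b where X: "xs ! t = (a, b)" by (cases "xs ! t")
    have "(a, b) \<in> set xs" using t X nth_mem by metis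
    moreover have "\<forall>(a, b)\<in>set xs. (a, b) = (0, n - 1) \<or> (\<exists>c<a. (c, b) \<in> set xs) \<or> (\<exists>d>b. (a, d) \<in> set xs)"
      using bal unfolding balanced_def by blast
    ultimately have "(\<exists>c<a. (c, b) \<in> set xs) \<or> (\<exists>d>b. (a, d) \<in> set xs)" using t X by fastforce
    thus ?thesis unfolding X by (auto simp: in_set_conv_nth)
  qed
  have "(0, n - 1) \<in> set xs" using bal by (simp add: balanced_def)
  then obtain t0 where t0: "t0 < length xs" "xs ! t0 = (0, n - 1)" by (auto simp: in_set_conv_nth)
  have top: "(t0, p) \<in> cells xs" if "p < n" for p using that t0 by (auto simp: cells_def)
  show ?thesis
    unfolding faithfully_balanced_iff[OF lm] bar_simps
  proof (intro conjI ballI allI impI)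
    fix A B :: "'k mat"
    assume AB: "A \<in> carrier (Tri n)" "B \<in> carrier (Tri n)" and eq: "\<forall>v\<in>carrier (bar xs). bar_act xs A v = bar_act xs B v"
    have "A $$ (q, p) = B $$ (q, p)" if "q < n" "p < n" for q p
    proof -
      have "bar_act xs A (delta (t0, p) 1) (t0, q) = bar_act xs B (delta (t0, p) 1) (t0, q)"
        using eq delta_carrier[OF top[OF that(2)]] by metis
      thus ?thesis
        using bar_act_Tri_delta[OF xs AB(1) top top, of p q 1] bar_act_Tri_delta[OF xs AB(2) top top, of p q 1] that by simp
    qed
    thus "A = B" using AB by (intro eq_matI) (auto simp: Tri_carrier)
  next
    fix \<phi> :: "(nat \<times> nat \<Rightarrow> 'k) \<Rightarrow> nat \<times> nat \<Rightarrow> 'k"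
    assume \<phi>: "bicommuting (Tri n) (bar xs) \<phi>"
    have \<phi>c: "\<phi> v \<in> carrier (bar xs)" if "v \<in> carrier (bar xs)" for v
      using \<phi> that unfolding bicommuting_def by blast
    have \<phi>add: "\<phi> (v + w) = \<phi> v + \<phi> w" if "v \<in> carrier (bar xs)" "w \<in> carrier (bar xs)" for v w
      using \<phi> that unfolding bicommuting_def bar_simps by blast
    have \<phi>h: "\<phi> (h v) = h (\<phi> v)" if "lin (Tri n) (bar xs) (bar xs) h" "v \<in> carrier (bar xs)" for h v
      using \<phi> that unfolding bicommuting_def by blast
    have z: "0 \<in> carrier (bar xs :: ('k mat, _) module)" using left_module_ops(5)[OF lm] unfolding bar_simps .
    have \<phi>0: "\<phi> 0 = 0" using \<phi>add[OF z z] by simp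
    define \<Phi> where "\<Phi> = (\<lambda>t q p. \<phi> (delta (t, p) 1) (t, q))"
    \<comment> \<open>Commuting with the map of an arrow compares the entries at one position on
      both summands; an entry counts as zero where the summand misses one of the two
      vertices.\<close>
    have arr: "(if (u, p) \<in> cells xs then \<Phi> u q p else 0) = (if (t, q) \<in> cells xs then \<Phi> t q p else 0)"
      if tu: "arrow xs t u" "(t, p) \<in> cells xs" "(u, q) \<in> cells xs" for t u p q
    proof -
      have "\<phi> (arrow_map xs t u (delta (t, p) 1)) (u, q) = arrow_map xs t u (\<phi> (delta (t, p) 1)) (u, q)"
        using \<phi>h[OF arrow_map_lin[OF xs tu(1)] delta_carrier[OF tu(2)]] by metis
      moreover have "arrow_map xs t u (\<phi> (delta (t, p) 1)) (u, q) = (if (t, q) \<in> cells xs then \<Phi> t q p else 0)"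
        using tu by (simp add: arrow_map_def \<Phi>_def)
      moreover have "\<phi> (arrow_map xs t u (delta (t, p) 1)) (u, q) = (if (u, p) \<in> cells xs then \<Phi> u q p else 0)"
        using \<phi>0 by (simp only: arrow_map_delta[OF tu(2)] \<Phi>_def) simp
      ultimately show ?thesis by simp
    qed
    have same: "\<Phi> t q p = \<Phi> t0 q p" if "(t, p) \<in> cells xs" "(t, q) \<in> cells xs" for t q p
      using that
    proof (induction "n - (snd (xs ! t) - fst (xs ! t))" arbitrary: t rule: less_induct)
      case less
      have t: "t < length xs" using less.prems by (auto simp: cells_def)
      show ?case
      proof (cases "xs ! t = (0, n - 1)")
        case True
        hence "arrow xs t t0" using t t0 by (simp add: arrow_def)
        moreover have "p < n" "q < n" using less.prems cells_lt[OF xs] by blast+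
        ultimately show ?thesis using arr[of t t0 p q] less.prems top by simp
      next
        case False
        obtain a b where X: "xs ! t = (a, b)" by (cases "xs ! t")
        have ab: "a \<le> b" "b < n" using iv[OF t] X by (auto simp: intervals_def)
        obtain u where u: "u < length xs" "(\<exists>c<a. xs ! u = (c, b)) \<or> (\<exists>d>b. xs ! u = (a, d))"
          using A[OF t False] X by auto
        have X': "snd (xs ! u) < n" using iv[OF u(1)] by (auto simp: intervals_def)
        have c: "(u, p) \<in> cells xs" "(u, q) \<in> cells xs" using less.prems u X by (auto simp: cells_def)
        have "n - (snd (xs ! u) - fst (xs ! u)) < n - (snd (xs ! t) - fst (xs ! t))"
          using u X X' ab by auto
        hence IH: "\<Phi> u q p = \<Phi> t0 q p" using less.hyps c by blast
        \<comment> \<open>Prolongation on the left gives an arrow to the longer interval,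
          prolongation on the right an arrow from it.\<close>
        have "arrow xs t u \<or> arrow xs u t" using u t X ab by (auto simp: arrow_def)
        thus ?thesis using arr[of t u p q] arr[of u t p q] c less.prems IH by auto
      qed
    qed
    \<comment> \<open>The cases are: the interval contains p but not q, it contains q but not p, or
      it lies beyond q and ends just before p. Under prolongation the third case never gains both
      vertices at once, so some step leads from exactly one of them to both. The arrow of that step
      compares the entry with a missing one, which makes it zero.\<close>
    have lower: "\<Phi> t0 q p = 0"
      if "t < length xs" "q < p" "p < n"
        "q < fst (xs ! t) \<and> fst (xs ! t) \<le> p \<and> p \<le> snd (xs ! t) \<or>
         fst (xs ! t) \<le> q \<and> q \<le> snd (xs ! t) \<and> snd (xs ! t) < p \<or>
         q < fst (xs ! t) \<and> Suc (snd (xs ! t)) = p" for t q p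
      using that
    proof (induction "n - (snd (xs ! t) - fst (xs ! t))" arbitrary: t rule: less_induct)
      case less
      obtain a b where X: "xs ! t = (a, b)" by (cases "xs ! t")
      have ab: "a \<le> b" "b < n" using iv[OF less.prems(1)] X by (auto simp: intervals_def)
      have cs: "q < a \<and> a \<le> p \<and> p \<le> b \<or> a \<le> q \<and> q \<le> b \<and> b < p \<or> q < a \<and> Suc b = p"
        using less.prems(4) X by simp
      hence "xs ! t \<noteq> (0, n - 1)" using X less.prems by auto
      then obtain u where u: "u < length xs" "(\<exists>c<a. xs ! u = (c, b)) \<or> (\<exists>d>b. xs ! u = (a, d))"
        using A[OF less.prems(1)] X by auto
      have X': "snd (xs ! u) < n" using iv[OF u(1)] by (auto simp: intervals_def)
      have "n - (snd (xs ! u) - fst (xs ! u)) < n - (snd (xs ! t) - fst (xs ! t))"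
        using u X X' ab by auto
      note IH = less.hyps[OF this u(1) less.prems(2,3)]
      from u(2) show ?case
      proof
        assume "\<exists>c<a. xs ! u = (c, b)"
        then obtain c where c: "c < a" "xs ! u = (c, b)" by blast
        show ?thesis
        proof (cases "q < a \<and> a \<le> p \<and> p \<le> b \<and> c \<le> q")
          case True
          hence mem: "(t, p) \<in> cells xs" "(t, q) \<notin> cells xs" "(u, p) \<in> cells xs" "(u, q) \<in> cells xs"
            using X c u less.prems by (auto simp: cells_def)
          have "arrow xs t u" using c X u less.prems ab by (auto simp: arrow_def)
          hence "\<Phi> u q p = 0" using arr[of t u p q] mem by simp
          thus ?thesis using same mem by simp
        next
          case False
          thus ?thesis using cs c ab by (intro IH) auto
        qed
      next
        assume "\<exists>d>b. xs ! u = (a, d)"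
        then obtain d where d: "b < d" "xs ! u = (a, d)" by blast
        show ?thesis
        proof (cases "a \<le> q \<and> q \<le> b \<and> b < p \<and> p \<le> d")
          case True
          hence mem: "(u, p) \<in> cells xs" "(t, q) \<in> cells xs" "(t, p) \<notin> cells xs" "(u, q) \<in> cells xs"
            using X d u less.prems by (auto simp: cells_def)
          have "arrow xs u t" using d X u less.prems ab by (auto simp: arrow_def)
          hence "\<Phi> u q p = 0" using arr[of u t p q] mem by simp
          thus ?thesis using same mem by simp
        next
          case False
          thus ?thesis using cs d ab by (intro IH) auto
        qed
      qed
    qed
    \<comment> \<open>An interval starting at \<open>p\<close> contains \<open>p\<close> but not
      \<open>q\<close>. One ending at \<open>p - 1\<close> either contains \<open>q\<close> but not
      \<open>p\<close>, or starts beyond \<open>q\<close> and ends just before \<open>p\<close>. So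
      \<open>lower\<close> always applies.\<close>
    have upper_zero: "\<Phi> t0 q p = 0" if qp: "q < p" "p < n" for q p
    proof -
      have "(\<exists>b. (p, b) \<in> set xs) \<or> (\<exists>a. (a, p - 1) \<in> set xs)"
        using bal qp unfolding balanced_def by simp
      then obtain t where t: "t < length xs" "(\<exists>b. xs ! t = (p, b)) \<or> (\<exists>a. xs ! t = (a, p - 1))"
        by (auto simp: in_set_conv_nth)
      have "fst (xs ! t) \<le> snd (xs ! t)" using iv[OF t(1)] by (auto simp: intervals_def)
      thus ?thesis using t qp by (intro lower[OF t(1) qp]) auto
    qed
    define A where "A = mat n n (\<lambda>(q, p). \<Phi> t0 q p)"
    have Ac: "A \<in> carrier (Tri n)" using upper_zero by (auto simp: A_def Tri_carrier)
    have delta: "\<phi> (delta (t, p) c) = bar_act xs A (delta (t, p) c)" if tp: "(t, p) \<in> cells xs" for t p c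
    proof (rule ext, clarify)
      fix u q
      have t: "t < length xs" using tp by (auto simp: cells_def)
      have sc: "\<phi> (delta (t, p) c) = fscale c (\<phi> (delta (t, p) 1))"
      proof -
        have "delta (t, p) c = fscale c (delta (t, p) 1)" by (auto simp: delta_def fun_eq_iff)
        thus ?thesis using \<phi>h[OF scale_lin[OF xs] delta_carrier[OF tp], of c 1] by metis
      qed
      \<comment> \<open>The arrow from \<open>t\<close> to itself is the projection onto the
        \<open>t\<close>-th summand, so \<open>\<phi>\<close> preserves every summand.\<close>
      have "arrow xs t t" using t tp by (auto simp: arrow_def cells_def)
      hence "\<phi> (arrow_map xs t t (delta (t, p) 1)) = arrow_map xs t t (\<phi> (delta (t, p) 1))"
        using \<phi>h[OF arrow_map_lin[OF xs] delta_carrier[OF tp]] by blast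
      hence proj: "\<phi> (delta (t, p) 1) = arrow_map xs t t (\<phi> (delta (t, p) 1))"
        using tp by (simp only: arrow_map_delta[OF tp] if_True)
      show "\<phi> (delta (t, p) c) (u, q) = bar_act xs A (delta (t, p) c) (u, q)"
      proof (cases "u = t \<and> (t, q) \<in> cells xs")
        case True
        have "\<phi> (delta (t, p) c) (t, q) = c * \<Phi> t q p" using sc by (simp add: \<Phi>_def)
        also have "\<Phi> t q p = A $$ (q, p)"
          using same[OF tp] True cells_lt[OF xs tp] cells_lt[OF xs, of t q] by (simp add: A_def)
        finally show ?thesis using bar_act_Tri_delta[OF xs Ac tp, of q c] True by (simp add: mult.commute)
      next
        case False
        have "\<phi> (delta (t, p) 1) (u, q) = 0" by (subst proj) (use False in \<open>auto simp: arrow_map_def\<close>)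
        moreover have "bar_act xs A (delta (t, p) c) (u, q) = 0"
          using False by (auto simp: bar_act_def delta_def intro!: sum.neutral)
        ultimately show ?thesis using sc by simp
      qed
    qed
    have "\<phi> v = bar_act xs A v" if "v \<in> carrier (bar xs)" for v
      using that
    proof (induction v rule: bar_induct)
      case zero
      have "bar_act xs A 0 = 0" using left_module.smult_zero_right[OF lm Ac] unfolding bar_simps .
      thus ?case using \<phi>0 by metis
    next
      case (add v z c)
      have "\<phi> (v + delta z c) = \<phi> v + \<phi> (delta z c)" using \<phi>add add.hyps delta_carrier by blast
      also have "\<dots> = bar_act xs A v + bar_act xs A (delta z c)" using add.IH add.hyps delta by (cases z) simp
      also have "\<dots> = bar_act xs A (v + delta z c)"
        using left_module.smult_r_distr[OF lm Ac add.hyps(1) delta_carrier[OF add.hyps(2)]] unfolding bar_simps by simp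
      finally show ?case .
    qed
    thus "\<exists>A\<in>carrier (Tri n). \<forall>v\<in>carrier (bar xs). \<phi> v = bar_act xs A v" using Ac by blast
  qed
qed

section \<open>Isomorphism classes\<close>

text \<open>\<open>THE\<close> is justified by \<open>barcode_eqI\<close>. The carrier type is left
  open because barcodes are taken of \<open>tri_module\<close>s and also of their direct sums, which
  have another type.\<close>

definition barcode :: "nat \<Rightarrow> ('k::field mat, 'm) module \<Rightarrow> (nat \<times> nat) multiset" where
  "barcode n M = (THE X. \<exists>xs. set xs \<subseteq> intervals n \<and> mod_iso (Tri n) M (bar xs) \<and> mset xs = X)"

lemma fg_left_module: "fg_module R M \<Longrightarrow> left_module R M"
  by (simp add: fg_module_def)

lemma barcode_eqI:
  fixes M :: "('k::field mat, 'm) module"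
  assumes M: "left_module (Tri n) M" and xs: "set xs \<subseteq> intervals n" and iso: "mod_iso (Tri n) M (bar xs)"
  shows "barcode n M = mset xs"
  unfolding barcode_def
proof (rule the_equality)
  show "\<exists>ys. set ys \<subseteq> intervals n \<and> mod_iso (Tri n) M (bar ys) \<and> mset ys = mset xs"
    using xs iso by blast
  fix X assume "\<exists>ys. set ys \<subseteq> intervals n \<and> mod_iso (Tri n) M (bar ys) \<and> mset ys = X"
  then obtain ys where ys: "set ys \<subseteq> intervals n" "mod_iso (Tri n) M (bar ys)" "mset ys = X" by blast
  have "mod_iso (Tri n) (bar ys) M" by (rule mod_iso_sym[OF M bar_left_module[OF ys(1)] ys(2)])
  hence "mod_iso (Tri n) (bar ys :: ('k mat, _) module) (bar xs)" by (rule mod_iso_trans[OF bar_left_module[OF ys(1)] M _ iso])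
  thus "X = mset xs" using bar_iso_iff[OF ys(1) xs, where 'k = 'k] ys(3) by simp
qed

lemma barcodeE:
  fixes M :: "('k::field mat, 'm) module"
  assumes "fg_module (Tri n) M"
  obtains xs where "set xs \<subseteq> intervals n" "mod_iso (Tri n) M (bar xs)" "barcode n M = mset xs"
  using interval_decomposition[OF assms] barcode_eqI[OF fg_left_module[OF assms]] by metis

lemma mod_iso_iff_barcode:
  fixes M :: "('k::field mat, 'm) module" and N :: "('k mat, 'p) module"
  assumes M: "fg_module (Tri n) M" and N: "fg_module (Tri n) N"
  shows "mod_iso (Tri n) M N \<longleftrightarrow> barcode n M = barcode n N"
proof -
  note lM = fg_left_module[OF M] and lN = fg_left_module[OF N]
  obtain xs where xs: "set xs \<subseteq> intervals n" "mod_iso (Tri n) M (bar xs)" "barcode n M = mset xs"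
    by (rule barcodeE[OF M])
  obtain ys where ys: "set ys \<subseteq> intervals n" "mod_iso (Tri n) N (bar ys)" "barcode n N = mset ys"
    by (rule barcodeE[OF N])
  show ?thesis
  proof
    assume "mod_iso (Tri n) M N"
    hence "mod_iso (Tri n) M (bar ys)" by (rule mod_iso_trans[OF lM lN _ ys(2)])
    thus "barcode n M = barcode n N" using barcode_eqI[OF lM ys(1)] ys(3) by simp
  next
    assume "barcode n M = barcode n N"
    hence "mod_iso (Tri n) (bar xs :: ('k mat, _) module) (bar ys)" using bar_iso_iff[OF xs(1) ys(1)] xs(3) ys(3) by simp
    hence "mod_iso (Tri n) M (bar ys)" by (rule mod_iso_trans[OF lM bar_left_module[OF xs(1)] xs(2)])
    thus "mod_iso (Tri n) M N"
      by (rule mod_iso_trans[OF lM bar_left_module[OF ys(1)] _ mod_iso_sym[OF lN bar_left_module[OF ys(1)] ys(2)]])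
  qed
qed

lemma fg_module_mod_iso:
  assumes "fg_module R M" "left_module R N" "mod_iso R M N"
  shows "fg_module R N"
  using assms fg_module_iso mod_iso_iff[OF fg_left_module[OF assms(1)]] by blast

lemma indecomposable_mod_iso:
  assumes "left_module R M" "left_module R N" "mod_iso R M N" "indecomposable R M"
  shows "indecomposable R N"
  using assms indecomposable_iso mod_iso_iff[OF assms(1)] by blast

lemma faithfully_balanced_mod_iso:
  assumes "left_module R M" "left_module R N" "mod_iso R M N"
  shows "faithfully_balanced R M \<longleftrightarrow> faithfully_balanced R N"
  using assms faithfully_balanced_iso mod_iso_iff mod_iso_sym by metis

text \<open>\<open>prod_decode\<close> numbers the coordinates \<open>(t, p)\<close> by natural
  numbers, which places every barcode among the modules of type \<open>tri_module\<close>.\<close>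

lemma exists_tri_module:
  assumes xs: "set xs \<subseteq> intervals n"
  obtains M :: "'k::field tri_module" where "fg_module (Tri n) M" "mod_iso (Tri n) M (bar xs)"
proof -
  note lm = bar_left_module[OF xs, where 'k = 'k]
  let ?h = "\<lambda>(v :: nat \<times> nat \<Rightarrow> 'k) i. v (prod_decode i)"
  have "inj_on ?h (carrier (bar xs))"
    by (rule inj_onI) (metis ext prod_encode_inverse)
  then obtain M :: "'k tri_module" where M: "left_module (Tri n) M" "lin_iso (Tri n) (bar xs) M ?h"
    by (rule left_module_transport[OF lm])
  have "mod_iso (Tri n) (bar xs) M" using M(2) mod_iso_iff[OF lm] by blast
  hence "fg_module (Tri n) M" "mod_iso (Tri n) M (bar xs)"
    using fg_module_mod_iso[OF bar_fg[OF xs] M(1)] mod_iso_sym[OF lm M(1)] by blast+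
  thus ?thesis by (rule that)
qed

lemma indecomposable_interval:
  fixes M :: "('k::field mat, 'm) module"
  assumes M: "fg_module (Tri n) M" and ind: "indecomposable (Tri n) M"
  obtains y where "y \<in> intervals n" "mod_iso (Tri n) M (bar [y])"
proof -
  obtain xs where xs: "set xs \<subseteq> intervals n" "mod_iso (Tri n) M (bar xs)"
    by (rule interval_decomposition[OF M])
  have "indecomposable (Tri n) (bar xs :: ('k mat, _) module)"
    by (rule indecomposable_mod_iso[OF fg_left_module[OF M] bar_left_module[OF xs(1)] xs(2) ind])
  hence "length xs = 1" by (rule bar_indecomposable_length[OF xs(1)])
  then obtain y where "xs = [y]" by (cases xs) auto
  thus ?thesis using that xs by simp
qed

lemma direct_sum_intervals_iso:
  fixes X :: "'i \<Rightarrow> ('k::field mat, 'm) module"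
  assumes fin: "finite I" and \<sigma>: "bij_betw \<sigma> I {..<length ys}" and ys: "set ys \<subseteq> intervals n"
    and X: "\<And>i. i \<in> I \<Longrightarrow> left_module (Tri n) (X i)" "\<And>i. i \<in> I \<Longrightarrow> mod_iso (Tri n) (X i) (bar [ys ! \<sigma> i])"
  shows "left_module (Tri n) (direct_sum I X)" "mod_iso (Tri n) (direct_sum I X) (bar ys)"
proof -
  have yt: "set [ys ! t] \<subseteq> intervals n" if "t \<in> {..<length ys}" for t using ys that nth_mem by fastforce
  show l: "left_module (Tri n) (direct_sum I X)" by (rule direct_sum_left_module[OF Tri_ring fin X(1)])
  let ?D = "direct_sum {..<length ys} (\<lambda>t. bar [ys ! t] :: ('k mat, _) module)"
  have l': "left_module (Tri n) ?D"
    by (rule direct_sum_left_module[OF Tri_ring]) (use bar_left_module[OF yt] in simp_all)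
  have 1: "mod_iso (Tri n) (direct_sum I X) ?D"
    by (rule direct_sum_iso[OF Tri_ring fin \<sigma>]) (use X bar_left_module[OF yt] in simp_all)
  have 2: "mod_iso (Tri n) ?D (bar ys)"
    by (rule mod_iso_sym[OF bar_left_module[OF ys] l' bar_direct_sum_iso[OF ys]])
  show "mod_iso (Tri n) (direct_sum I X) (bar ys)" by (rule mod_iso_trans[OF l l' 1 2])
qed

text \<open>The Krull-Schmidt theorem for these algebras: every decomposition lists the barcode, so
  the number of summands and their multiplicities depend on the module only.\<close>

lemma indec_decomposition_barcode:
  fixes M :: "('k::field mat, 'm) module"
  assumes M: "fg_module (Tri n) M" and dec: "indec_decomposition (Tri n) M s X"
  obtains ys where "length ys = s" "barcode n M = mset ys"
    "\<And>i. i < s \<Longrightarrow> multiplicity_in (Tri n) s X i = count (mset ys) (ys ! i)"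
proof -
  have X: "fg_module (Tri n) (X i)" "indecomposable (Tri n) (X i)" if "i < s" for i
    using dec that by (auto simp: indec_decomposition_def)
  have "\<forall>i\<in>{..<s}. \<exists>y. y \<in> intervals n \<and> mod_iso (Tri n) (X i) (bar [y])"
    using indecomposable_interval[OF X] by (metis lessThan_iff)
  then obtain y where y: "\<And>i. i < s \<Longrightarrow> y i \<in> intervals n"
    "\<And>i. i < s \<Longrightarrow> mod_iso (Tri n) (X i) (bar [y i])" by (metis lessThan_iff)
  define ys where "ys = map y [0..<s]"
  have len: "length ys = s" and nth: "\<And>i. i < s \<Longrightarrow> ys ! i = y i" by (simp_all add: ys_def)
  have ys: "set ys \<subseteq> intervals n" using y(1) by (auto simp: ys_def)
  have bij: "bij_betw (\<lambda>i. i) {..<s} {..<length ys}" using len by (simp add: bij_betw_def)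
  have lX: "left_module (Tri n) (X i)" and iX: "mod_iso (Tri n) (X i) (bar [ys ! i])" if "i \<in> {..<s}" for i
    using that y(2)[of i] nth[of i] fg_left_module[OF X(1), of i] by simp_all
  have D: "left_module (Tri n) (direct_sum {..<s} X)" "mod_iso (Tri n) (direct_sum {..<s} X) (bar ys)"
    using direct_sum_intervals_iso[OF finite_lessThan bij ys, of X] lX iX by blast+
  have "mod_iso (Tri n) M (direct_sum {..<s} X)" using dec by (simp add: indec_decomposition_def)
  hence "mod_iso (Tri n) M (bar ys)" by (rule mod_iso_trans[OF fg_left_module[OF M] D(1) _ D(2)])
  hence bc: "barcode n M = mset ys" by (rule barcode_eqI[OF fg_left_module[OF M] ys])
  have bX: "barcode n (X i) = {#y i#}" if "i < s" for i
    using barcode_eqI[OF fg_left_module[OF X(1)[OF that]] _ y(2)[OF that]] y(1)[OF that] by simp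
  have "multiplicity_in (Tri n) s X i = count (mset ys) (ys ! i)" if i: "i < s" for i
  proof -
    have "{j \<in> {..<s}. mod_iso (Tri n) (X j) (X i)} = {j. j < length ys \<and> ys ! i = ys ! j}"
      using i len nth bX mod_iso_iff_barcode[OF X(1) X(1)] by auto
    thus ?thesis unfolding multiplicity_in_def count_mset count_list_eq_length_filter length_filter_conv_card
      by simp
  qed
  thus ?thesis using that len bc by blast
qed

text \<open>The summands must have the type of \<open>M\<close>, so they are realized inside
  \<open>M\<close> as images of the summands of \<open>bar ys\<close>.\<close>

lemma exists_indec_decomposition:
  fixes M :: "('k::field mat, 'm) module"
  assumes M: "fg_module (Tri n) M"
  obtains X where "indec_decomposition (Tri n) M (size (barcode n M)) X"
proof -
  obtain ys where ys: "set ys \<subseteq> intervals n" "mod_iso (Tri n) M (bar ys)" "barcode n M = mset ys"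
    by (rule barcodeE[OF M])
  note lM = fg_left_module[OF M] and lm = bar_left_module[OF ys(1), where 'k = 'k]
  obtain g where g: "lin_iso (Tri n) (bar ys) M g"
    using mod_iso_sym[OF lM lm ys(2)] mod_iso_iff[OF lm] by blast
  hence injg: "inj_on g (carrier (bar ys))" by (auto simp: lin_iso_def bij_betw_def)
  have yt: "set [ys ! t] \<subseteq> intervals n" if "t < length ys" for t using ys that nth_mem by fastforce
  have "\<exists>N :: ('k mat, 'm) module. left_module (Tri n) N \<and> mod_iso (Tri n) (bar [ys ! t]) N"
    if t: "t < length ys" for t
  proof -
    \<comment> \<open>Places a vector of the single interval module into the \<open>t\<close>-th
      summand of \<open>bar ys\<close>.\<close>
    let ?e = "\<lambda>v (s, p). if s = t then v (0, p) else (0::'k)"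
    have ec: "?e v \<in> carrier (bar ys)" if "v \<in> carrier (bar [ys ! t])" for v
      using that t by (auto simp: bar_carrier cells_def)
    have "inj_on ?e (carrier (bar [ys ! t]))"
    proof (rule inj_onI)
      fix v w :: "nat \<times> nat \<Rightarrow> 'k"
      assume vw: "v \<in> carrier (bar [ys ! t])" "w \<in> carrier (bar [ys ! t])" "?e v = ?e w"
      show "v = w"
      proof (rule ext, clarify)
        fix s p
        show "v (s, p) = w (s, p)"
        proof (cases s)
          case 0 thus ?thesis using fun_cong[OF vw(3), of "(t, p)"] by simp
        next
          case (Suc s')
          hence "(s, p) \<notin> cells [ys ! t]" by (simp add: cells_def)
          thus ?thesis using vw(1,2) unfolding bar_carrier by metis
        qed
      qed
    qed
    hence "inj_on (\<lambda>v. g (?e v)) (carrier (bar [ys ! t]))"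
      using injg ec unfolding inj_on_def by meson
    then obtain N :: "('k mat, 'm) module" where
      "left_module (Tri n) N" "lin_iso (Tri n) (bar [ys ! t]) N (\<lambda>v. g (?e v))"
      by (rule left_module_transport[OF bar_left_module[OF yt[OF t]]])
    thus ?thesis using mod_iso_iff[OF bar_left_module[OF yt[OF t]]] by blast
  qed
  then obtain X :: "nat \<Rightarrow> ('k mat, 'm) module" where
    X: "\<And>t. t < length ys \<Longrightarrow> left_module (Tri n) (X t)"
      "\<And>t. t < length ys \<Longrightarrow> mod_iso (Tri n) (bar [ys ! t]) (X t)" by metis
  have iX: "mod_iso (Tri n) (X t) (bar [ys ! t])" if "t < length ys" for t
    by (rule mod_iso_sym[OF bar_left_module[OF yt[OF that]] X(1)[OF that] X(2)[OF that]])
  have bij: "bij_betw (\<lambda>i. i) {..<length ys} {..<length ys}" by (simp add: bij_betw_def)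
  have D: "left_module (Tri n) (direct_sum {..<length ys} X)" "mod_iso (Tri n) (direct_sum {..<length ys} X) (bar ys)"
    using direct_sum_intervals_iso[OF finite_lessThan bij ys(1), of X] X(1) iX by simp_all
  have "mod_iso (Tri n) M (direct_sum {..<length ys} X)"
    by (rule mod_iso_trans[OF lM lm ys(2) mod_iso_sym[OF D(1) lm D(2)]])
  moreover have "fg_module (Tri n) (X t)" if "t < length ys" for t
    by (rule fg_module_mod_iso[OF bar_fg[OF yt[OF that]] X(1)[OF that] X(2)[OF that]])
  moreover have "indecomposable (Tri n) (X t)" if t: "t < length ys" for t
  proof (rule indecomposable_mod_iso[OF bar_left_module[OF yt[OF t]] X(1)[OF t] X(2)[OF t]])
    have "(fst (ys ! t), snd (ys ! t)) \<in> intervals n" using yt[OF t] by simp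
    from bar_indecomposable[OF this] show "indecomposable (Tri n) (bar [ys ! t] :: ('k mat, _) module)" by simp
  qed
  ultimately have "indec_decomposition (Tri n) M (length ys) X" by (simp add: indec_decomposition_def)
  thus ?thesis using that ys(3) by simp
qed

lemma has_num_summands_iff:
  fixes M :: "('k::field mat, 'm) module"
  assumes "fg_module (Tri n) M"
  shows "has_num_summands (Tri n) M s \<longleftrightarrow> size (barcode n M) = s"
  unfolding has_num_summands_def
  using indec_decomposition_barcode[OF assms] exists_indec_decomposition[OF assms] by (metis size_mset)

text \<open>The definition asks for one suitable decomposition; all decompositions have the
  multiplicities of the barcode, so it does not matter which one is taken.\<close>

lemma multiplicities_at_most_iff:
  fixes M :: "('k::field mat, 'm) module"
  assumes M: "fg_module (Tri n) M"
  shows "multiplicities_at_most (Tri n) m M \<longleftrightarrow> (\<forall>x. count (barcode n M) x \<le> m)"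
proof -
  have *: "(\<forall>i<s. multiplicity_in (Tri n) s X i \<le> m) \<longleftrightarrow> (\<forall>x. count (barcode n M) x \<le> m)"
    if dec: "indec_decomposition (Tri n) M s X" for s X
  proof -
    obtain ys where ys: "length ys = s" "barcode n M = mset ys"
      "\<And>i. i < s \<Longrightarrow> multiplicity_in (Tri n) s X i = count (mset ys) (ys ! i)"
      by (rule indec_decomposition_barcode[OF M dec]) (use that in blast)
    have le: "count (mset ys) x \<le> m" if "\<forall>i<s. count (mset ys) (ys ! i) \<le> m" for x
    proof (cases "x \<in> set ys")
      case True
      thus ?thesis using that ys(1) by (auto simp: in_set_conv_nth)
    next
      case False
      hence "count (mset ys) x = 0" by (simp add: count_eq_zero_iff)
      thus ?thesis by linarith
    qed
    have "(\<forall>i<s. multiplicity_in (Tri n) s X i \<le> m) \<longleftrightarrow> (\<forall>i<s. count (mset ys) (ys ! i) \<le> m)"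
      using ys(3) by simp
    thus ?thesis unfolding ys(2) using le by blast
  qed
  obtain X where "indec_decomposition (Tri n) M (size (barcode n M)) X"
    by (rule exists_indec_decomposition[OF M])
  thus ?thesis unfolding multiplicities_at_most_def using * by blast
qed

text \<open>Each listed summand counts itself, so its multiplicity is 1 as soon as it is at most
  1.\<close>

lemma basic_iff:
  fixes M :: "('k::field mat, 'm) module"
  assumes M: "fg_module (Tri n) M"
  shows "basic (Tri n) M \<longleftrightarrow> (\<forall>x. count (barcode n M) x \<le> 1)"
proof -
  have "multiplicity_in (Tri n) s X i = 1 \<longleftrightarrow> multiplicity_in (Tri n) s X i \<le> 1"
    if dec: "indec_decomposition (Tri n) M s X" and i: "i < s" for s X i
  proof -
    obtain ys where ys: "length ys = s" "barcode n M = mset ys"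
      "\<And>i. i < s \<Longrightarrow> multiplicity_in (Tri n) s X i = count (mset ys) (ys ! i)"
      by (rule indec_decomposition_barcode[OF M dec]) (use that in blast)
    have "ys ! i \<in># mset ys" using i ys(1) by simp
    hence "count (mset ys) (ys ! i) \<noteq> 0" by (simp add: count_eq_zero_iff)
    thus ?thesis using ys(3)[OF i] by linarith
  qed
  thus ?thesis unfolding multiplicities_at_most_iff[OF M, symmetric] basic_def multiplicities_at_most_def by blast
qed

lemma faithfully_balanced_iff_balanced:
  fixes M :: "('k::field mat, 'm) module"
  assumes M: "fg_module (Tri n) M" and "n \<ge> 1"
  shows "faithfully_balanced (Tri n) M \<longleftrightarrow> balanced n (set_mset (barcode n M))"
proof -
  obtain ys where ys: "set ys \<subseteq> intervals n" "mod_iso (Tri n) M (bar ys)" "barcode n M = mset ys"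
    by (rule barcodeE[OF M])
  have "faithfully_balanced (Tri n) M \<longleftrightarrow> faithfully_balanced (Tri n) (bar ys :: ('k mat, _) module)"
    by (rule faithfully_balanced_mod_iso[OF fg_left_module[OF M] bar_left_module[OF ys(1)] ys(2)])
  also have "\<dots> \<longleftrightarrow> balanced n (set ys)"
    using faithfully_balanced_imp_balanced[OF ys(1) assms(2)] balanced_imp_faithfully_balanced[OF ys(1) assms(2)] by blast
  finally show ?thesis using ys(3) by simp
qed

section \<open>Counting isomorphism classes by barcodes\<close>

lemma card_quotient_kernel:
  "card (A // {(x, y). x \<in> A \<and> y \<in> A \<and> f x = f y}) = card (f ` A)"
proof -
  let ?r = "{(x, y). x \<in> A \<and> y \<in> A \<and> f x = f y}"
  have im: "?r `` {x} = {y \<in> A. f y = f x}" if "x \<in> A" for x using that by auto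
  have "A // ?r = (\<lambda>x. ?r `` {x}) ` A" by (auto simp: quotient_def)
  also have "\<dots> = (\<lambda>x. {y \<in> A. f y = f x}) ` A" by (rule image_cong[OF refl im])
  also have "\<dots> = (\<lambda>z. {y \<in> A. f y = z}) ` f ` A" by (simp add: image_image)
  finally have "A // ?r = (\<lambda>z. {y \<in> A. f y = z}) ` f ` A" .
  moreover have "inj_on (\<lambda>z. {y \<in> A. f y = z}) (f ` A)" by (rule inj_onI) blast
  ultimately show ?thesis by (simp add: card_image)
qed

text \<open>Barcodes separate isomorphism classes, and \<open>exists_tri_module\<close> realizes
  every multiset of intervals.\<close>

lemma num_iso_classes_barcode:
  fixes P :: "(nat \<times> nat) multiset \<Rightarrow> bool"
  shows "num_iso_classes (Tri n) {M \<in> tri_modules TYPE('k::field) n. P (barcode n M)} =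
    card {X. set_mset X \<subseteq> intervals n \<and> P X}"
proof -
  let ?A = "{M \<in> tri_modules TYPE('k) n. P (barcode n M)}"
  have fg: "fg_module (Tri n) M" if "M \<in> ?A" for M using that by (simp add: tri_modules_def)
  have "{(M, N). M \<in> ?A \<and> N \<in> ?A \<and> mod_iso (Tri n) M N} = {(M, N). M \<in> ?A \<and> N \<in> ?A \<and> barcode n M = barcode n N}"
    using mod_iso_iff_barcode fg by blast
  hence "num_iso_classes (Tri n) ?A = card (barcode n ` ?A)"
    unfolding num_iso_classes_def by (simp only: card_quotient_kernel)
  also have "barcode n ` ?A = {X. set_mset X \<subseteq> intervals n \<and> P X}"
  proof
    show "barcode n ` ?A \<subseteq> {X. set_mset X \<subseteq> intervals n \<and> P X}"
    proof
      fix X assume "X \<in> barcode n ` ?A"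
      then obtain M where M: "M \<in> ?A" "X = barcode n M" by blast
      obtain ys where "set ys \<subseteq> intervals n" "barcode n M = mset ys"
        using barcodeE[OF fg[OF M(1)]] by metis
      thus "X \<in> {X. set_mset X \<subseteq> intervals n \<and> P X}" using M by simp
    qed
    show "{X. set_mset X \<subseteq> intervals n \<and> P X} \<subseteq> barcode n ` ?A"
    proof
      fix X assume X: "X \<in> {X. set_mset X \<subseteq> intervals n \<and> P X}"
      obtain xs where xs: "mset xs = X" using ex_mset by blast
      hence sub: "set xs \<subseteq> intervals n" using X by auto
      obtain M :: "'k tri_module" where M: "fg_module (Tri n) M" "mod_iso (Tri n) M (bar xs)"
        by (rule exists_tri_module[OF sub])
      have "barcode n M = X" using barcode_eqI[OF fg_left_module[OF M(1)] sub M(2)] xs by simp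
      moreover from this have "M \<in> ?A" using X M(1) by (simp add: tri_modules_def)
      ultimately show "X \<in> barcode n ` ?A" by blast
    qed
  qed
  finally show ?thesis .
qed

lemma balanced_subset: "balanced n S \<Longrightarrow> S \<subseteq> intervals n"
  by (simp add: balanced_def)

lemma finite_balanced: "finite {S. balanced n S}"
  by (rule finite_subset[of _ "Pow (intervals n)"]) (auto simp: finite_intervals dest: balanced_subset)

lemma mset_set_set_mset_eq:
  assumes "\<forall>x. count X x \<le> 1" shows "mset_set (set_mset X) = X"
proof (rule multiset_eqI)
  fix x
  have "count X x = (if x \<in># X then 1 else 0)"
    using assms[rule_format, of x] count_greater_zero_iff[of X x]
    by (cases "x \<in># X"; simp only: if_True if_False; linarith)
  thus "count (mset_set (set_mset X)) x = count X x" by (simp add: count_mset_set')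
qed

lemma card_multiplicity_free:
  assumes "\<And>S. Q S \<Longrightarrow> finite S"
  shows "card {X. Q (set_mset X) \<and> (\<forall>x. count X x \<le> 1)} = card {S. Q S}"
proof (rule bij_betw_same_card)
  show "bij_betw set_mset {X. Q (set_mset X) \<and> (\<forall>x. count X x \<le> 1)} {S. Q S}"
    by (rule bij_betw_byWitness[where f' = mset_set])
      (use assms in \<open>auto simp: mset_set_set_mset_eq count_mset_set'\<close>)
qed

text \<open>The elements of the support choose their multiplicities from 1 to m
  independently.\<close>

lemma card_multisets_with_support:
  assumes "finite S"
  shows "card {X. set_mset X = S \<and> (\<forall>x. count X x \<le> m)} = m ^ card S"
proof -
  have cnt: "count (\<Sum>x\<in>S. replicate_mset (f x) x) y = (if y \<in> S then f y else 0)" for f :: "'a \<Rightarrow> nat" and y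
  proof -
    have "count (\<Sum>x\<in>S. replicate_mset (f x) x) y = (\<Sum>x\<in>S. if x = y then f y else 0)"
      by (subst count_sum) (intro sum.cong, auto)
    thus ?thesis using assms by simp
  qed
  have "bij_betw (\<lambda>X. \<lambda>x\<in>S. count X x) {X. set_mset X = S \<and> (\<forall>x. count X x \<le> m)} (\<Pi>\<^sub>E x\<in>S. {1..m})"
  proof (rule bij_betw_byWitness[where f' = "\<lambda>f. \<Sum>x\<in>S. replicate_mset (f x) x"])
    show "\<forall>X\<in>{X. set_mset X = S \<and> (\<forall>x. count X x \<le> m)}. (\<Sum>x\<in>S. replicate_mset ((\<lambda>x\<in>S. count X x) x) x) = X"
    proof
      fix X assume X: "X \<in> {X. set_mset X = S \<and> (\<forall>x. count X x \<le> m)}"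
      show "(\<Sum>x\<in>S. replicate_mset ((\<lambda>x\<in>S. count X x) x) x) = X"
        unfolding multiset_eq_iff cnt using X not_in_iff by force
    qed
    show "\<forall>f\<in>\<Pi>\<^sub>E x\<in>S. {1..m}. (\<lambda>x\<in>S. count (\<Sum>x\<in>S. replicate_mset (f x) x) x) = f"
      by (auto simp: cnt PiE_iff extensional_def fun_eq_iff)
    show "(\<lambda>X. \<lambda>x\<in>S. count X x) ` {X. set_mset X = S \<and> (\<forall>x. count X x \<le> m)} \<subseteq> (\<Pi>\<^sub>E x\<in>S. {1..m})"
      by (auto simp: PiE_iff Suc_le_eq)
    show "(\<lambda>f. \<Sum>x\<in>S. replicate_mset (f x) x) ` (\<Pi>\<^sub>E x\<in>S. {1..m}) \<subseteq> {X. set_mset X = S \<and> (\<forall>x. count X x \<le> m)}"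
    proof (rule image_subsetI)
      fix f assume f: "f \<in> (\<Pi>\<^sub>E x\<in>S. {1..m})"
      have "x \<in># (\<Sum>x\<in>S. replicate_mset (f x) x) \<longleftrightarrow> x \<in> S" for x
        using cnt[of f x] f by (auto simp: PiE_iff simp flip: count_greater_zero_iff split: if_splits)
      moreover have "count (\<Sum>x\<in>S. replicate_mset (f x) x) x \<le> m" for x
        using cnt[of f x] f by (auto simp: PiE_iff)
      ultimately show "(\<Sum>x\<in>S. replicate_mset (f x) x) \<in> {X. set_mset X = S \<and> (\<forall>x. count X x \<le> m)}" by blast
    qed
  qed
  hence "card {X. set_mset X = S \<and> (\<forall>x. count X x \<le> m)} = card (\<Pi>\<^sub>E x\<in>S. {1..m})" by (rule bij_betw_same_card)
  thus ?thesis using assms by (simp add: card_PiE)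
qed

text \<open>Balancedness only concerns the support. Grouping by it turns the bound m on
  multiplicities into the weight m for each interval, that is, into the substitution x = m.\<close>

lemma card_multisets_balanced:
  "card {X. balanced n (set_mset X) \<and> (\<forall>x. count X x \<le> m)} = (\<Sum>S\<in>{S. balanced n S}. m ^ card S)"
proof -
  let ?B = "\<lambda>S. {X. set_mset X = S \<and> (\<forall>x. count X x \<le> m)}"
  have fS: "finite S" if "balanced n S" for S using that finite_subset[OF balanced_subset finite_intervals] by blast
  \<comment> \<open>Finiteness is read off from the nonzero cardinality \<open>m ^ card S\<close>,
    an argument that needs m > 0.\<close>
  have finB: "finite (?B S)" if "balanced n S" for S
  proof (cases "m = 0")
    case True
    hence "?B S \<subseteq> {{#}}" by (auto simp: multiset_eq_iff)
    thus ?thesis using finite_subset by blast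
  next
    case False
    hence "card (?B S) \<noteq> 0" using card_multisets_with_support[OF fS[OF that], of m] by simp
    thus ?thesis by (meson card.infinite)
  qed
  have "{X. balanced n (set_mset X) \<and> (\<forall>x. count X x \<le> m)} = (\<Union>S\<in>{S. balanced n S}. ?B S)" by auto
  also have "card \<dots> = (\<Sum>S\<in>{S. balanced n S}. card (?B S))"
    by (rule card_UN_disjoint) (use finite_balanced finB in auto)
  also have "\<dots> = (\<Sum>S\<in>{S. balanced n S}. m ^ card S)"
  proof (rule sum.cong[OF refl])
    fix S assume "S \<in> {S. balanced n S}"
    hence "finite S" using fS by blast
    thus "card (?B S) = m ^ card S" by (rule card_multisets_with_support)
  qed
  finally show ?thesis .
qed

lemma num_basic_fb_eq:
  assumes "n \<ge> 1"
  shows "num_basic_fb TYPE('k::field) n s = card {S. balanced n S \<and> card S = s}"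
proof -
  have "M \<in> basic_fb_modules TYPE('k) n \<and> has_num_summands (Tri n) M s \<longleftrightarrow>
      M \<in> tri_modules TYPE('k) n \<and> balanced n (set_mset (barcode n M)) \<and>
      (\<forall>x. count (barcode n M) x \<le> 1) \<and> size (barcode n M) = s" for M
    using faithfully_balanced_iff_balanced[OF _ assms, of M] basic_iff[of n M] has_num_summands_iff[of n M]
    unfolding basic_fb_modules_def fb_modules_def tri_modules_def by blast
  hence "num_basic_fb TYPE('k) n s =
      card {X. set_mset X \<subseteq> intervals n \<and> balanced n (set_mset X) \<and> (\<forall>x. count X x \<le> 1) \<and> size X = s}"
    unfolding num_basic_fb_def
    by (simp only: num_iso_classes_barcode[of n "\<lambda>X. balanced n (set_mset X) \<and> (\<forall>x. count X x \<le> 1) \<and> size X = s"])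
  also have "{X. set_mset X \<subseteq> intervals n \<and> balanced n (set_mset X) \<and> (\<forall>x. count X x \<le> 1) \<and> size X = s} =
      {X. (balanced n (set_mset X) \<and> card (set_mset X) = s) \<and> (\<forall>x. count X x \<le> 1)}"
    using balanced_subset mset_set_set_mset_eq by (metis (no_types, lifting) size_mset_set)
  also have "card \<dots> = card {S. balanced n S \<and> card S = s}"
    by (rule card_multiplicity_free) (use finite_subset[OF balanced_subset finite_intervals] in blast)
  finally show ?thesis .
qed

lemma num_multiplicities_at_most:
  assumes "n \<ge> 1"
  shows "num_iso_classes (Tri n) {M \<in> fb_modules TYPE('k::field) n. multiplicities_at_most (Tri n) m M} =
    (\<Prod>i=1..n. ((1 + m) ^ i - 1))"
proof -
  have "M \<in> fb_modules TYPE('k) n \<and> multiplicities_at_most (Tri n) m M \<longleftrightarrow>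
      M \<in> tri_modules TYPE('k) n \<and> balanced n (set_mset (barcode n M)) \<and> (\<forall>x. count (barcode n M) x \<le> m)" for M
    using faithfully_balanced_iff_balanced[OF _ assms, of M] multiplicities_at_most_iff[of n M m]
    unfolding fb_modules_def tri_modules_def by blast
  hence "num_iso_classes (Tri n) {M \<in> fb_modules TYPE('k) n. multiplicities_at_most (Tri n) m M} =
      card {X. set_mset X \<subseteq> intervals n \<and> balanced n (set_mset X) \<and> (\<forall>x. count X x \<le> m)}"
    by (simp only: num_iso_classes_barcode[of n "\<lambda>X. balanced n (set_mset X) \<and> (\<forall>x. count X x \<le> m)"])
  also have "\<dots> = card {X. balanced n (set_mset X) \<and> (\<forall>x. count X x \<le> m)}"
    by (rule arg_cong[where f = card]) (use balanced_subset in blast)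
  also have "\<dots> = (\<Sum>S\<in>{S. balanced n S}. m ^ card S)" by (rule card_multisets_balanced)
  also have "\<dots> = (\<Prod>i=1..n. ((1 + m) ^ i - 1))"
  proof -
    \<comment> \<open>\<open>sum_balanced\<close> lives in a ring. The way back to natural numbers
      is sound because (1 + m) ^ i is at least 1 and the subtraction does not truncate.\<close>
    have "int (\<Sum>S\<in>{S. balanced n S}. m ^ card S) = (\<Prod>i=1..n. (1 + int m) ^ i - 1)"
      using sum_balanced[OF assms, of "int m"] by simp
    also have "\<dots> = int (\<Prod>i=1..n. ((1 + m) ^ i - 1))" by (simp add: of_nat_diff)
    finally show ?thesis by (simp only: of_nat_eq_iff)
  qed
  finally show ?thesis .
qed

section \<open>Coefficients of the generating function\<close>

lemma fps_balanced:
  assumes "n \<ge> 1"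
  shows "Abs_fps (\<lambda>s. int (card {S. balanced n S \<and> card S = s})) = (\<Prod>i=1..n. ((1 + fps_X) ^ i - 1))"
proof -
  have "Abs_fps (\<lambda>s. int (card {S. balanced n S \<and> card S = s})) = (\<Sum>S\<in>{S. balanced n S}. fps_X ^ card S)"
  proof (rule fps_ext)
    fix s
    have "fps_nth (\<Sum>S\<in>{S. balanced n S}. (fps_X :: int fps) ^ card S) s =
        (\<Sum>S\<in>{S. balanced n S}. if s = card S then 1 else 0)"
      by (simp add: fps_sum_nth fps_X_power_nth)
    also have "\<dots> = int (card {S \<in> {S. balanced n S}. s = card S})"
      using finite_balanced by (subst sum.inter_filter[symmetric]) simp_all
    also have "{S \<in> {S. balanced n S}. s = card S} = {S. balanced n S \<and> card S = s}" by auto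
    finally show "fps_nth (Abs_fps (\<lambda>s. int (card {S. balanced n S \<and> card S = s}))) s =
        fps_nth (\<Sum>S\<in>{S. balanced n S}. fps_X ^ card S) s" by simp
  qed
  thus ?thesis using sum_balanced[OF assms, of "fps_X :: int fps"] by simp
qed

text \<open>Subtracting 1 removes the term j = 0 from the binomial expansion of (1 + x) ^ i, hence
  the lower bound 1 on the indices; then the product is expanded and coefficients are
  compared.\<close>

lemma card_balanced:
  assumes "n \<ge> 1"
  shows "card {S. balanced n S \<and> card S = s} =
    (\<Sum>j \<in> {j \<in> \<Pi>\<^sub>E r\<in>{1..n}. {1..r}. (\<Sum>r=1..n. j r) = s}. \<Prod>r=1..n. (r choose j r))"
proof -
  have bin: "(1 + fps_X) ^ i - 1 = (\<Sum>j\<in>{1..i}. of_nat (i choose j) * fps_X ^ j :: int fps)" for i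
  proof -
    have "(fps_X + 1) ^ i = (\<Sum>j\<le>i. of_nat (i choose j) * fps_X ^ j :: int fps)"
      by (simp add: binomial_ring)
    also have "{..i} = insert 0 {1..i}" by auto
    finally show ?thesis by (simp add: add.commute)
  qed
  let ?J = "\<Pi>\<^sub>E r\<in>{1..n}. {1..r}"
  have finJ: "finite ?J" by (intro finite_PiE) auto
  have "(\<Prod>i=1..n. ((1 + fps_X) ^ i - 1 :: int fps)) = (\<Sum>j\<in>?J. \<Prod>i=1..n. of_nat (i choose j i) * fps_X ^ j i)"
    unfolding bin by (rule prod_sum_PiE) auto
  also have "\<dots> = (\<Sum>j\<in>?J. of_nat (\<Prod>i=1..n. i choose j i) * fps_X ^ (\<Sum>i=1..n. j i))"
    by (simp add: prod.distrib power_sum)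
  finally have "fps_nth (\<Prod>i=1..n. ((1 + fps_X) ^ i - 1 :: int fps)) s =
      (\<Sum>j\<in>?J. fps_nth (of_nat (\<Prod>i=1..n. i choose j i) * fps_X ^ (\<Sum>i=1..n. j i)) s)"
    by (simp add: fps_sum_nth)
  also have "\<dots> = (\<Sum>j\<in>?J. if (\<Sum>i=1..n. j i) = s then int (\<Prod>i=1..n. i choose j i) else 0)"
    by (intro sum.cong refl) (simp add: fps_X_power_mult_right_nth fps_of_nat[symmetric] del: of_nat_prod)
  also have "\<dots> = int (\<Sum>j \<in> {j \<in> ?J. (\<Sum>r=1..n. j r) = s}. \<Prod>r=1..n. (r choose j r))"
    unfolding sum.inter_filter[OF finJ] of_nat_sum by (intro sum.cong refl) simp
  finally have "int (card {S. balanced n S \<and> card S = s}) =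
      int (\<Sum>j \<in> {j \<in> ?J. (\<Sum>r=1..n. j r) = s}. \<Prod>r=1..n. (r choose j r))"
    using fps_balanced[OF assms] by (metis (no_types, lifting) fps_nth_Abs_fps)
  thus ?thesis by (simp only: of_nat_eq_iff)
qed

text \<open>All indices in \<open>card_balanced\<close> are at least 1, so the formula has no terms
  when the size is below n.\<close>

lemma balanced_card_ge:
  assumes "n \<ge> 1" "balanced n S"
  shows "n \<le> card S"
proof (rule ccontr)
  assume "\<not> n \<le> card S"
  have le: "n \<le> (\<Sum>r=1..n. j r)" if "j \<in> (\<Pi>\<^sub>E r\<in>{1..n}. {1..r})" for j
  proof -
    have "(\<Sum>r=1..n. 1) \<le> (\<Sum>r=1..n. j r)" using that by (intro sum_mono) (auto simp: PiE_iff)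
    thus ?thesis by simp
  qed
  have empty: "{j \<in> \<Pi>\<^sub>E r\<in>{1..n}. {1..r}. (\<Sum>r=1..n. j r) = card S} = {}"
  proof (rule equals0I)
    fix j assume "j \<in> {j \<in> \<Pi>\<^sub>E r\<in>{1..n}. {1..r}. (\<Sum>r=1..n. j r) = card S}"
    thus False using le[of j] \<open>\<not> n \<le> card S\<close> by simp
  qed
  have "card {S'. balanced n S' \<and> card S' = card S} = 0"
    by (simp only: card_balanced[OF assms(1)] empty sum.empty)
  moreover have "finite {S'. balanced n S' \<and> card S' = card S}"
    by (rule finite_subset[OF _ finite_balanced]) blast
  ultimately show False using assms(2) by auto
qed

text \<open>A sum of n indices that are at least 1 equals n only if all are 1, and the binomials
  then multiply to n!.\<close>

lemma card_balanced_n: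
  assumes "n \<ge> 1"
  shows "card {S. balanced n S \<and> card S = n} = fact n"
proof -
  have "{j \<in> \<Pi>\<^sub>E r\<in>{1..n}. {1..r}. (\<Sum>r=1..n. j r) = n} = {\<lambda>r\<in>{1..n}. 1}"
  proof
    show "{j \<in> \<Pi>\<^sub>E r\<in>{1..n}. {1..r}. (\<Sum>r=1..n. j r) = n} \<subseteq> {\<lambda>r\<in>{1..n}. 1}"
    proof
      fix j assume "j \<in> {j \<in> \<Pi>\<^sub>E r\<in>{1..n}. {1..r}. (\<Sum>r=1..n. j r) = n}"
      hence j: "j \<in> extensional {1..n}" "\<And>r. r \<in> {1..n} \<Longrightarrow> 1 \<le> j r" "(\<Sum>r=1..n. j r) = n"
        by (auto simp: PiE_iff)
      have "(\<Sum>r=1..n. j r - 1) = (\<Sum>r=1..n. j r) - (\<Sum>r=1..n. 1)"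
        by (rule sum_subtractf_nat) (use j(2) in auto)
      hence "\<forall>r\<in>{1..n}. j r - 1 = 0" using j(3) by simp
      hence "j r = 1" if "r \<in> {1..n}" for r using that j(2)[OF that] by (auto simp: le_antisym)
      thus "j \<in> {\<lambda>r\<in>{1..n}. 1}" using j(1) by (auto simp: extensional_def fun_eq_iff)
    qed
  qed (auto simp: PiE_iff)
  hence "card {S. balanced n S \<and> card S = n} = (\<Prod>r=1..n. (r choose (\<lambda>r\<in>{1..n}. 1) r))"
    unfolding card_balanced[OF assms] by simp
  also have "\<dots> = (\<Prod>r=1..n. r)" by (intro prod.cong) auto
  finally show ?thesis by (simp add: fact_prod)
qed

text \<open>The indices fall short of their maxima by 1 in total, so exactly one of them is r0 - 1
  in place of r0, contributing the binomial r0. Here r0 \<ge> 2 because the first index is forced to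
  be 1, and 2 + ... + n = N - 1.\<close>

lemma card_balanced_max_minus_one:
  assumes "n \<ge> 1"
  defines "N \<equiv> n * (n + 1) div 2"
  shows "card {S. balanced n S \<and> card S = N - 1} = N - 1"
proof -
  have N: "(\<Sum>r=1..n. r) = N" unfolding N_def using gauss_sum_nat[of n] by (simp add: atLeast0AtMost sum.atLeast_Suc_atMost flip: atLeast0AtMost)
  have N1: "N \<ge> 1" unfolding N[symmetric] using assms(1) by (simp add: sum.atLeast_Suc_atMost)
  define J where "J = (\<lambda>r0. \<lambda>r\<in>{1..n}. if r = r0 then r - 1 else r)"
  have set: "{j \<in> \<Pi>\<^sub>E r\<in>{1..n}. {1..r}. (\<Sum>r=1..n. j r) = N - 1} = J ` {2..n}"
  proof
    show "{j \<in> \<Pi>\<^sub>E r\<in>{1..n}. {1..r}. (\<Sum>r=1..n. j r) = N - 1} \<subseteq> J ` {2..n}"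
    proof
      fix j assume "j \<in> {j \<in> \<Pi>\<^sub>E r\<in>{1..n}. {1..r}. (\<Sum>r=1..n. j r) = N - 1}"
      hence j: "j \<in> extensional {1..n}" "\<And>r. r \<in> {1..n} \<Longrightarrow> 1 \<le> j r \<and> j r \<le> r" "(\<Sum>r=1..n. j r) = N - 1"
        by (auto simp: PiE_iff)
      have "(\<Sum>r=1..n. r - j r) = (\<Sum>r=1..n. r) - (\<Sum>r=1..n. j r)"
        by (rule sum_subtractf_nat) (use j(2) in auto)
      hence "(\<Sum>r=1..n. r - j r) = 1" using j(3) N N1 by simp
      then obtain r0 where r0: "r0 \<in> {1..n}" "r0 - j r0 = 1" "\<forall>r\<in>{1..n}. r0 \<noteq> r \<longrightarrow> r - j r = 0"
        using sum_eq_1_iff[of "{1..n}" "\<lambda>r. r - j r"] by auto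
      have "j r = J r0 r" for r
      proof (cases "r \<in> {1..n}")
        case True
        thus ?thesis using r0 j(2)[OF True] by (cases "r = r0") (auto simp: J_def)
      next
        case False
        thus ?thesis using extensional_arb[OF j(1) False] by (simp only: J_def restrict_apply if_False)
      qed
      hence "j = J r0" by blast
      moreover have "r0 \<in> {2..n}" using r0(1,2) j(2)[OF r0(1)] by auto
      ultimately show "j \<in> J ` {2..n}" by blast
    qed
    show "J ` {2..n} \<subseteq> {j \<in> \<Pi>\<^sub>E r\<in>{1..n}. {1..r}. (\<Sum>r=1..n. j r) = N - 1}"
    proof (rule image_subsetI)
      fix r0 assume r0: "r0 \<in> {2..n}"
      have r0': "r0 \<in> {1..n}" using r0 by auto
      have "(\<Sum>r=1..n. J r0 r) = (r0 - 1) + (\<Sum>r\<in>{1..n} - {r0}. J r0 r)"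
        using sum.remove[of "{1..n}" r0 "J r0"] r0 by (simp add: J_def)
      also have "(\<Sum>r\<in>{1..n} - {r0}. J r0 r) = (\<Sum>r\<in>{1..n} - {r0}. r)" by (intro sum.cong) (auto simp: J_def)
      finally have "(\<Sum>r=1..n. J r0 r) = N - 1"
        using sum.remove[of "{1..n}" r0 "\<lambda>r. r"] r0 N by simp
      moreover have "J r0 \<in> (\<Pi>\<^sub>E r\<in>{1..n}. {1..r})" using r0 by (auto simp: J_def PiE_iff)
      ultimately show "J r0 \<in> {j \<in> \<Pi>\<^sub>E r\<in>{1..n}. {1..r}. (\<Sum>r=1..n. j r) = N - 1}" by blast
    qed
  qed
  have inj: "inj_on J {2..n}"
  proof (rule inj_onI)
    fix r r' assume r: "r \<in> {2..n}" "r' \<in> {2..n}" "J r = J r'"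
    hence "J r r = J r' r" by simp
    thus "r = r'" using r by (auto simp: J_def split: if_splits)
  qed
  have val: "(\<Prod>r=1..n. (r choose J r0 r)) = r0" if r0: "r0 \<in> {2..n}" for r0
  proof -
    have "(\<Prod>r=1..n. (r choose J r0 r)) = (\<Prod>r=1..n. if r = r0 then r0 else 1)"
    proof (rule prod.cong[OF refl])
      fix r assume r: "r \<in> {1..n}"
      show "(r choose J r0 r) = (if r = r0 then r0 else 1)"
        using r r0 binomial_symmetric[of 1 r0] by (auto simp: J_def)
    qed
    thus ?thesis using r0 by simp
  qed
  have "card {S. balanced n S \<and> card S = N - 1} = (\<Sum>r0\<in>{2..n}. r0)"
    unfolding card_balanced[OF assms(1)] set using val by (simp add: sum.reindex[OF inj])
  also have "\<dots> = N - 1"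
  proof -
    have "{1..n} = insert 1 {2..n}" using assms(1) by auto
    thus ?thesis using N by simp
  qed
  finally show ?thesis .
qed

section \<open>The sum of all indecomposable modules\<close>

lemma card_intervals: "card (intervals n) = n * (n + 1) div 2"
proof (induction n)
  case 0
  show ?case by (simp add: intervals_def)
next
  case (Suc m)
  have "intervals (Suc m) = {..m} \<times> {m} \<union> intervals m" by (auto simp: intervals_def)
  thus ?case using card_column_Un[of "{..m}" m "intervals m"] Suc.IH by simp
qed

lemma balanced_intervals:
  assumes "n \<ge> 1" shows "balanced n (intervals n)"
  unfolding balanced_def
proof (intro conjI ballI allI impI)
  fix z assume z: "z \<in> intervals n"
  obtain a b where ab: "z = (a, b)" "a \<le> b" "b < n" using z by (auto simp: intervals_def)
  have "(a, b) = (0, n - 1) \<or> (0 < a \<and> (0, b) \<in> intervals n) \<or> (b < n - 1 \<and> (a, n - 1) \<in> intervals n)"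
    using ab assms by (auto simp: intervals_def)
  thus "case z of (a, b) \<Rightarrow> (a, b) = (0, n - 1) \<or> (\<exists>c<a. (c, b) \<in> intervals n) \<or> (\<exists>d>b. (a, d) \<in> intervals n)"
    using ab(1) by auto
next
  fix p assume "1 \<le> p \<and> p < n"
  hence "(p, p) \<in> intervals n" by (simp add: intervals_def)
  thus "(\<exists>b. (p, b) \<in> intervals n) \<or> (\<exists>a. (a, p - 1) \<in> intervals n)" by blast
qed (use assms in \<open>auto simp: intervals_def\<close>)

text \<open>Sending a representative to its interval is a bijection from \<open>T\<close> onto all
  intervals: injective because \<open>T\<close> has one module per class, surjective because
  interval modules are indecomposable. In particular \<open>T\<close> is finite.\<close>

lemma indec_representatives_direct_sum:
  fixes T :: "'k::field tri_module set"
  assumes T: "indec_representatives TYPE('k) n T"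
  shows "fg_module (Tri n) (direct_sum T (\<lambda>X. X))"
    and "barcode n (direct_sum T (\<lambda>X. X)) = mset_set (intervals n)"
proof -
  have fg: "fg_module (Tri n) X" and ind: "indecomposable (Tri n) X" if "X \<in> T" for X
    using T that by (auto simp: indec_representatives_def tri_modules_def)
  have rep: "\<exists>!X. X \<in> T \<and> mod_iso (Tri n) Y X" if "fg_module (Tri n) Y" "indecomposable (Tri n) Y"
    for Y :: "'k tri_module"
    using T that unfolding indec_representatives_def tri_modules_def by blast
  have "\<forall>X\<in>T. \<exists>y. y \<in> intervals n \<and> mod_iso (Tri n) X (bar [y])"
    using indecomposable_interval[OF fg ind] by metis
  then obtain y where y: "\<And>X. X \<in> T \<Longrightarrow> y X \<in> intervals n" "\<And>X. X \<in> T \<Longrightarrow> mod_iso (Tri n) X (bar [y X])"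
    by metis
  have bc: "barcode n X = {#y X#}" if "X \<in> T" for X
    using barcode_eqI[OF fg_left_module[OF fg[OF that]] _ y(2)[OF that]] y(1)[OF that] by simp
  have inj: "inj_on y T"
  proof (rule inj_onI)
    fix X X' assume X: "X \<in> T" "X' \<in> T" "y X = y X'"
    have "mod_iso (Tri n) X X'" "mod_iso (Tri n) X X"
      using mod_iso_iff_barcode[OF fg fg] bc X by auto
    thus "X = X'" using rep[OF fg[OF X(1)] ind[OF X(1)]] X by blast
  qed
  have "intervals n \<subseteq> y ` T"
  proof
    fix z assume z: "z \<in> intervals n"
    hence zs: "set [z] \<subseteq> intervals n" by simp
    obtain Y :: "'k tri_module" where Y: "fg_module (Tri n) Y" "mod_iso (Tri n) Y (bar [z])"
      by (rule exists_tri_module[OF zs])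
    have "(fst z, snd z) \<in> intervals n" using z by simp
    from bar_indecomposable[OF this] have "indecomposable (Tri n) (bar [z] :: ('k mat, _) module)" by simp
    hence "indecomposable (Tri n) Y"
      by (rule indecomposable_mod_iso[OF bar_left_module[OF zs] fg_left_module[OF Y(1)]
            mod_iso_sym[OF fg_left_module[OF Y(1)] bar_left_module[OF zs] Y(2)]])
    then obtain X where X: "X \<in> T" "mod_iso (Tri n) Y X" using rep[OF Y(1)] by blast
    have "barcode n Y = {#z#}" using barcode_eqI[OF fg_left_module[OF Y(1)] zs Y(2)] by simp
    hence "y X = z" using mod_iso_iff_barcode[OF Y(1) fg[OF X(1)]] X bc by simp
    thus "z \<in> y ` T" using X(1) by blast
  qed
  hence bij: "bij_betw y T (intervals n)" using inj y(1) by (auto simp: bij_betw_def)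
  hence finT: "finite T" using finite_intervals bij_betw_finite by blast
  obtain ys where ys: "set ys = intervals n" "distinct ys"
    using finite_distinct_list[OF finite_intervals] by blast
  have bij_nth: "bij_betw (\<lambda>t. ys ! t) {..<length ys} (intervals n)"
    using bij_betw_nth[OF ys(2)] ys(1) by blast
  define \<sigma> where "\<sigma> = (\<lambda>X. inv_into {..<length ys} (\<lambda>t. ys ! t) (y X))"
  have \<sigma>: "bij_betw \<sigma> T {..<length ys}"
    unfolding \<sigma>_def using bij_betw_trans[OF bij bij_betw_inv_into[OF bij_nth]] by (simp add: comp_def)
  have ys': "set ys \<subseteq> intervals n" using ys(1) by simp
  have nth: "ys ! \<sigma> X = y X" if "X \<in> T" for X
    unfolding \<sigma>_def using bij_betw_inv_into_right[OF bij_nth y(1)[OF that]] by simp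
  have D: "left_module (Tri n) (direct_sum T (\<lambda>X. X))" "mod_iso (Tri n) (direct_sum T (\<lambda>X. X)) (bar ys)"
    by (rule direct_sum_intervals_iso[OF finT \<sigma> ys']; use fg_left_module[OF fg] y(2) nth in simp)+
  show "fg_module (Tri n) (direct_sum T (\<lambda>X. X))"
    by (rule fg_module_mod_iso[OF bar_fg[OF ys'] D(1) mod_iso_sym[OF D(1) bar_left_module[OF ys'] D(2)]])
  show "barcode n (direct_sum T (\<lambda>X. X)) = mset_set (intervals n)"
    using barcode_eqI[OF D(1) ys' D(2)] ys by (metis mset_set_set)
qed

theorem corollary6p3:
  fixes n N :: nat and \<Lambda> :: "'k::field mat ring"
  assumes "n \<ge> 1"
  defines "\<Lambda> \<equiv> lower_tri_algebra TYPE('k) n"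
    and "N \<equiv> n * (n + 1) div 2"
  shows
    "Abs_fps (\<lambda>s. int (num_basic_fb TYPE('k) n s)) = (\<Prod>i=1..n. ((1 + fps_X) ^ i - 1))
     \<and>
     (\<forall>s. num_basic_fb TYPE('k) n s =
       (\<Sum>j \<in> {j \<in> \<Pi>\<^sub>E r\<in>{1..n}. {1..r}. (\<Sum>r=1..n. j r) = s}. \<Prod>r=1..n. (r choose j r)))
     \<and>
     num_iso_classes \<Lambda> (basic_fb_modules TYPE('k) n) = (\<Prod>i=1..n. (2 ^ i - 1))
     \<and>
     (\<forall>m. num_iso_classes \<Lambda> {M \<in> fb_modules TYPE('k) n. multiplicities_at_most \<Lambda> m M}
       = (\<Prod>i=1..n. ((1 + m) ^ i - 1)))
     \<and>
     (\<forall>M\<in>basic_fb_modules TYPE('k) n. \<forall>s. has_num_summands \<Lambda> M s \<longrightarrow> n \<le> s)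
     \<and>
     num_basic_fb TYPE('k) n n = fact n
     \<and>
     (\<forall>T. indec_representatives TYPE('k) n T \<longrightarrow>
       fg_module \<Lambda> (direct_sum T (\<lambda>X. X)) \<and>
       faithfully_balanced \<Lambda> (direct_sum T (\<lambda>X. X)) \<and>
       has_num_summands \<Lambda> (direct_sum T (\<lambda>X. X)) N)
     \<and>
     num_basic_fb TYPE('k) n (N - 1) = N - 1"
  unfolding \<Lambda>_def num_basic_fb_eq[OF assms(1), where 'k = 'k]
proof (intro conjI allI ballI impI)
  show "Abs_fps (\<lambda>s. int (card {S. balanced n S \<and> card S = s})) = (\<Prod>i=1..n. ((1 + fps_X) ^ i - 1))"
    by (rule fps_balanced[OF assms(1)])
  show "card {S. balanced n S \<and> card S = s} =
      (\<Sum>j \<in> {j \<in> \<Pi>\<^sub>E r\<in>{1..n}. {1..r}. (\<Sum>r=1..n. j r) = s}. \<Prod>r=1..n. (r choose j r))" for s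
    by (rule card_balanced[OF assms(1)])
  show "num_iso_classes (Tri n) {M \<in> fb_modules TYPE('k) n. multiplicities_at_most (Tri n) m M}
      = (\<Prod>i=1..n. ((1 + m) ^ i - 1))" for m
    by (rule num_multiplicities_at_most[OF assms(1)])
  \<comment> \<open>Basic modules are the case of multiplicities at most 1, so their number is the
    case m = 1 of the count with bounded multiplicities.\<close>
  have "M \<in> basic_fb_modules TYPE('k) n \<longleftrightarrow> M \<in> fb_modules TYPE('k) n \<and> multiplicities_at_most (Tri n) 1 M" for M
    using basic_iff[of n M] multiplicities_at_most_iff[of n M 1]
    unfolding basic_fb_modules_def fb_modules_def tri_modules_def by blast
  hence "basic_fb_modules TYPE('k) n = {M \<in> fb_modules TYPE('k) n. multiplicities_at_most (Tri n) 1 M}"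
    by blast
  thus "num_iso_classes (Tri n) (basic_fb_modules TYPE('k) n) = (\<Prod>i=1..n. (2 ^ i - 1))"
    using num_multiplicities_at_most[OF assms(1), of 1, where 'k = 'k] by (simp add: numeral_2_eq_2)
  show "n \<le> s" if M: "M \<in> basic_fb_modules TYPE('k) n" and s: "has_num_summands (Tri n) M s" for M s
  proof -
    have fg: "fg_module (Tri n) M" and "faithfully_balanced (Tri n) M"
      using M by (auto simp: basic_fb_modules_def fb_modules_def tri_modules_def)
    hence "n \<le> card (set_mset (barcode n M))"
      using balanced_card_ge[OF assms(1)] faithfully_balanced_iff_balanced[OF fg assms(1)] by blast
    also have "\<dots> \<le> size (barcode n M)"
      by (metis card_length ex_mset set_mset_mset size_mset)
    finally show ?thesis using s has_num_summands_iff[OF fg] by simp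
  qed
  show "card {S. balanced n S \<and> card S = n} = fact n" by (rule card_balanced_n[OF assms(1)])
  show "card {S. balanced n S \<and> card S = N - 1} = N - 1"
    unfolding N_def by (rule card_balanced_max_minus_one[OF assms(1)])
  fix T assume T: "indec_representatives TYPE('k) n T"
  note D = indec_representatives_direct_sum[OF T]
  show "fg_module (Tri n) (direct_sum T (\<lambda>X. X))" by (rule D(1))
  show "faithfully_balanced (Tri n) (direct_sum T (\<lambda>X. X))"
    using faithfully_balanced_iff_balanced[OF D(1) assms(1)] D(2) balanced_intervals[OF assms(1)]
    by (simp add: finite_intervals)
  show "has_num_summands (Tri n) (direct_sum T (\<lambda>X. X)) N"
    using has_num_summands_iff[OF D(1)] D(2) by (simp add: card_intervals N_def)
qed

end
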